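(* Let $(M,g)$ be a complete finite-dimensional Riemannian manifold, let $E\subseteq M$ be star-shaped at $p_0\in E$, and let $f,g_1,\dots,g_m:E\to\mathbb{R}$. Consider the problem of minimizing $f(p)$ subject to $g_i(p)\le 0$, $i\in\{1,\dots,m\}$, with feasible set $X=\{p\in E: g_i(p)\le 0,\ 1\le i\le m\}$. Let $p_0\in X$ and $J=\{i: g_i(p_0)=0\}$. Suppose that $f$ and the constraints $g_i$, $i\in J$, are convex at $p_0$, and that $f$ and all $g_i$, $i\in\{1,\dots,m\}$, are directionally differentiable at $p_0$. Suppose there exist real scalars $\mu_i\ge 0$, $i\in\{1,\dots,m\}$, such that (i) $Df(p_0;X_{p_0})+\sum_{i=1}^m\mu_i\,Dg_i(p_0;X_{p_0})\ge 0$ for all $X_{p_0}\in T_{p_0}(E)$; (ii) $\mu_i g_i(p_0)=0$ for all $i\in\{1,\dots,m\}$. Then $p_0$ is an optimal solution of the problem. Moreover, if $f$ is non-constant on $X$ (in the sense defined in the context), then $p_0$ is a strict optimal solution of the problem.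
   Context: Star-shaped: $E\subseteq M$ is star-shaped at $p_0\in E$ if for every $p\in E$ and every geodesic $\gamma:[0,1]\to M$ with $\gamma(0)=p_0$, $\gamma(1)=p$, one has $\gamma(s)\in E$ for all $s\in(0,1)$. Convexity at a point: for $E$ star-shaped at $p_0$, $h:E\to\mathbb{R}$ is convex at $p_0$ if $h(\gamma(s))\le(1-s)h(p_0)+s\,h(p)$ for all $p\in E$, every geodesic $\gamma:[0,1]\to M$ with $\gamma(0)=p_0$, $\gamma(1)=p$, and all $s\in(0,1)$. Tangent directions and directional derivative: $T_{p_0}(E)$ denotes the set of vectors $X_{p_0}\in T_{p_0}M$ for which there is a geodesic $\gamma:I\to M$, $I\subseteq\mathbb{R}$ an interval containing $[0,\varepsilon)$ for some $\varepsilon>0$, with $\gamma(I)\subseteq E$, $\gamma(0)=p_0$, $\dot\gamma(0)=X_{p_0}$. For such $X_{p_0}$ and $\gamma$, the directional derivative of $h:E\to\mathbb{R}$ is $Dh(p_0;X_{p_0})=\lim_{s\to0^+}\frac{h(\gamma(s))-h(p_0)}{s}$ if this limit exists; $h$ is directionally differentiable at $p_0$ if $Dh(p_0;X_{p_0})$ exists for every $X_{p_0}\in T_{p_0}(E)$. Non-constant (paper's definition): $f$ is non-constant on $X$ if for all $p,q\in X$ with $p\ne q$ one has $f(p)\neq f(q)$. Optimal solution: $p_0\in X$ is an optimal solution if there is no $p\in X$ with $f(p)<f(p_0)$; it is a strict optimal solution if there is no $p\in X$, $p\neq p_0$, with $f(p)\le f(p_0)$.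
   Formalization: The manifold M is assumed connected (the usual convention) and of dimension at least 1; for a disconnected M the claim fails, since points of E in another component are reached by no geodesic from p_0. *)

theory Defs
  imports "HOL-Analysis.Analysis"
begin

section \<open>Smooth manifolds\<close>

fun Ck_on :: "nat \<Rightarrow> 'a::real_normed_vector set \<Rightarrow> ('a \<Rightarrow> 'b::real_normed_vector) \<Rightarrow> bool" where
  "Ck_on 0 S f \<longleftrightarrow> continuous_on S f"
| "Ck_on (Suc k) S f \<longleftrightarrow> (\<forall>x\<in>S. f differentiable (at x)) \<and>
      (\<forall>v. Ck_on k S (\<lambda>x. frechet_derivative f (at x) v))"

text \<open>Only used for open \<open>S\<close> in a finite-dimensional space, where continuity of all
  directional derivatives up to order \<open>k\<close> amounts to being of class \<open>C\<^sup>k\<close>.\<close>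

definition smooth_on :: "'a::real_normed_vector set \<Rightarrow> ('a \<Rightarrow> 'b::real_normed_vector) \<Rightarrow> bool" where
  "smooth_on S f \<longleftrightarrow> (\<forall>k. Ck_on k S f)"

text \<open>The manifold is the whole type \<open>'m\<close>; a chart is a pair of its domain and its coordinate
  map, whose values outside the domain are irrelevant. The dimension of the manifold is
  \<open>DIM('e)\<close>.\<close>

type_synonym ('m, 'e) chart = "'m set \<times> ('m \<Rightarrow> 'e)"

abbreviation cdom :: "('m, 'e) chart \<Rightarrow> 'm set" where "cdom \<equiv> fst"
abbreviation cmap :: "('m, 'e) chart \<Rightarrow> 'm \<Rightarrow> 'e" where "cmap \<equiv> snd"

definition cinv :: "('m, 'e) chart \<Rightarrow> 'e \<Rightarrow> 'm" where
  "cinv \<phi> = inv_into (cdom \<phi>) (cmap \<phi>)"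

definition transition :: "('m, 'e) chart \<Rightarrow> ('m, 'e) chart \<Rightarrow> 'e \<Rightarrow> 'e" where
  "transition \<phi> \<psi> = cmap \<psi> \<circ> cinv \<phi>"

definition is_chart :: "('m::topological_space, 'e::euclidean_space) chart \<Rightarrow> bool" where
  "is_chart \<phi> \<longleftrightarrow> open (cdom \<phi>) \<and> open (cmap \<phi> ` cdom \<phi>) \<and>
     homeomorphism (cdom \<phi>) (cmap \<phi> ` cdom \<phi>) (cmap \<phi>) (cinv \<phi>)"

definition smooth_atlas ::
    "('m::{t2_space, second_countable_topology}, 'e::euclidean_space) chart set \<Rightarrow> bool" where
  "smooth_atlas A \<longleftrightarrow>
     (\<forall>\<phi>\<in>A. is_chart \<phi>) \<and> (\<Union>\<phi>\<in>A. cdom \<phi>) = UNIV \<and>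
     (\<forall>\<phi>\<in>A. \<forall>\<psi>\<in>A. smooth_on (cmap \<phi> ` (cdom \<phi> \<inter> cdom \<psi>)) (transition \<phi> \<psi>))"

text \<open>A tangent vector at \<open>p\<close> is given by its coordinate vectors in all charts around \<open>p\<close>,
  related to each other by the differentials of the transition maps. (The value 0 at all other
  arguments makes this representation unique.)\<close>

type_synonym ('m, 'e) tvector = "('m, 'e) chart \<Rightarrow> 'e"

definition tangent_space ::
    "('m, 'e::euclidean_space) chart set \<Rightarrow> 'm \<Rightarrow> ('m, 'e) tvector set" where
  "tangent_space A p =
     {X. (\<forall>\<phi>\<in>A. \<forall>\<psi>\<in>A. p \<in> cdom \<phi> \<inter> cdom \<psi> \<longrightarrow>
            X \<psi> = frechet_derivative (transition \<phi> \<psi>) (at (cmap \<phi> p)) (X \<phi>)) \<and>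
         (\<forall>\<phi>. \<not> (\<phi> \<in> A \<and> p \<in> cdom \<phi>) \<longrightarrow> X \<phi> = 0)}"

text \<open>One-sided derivatives are used at endpoints of \<open>I\<close> that belong to \<open>I\<close>.\<close>

definition velocity ::
    "('m, 'e::euclidean_space) chart set \<Rightarrow> real set \<Rightarrow> (real \<Rightarrow> 'm) \<Rightarrow> real \<Rightarrow> ('m, 'e) tvector" where
  "velocity A I \<gamma> t =
     (\<lambda>\<phi>. if \<phi> \<in> A \<and> \<gamma> t \<in> cdom \<phi> then vector_derivative (cmap \<phi> \<circ> \<gamma>) (at t within I) else 0)"

section \<open>Riemannian metrics\<close>

text \<open>A metric is given by its coordinate expressions: \<open>G \<phi> x u v\<close> is
  \<open>\<Sum>i j. g\<^sub>i\<^sub>j(x) u\<^sub>i v\<^sub>j\<close>, where the \<open>g\<^sub>i\<^sub>j\<close> are the components in the chart \<open>\<phi>\<close> at the point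
  with coordinates \<open>x\<close>.\<close>

type_synonym ('m, 'e) metric = "('m, 'e) chart \<Rightarrow> 'e \<Rightarrow> 'e \<Rightarrow> 'e \<Rightarrow> real"

definition riemannian_metric ::
    "('m, 'e::euclidean_space) chart set \<Rightarrow> ('m, 'e) metric \<Rightarrow> bool" where
  "riemannian_metric A G \<longleftrightarrow>
     (\<forall>\<phi>\<in>A. \<forall>x\<in>cmap \<phi> ` cdom \<phi>.
        bilinear (G \<phi> x) \<and> (\<forall>u v. G \<phi> x u v = G \<phi> x v u) \<and> (\<forall>u. u \<noteq> 0 \<longrightarrow> G \<phi> x u u > 0)) \<and>
     (\<forall>\<phi>\<in>A. \<forall>u v. smooth_on (cmap \<phi> ` cdom \<phi>) (\<lambda>x. G \<phi> x u v)) \<and>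
     (\<forall>\<phi>\<in>A. \<forall>\<psi>\<in>A. \<forall>p\<in>cdom \<phi> \<inter> cdom \<psi>. \<forall>u v.
        let D = frechet_derivative (transition \<phi> \<psi>) (at (cmap \<phi> p))
        in G \<phi> (cmap \<phi> p) u v = G \<psi> (cmap \<psi> p) (D u) (D v))"

text \<open>The bilinear form \<open>\<Gamma>\<^sup>k\<^sub>i\<^sub>j u\<^sup>i v\<^sup>j\<close> of the Christoffel symbols of the Levi-Civita connection; the
  index is raised by \<open>THE\<close>, the metric being nondegenerate.\<close>

definition christoffel ::
    "('m, 'e::euclidean_space) metric \<Rightarrow> ('m, 'e) chart \<Rightarrow> 'e \<Rightarrow> 'e \<Rightarrow> 'e \<Rightarrow> 'e" where
  "christoffel G \<phi> x u v =
     (THE z. \<forall>w. G \<phi> x z w =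
        (frechet_derivative (\<lambda>y. G \<phi> y v w) (at x) u
       + frechet_derivative (\<lambda>y. G \<phi> y u w) (at x) v
       - frechet_derivative (\<lambda>y. G \<phi> y u v) (at x) w) / 2)"

text \<open>Geodesics on an interval \<open>I\<close>, possibly constant: continuous curves whose coordinate
  expressions \<open>c\<close> in all charts satisfy \<open>c'' + \<Gamma>(c)(c', c') = 0\<close>. Smoothness follows.\<close>

definition geodesic ::
    "('m::topological_space, 'e::euclidean_space) chart set \<Rightarrow> ('m, 'e) metric \<Rightarrow>
     real set \<Rightarrow> (real \<Rightarrow> 'm) \<Rightarrow> bool" where
  "geodesic A G I \<gamma> \<longleftrightarrow> is_interval I \<and> continuous_on I \<gamma> \<and>
     (\<forall>\<phi>\<in>A. \<exists>v. \<forall>t\<in>I. \<gamma> t \<in> cdom \<phi> \<longrightarrow>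
        (cmap \<phi> \<circ> \<gamma> has_vector_derivative v t) (at t within I) \<and>
        (v has_vector_derivative - christoffel G \<phi> (cmap \<phi> (\<gamma> t)) (v t) (v t)) (at t within I))"

section \<open>Riemannian distance and completeness\<close>

definition C1_curve ::
    "('m, 'e::euclidean_space) chart set \<Rightarrow> real set \<Rightarrow> (real \<Rightarrow> 'm) \<Rightarrow> bool" where
  "C1_curve A I c \<longleftrightarrow>
     (\<forall>\<phi>\<in>A. let T = {t \<in> I. c t \<in> cdom \<phi>} in
        \<exists>v. continuous_on T v \<and>
            (\<forall>t\<in>T. (cmap \<phi> \<circ> c has_vector_derivative v t) (at t within I)))"

text \<open>There are finitely many break points (including both endpoints) such that the curve is
  \<open>C\<^sup>1\<close>, with one-sided derivatives at the ends, on each closed interval between consecutive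
  break points.\<close>

definition piecewise_C1_curve ::
    "('m::topological_space, 'e::euclidean_space) chart set \<Rightarrow> (real \<Rightarrow> 'm) \<Rightarrow> bool" where
  "piecewise_C1_curve A c \<longleftrightarrow> continuous_on {0..1} c \<and>
     (\<exists>S. finite S \<and> 0 \<in> S \<and> 1 \<in> S \<and> S \<subseteq> {0..1} \<and>
        (\<forall>a\<in>S. \<forall>b\<in>S. a < b \<and> S \<inter> {a<..<b} = {} \<longrightarrow> C1_curve A {a..b} c))"

text \<open>The chart used at a point does not matter, by the transformation law of \<open>G\<close>. The values
  of the speed at the finitely many break points do not affect the length.\<close>

definition speed ::
    "('m, 'e::euclidean_space) chart set \<Rightarrow> ('m, 'e) metric \<Rightarrow> (real \<Rightarrow> 'm) \<Rightarrow> real \<Rightarrow> real" where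
  "speed A G c t =
     (let \<phi> = (SOME \<phi>. \<phi> \<in> A \<and> c t \<in> cdom \<phi>); v = velocity A {0..1} c t \<phi>
      in sqrt (G \<phi> (cmap \<phi> (c t)) v v))"

definition curve_length ::
    "('m, 'e::euclidean_space) chart set \<Rightarrow> ('m, 'e) metric \<Rightarrow> (real \<Rightarrow> 'm) \<Rightarrow> real" where
  "curve_length A G c = integral {0..1} (speed A G c)"

definition riemannian_dist ::
    "('m::topological_space, 'e::euclidean_space) chart set \<Rightarrow> ('m, 'e) metric \<Rightarrow> 'm \<Rightarrow> 'm \<Rightarrow> real" where
  "riemannian_dist A G p q =
     Inf {curve_length A G c | c. piecewise_C1_curve A c \<and> c 0 = p \<and> c 1 = q}"

text \<open>Connected (so that the distance is finite) and complete as a metric space.\<close>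

definition complete_riemannian_manifold ::
    "('m::{t2_space, second_countable_topology}, 'e::euclidean_space) chart set \<Rightarrow>
     ('m, 'e) metric \<Rightarrow> bool" where
  "complete_riemannian_manifold A G \<longleftrightarrow>
     smooth_atlas A \<and> riemannian_metric A G \<and> connected (UNIV :: 'm set) \<and>
     Metric_space.mcomplete UNIV (riemannian_dist A G)"

section \<open>Optimization notions\<close>

text \<open>Real functions on \<open>E\<close> are total functions whose values outside \<open>E\<close> are never used.\<close>

definition star_shaped_at ::
    "('m::topological_space, 'e::euclidean_space) chart set \<Rightarrow> ('m, 'e) metric \<Rightarrow>
     'm set \<Rightarrow> 'm \<Rightarrow> bool" where
  "star_shaped_at A G E p0 \<longleftrightarrow> p0 \<in> E \<and>
     (\<forall>p\<in>E. \<forall>\<gamma>. geodesic A G {0..1} \<gamma> \<and> \<gamma> 0 = p0 \<and> \<gamma> 1 = p \<longrightarrow> (\<forall>s\<in>{0<..<1}. \<gamma> s \<in> E))"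

definition convex_at ::
    "('m::topological_space, 'e::euclidean_space) chart set \<Rightarrow> ('m, 'e) metric \<Rightarrow>
     'm set \<Rightarrow> ('m \<Rightarrow> real) \<Rightarrow> 'm \<Rightarrow> bool" where
  "convex_at A G E h p0 \<longleftrightarrow>
     (\<forall>p\<in>E. \<forall>\<gamma>. geodesic A G {0..1} \<gamma> \<and> \<gamma> 0 = p0 \<and> \<gamma> 1 = p \<longrightarrow>
        (\<forall>s\<in>{0<..<1}. h (\<gamma> s) \<le> (1 - s) * h p0 + s * h p))"

definition geodesic_in_direction ::
    "('m::topological_space, 'e::euclidean_space) chart set \<Rightarrow> ('m, 'e) metric \<Rightarrow>
     'm set \<Rightarrow> 'm \<Rightarrow> ('m, 'e) tvector \<Rightarrow> real set \<Rightarrow> (real \<Rightarrow> 'm) \<Rightarrow> bool" where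
  "geodesic_in_direction A G E p0 X I \<gamma> \<longleftrightarrow>
     geodesic A G I \<gamma> \<and> (\<exists>\<epsilon>>0. {0..<\<epsilon>} \<subseteq> I) \<and> \<gamma> ` I \<subseteq> E \<and> \<gamma> 0 = p0 \<and> velocity A I \<gamma> 0 = X"

definition tangent_directions ::
    "('m::topological_space, 'e::euclidean_space) chart set \<Rightarrow> ('m, 'e) metric \<Rightarrow>
     'm set \<Rightarrow> 'm \<Rightarrow> ('m, 'e) tvector set" where
  "tangent_directions A G E p0 =
     {X \<in> tangent_space A p0. \<exists>I \<gamma>. geodesic_in_direction A G E p0 X I \<gamma>}"

text \<open>The limit is required along every geodesic in \<open>E\<close> with initial velocity \<open>X\<close>. Any two of
  these agree on some \<open>[0, \<epsilon>)\<close> by uniqueness of geodesics, so requiring it along one of them would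
  be the same.\<close>

definition has_dir_derivative ::
    "('m::topological_space, 'e::euclidean_space) chart set \<Rightarrow> ('m, 'e) metric \<Rightarrow>
     'm set \<Rightarrow> ('m \<Rightarrow> real) \<Rightarrow> 'm \<Rightarrow> ('m, 'e) tvector \<Rightarrow> real \<Rightarrow> bool" where
  "has_dir_derivative A G E h p0 X L \<longleftrightarrow>
     (\<forall>I \<gamma>. geodesic_in_direction A G E p0 X I \<gamma> \<longrightarrow>
        ((\<lambda>s. (h (\<gamma> s) - h p0) / s) \<longlongrightarrow> L) (at_right 0))"

definition dir_derivative ::
    "('m::topological_space, 'e::euclidean_space) chart set \<Rightarrow> ('m, 'e) metric \<Rightarrow>
     'm set \<Rightarrow> ('m \<Rightarrow> real) \<Rightarrow> 'm \<Rightarrow> ('m, 'e) tvector \<Rightarrow> real" where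
  "dir_derivative A G E h p0 X = (THE L. has_dir_derivative A G E h p0 X L)"

definition dir_differentiable_at ::
    "('m::topological_space, 'e::euclidean_space) chart set \<Rightarrow> ('m, 'e) metric \<Rightarrow>
     'm set \<Rightarrow> ('m \<Rightarrow> real) \<Rightarrow> 'm \<Rightarrow> bool" where
  "dir_differentiable_at A G E h p0 \<longleftrightarrow>
     (\<forall>X\<in>tangent_directions A G E p0. \<exists>L. has_dir_derivative A G E h p0 X L)"

definition feasible_set :: "'m set \<Rightarrow> nat \<Rightarrow> (nat \<Rightarrow> 'm \<Rightarrow> real) \<Rightarrow> 'm set" where
  "feasible_set E m g = {p \<in> E. \<forall>i\<in>{1..m}. g i p \<le> 0}"

text \<open>This is injectivity on \<open>X\<close>, stronger than the usual meaning of the word.\<close>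

definition non_constant_on :: "('m \<Rightarrow> real) \<Rightarrow> 'm set \<Rightarrow> bool" where
  "non_constant_on f X \<longleftrightarrow> (\<forall>p\<in>X. \<forall>q\<in>X. p \<noteq> q \<longrightarrow> f p \<noteq> f q)"

definition optimal_solution :: "('m \<Rightarrow> real) \<Rightarrow> 'm set \<Rightarrow> 'm \<Rightarrow> bool" where
  "optimal_solution f X p0 \<longleftrightarrow> p0 \<in> X \<and> \<not> (\<exists>p\<in>X. f p < f p0)"

definition strict_optimal_solution :: "('m \<Rightarrow> real) \<Rightarrow> 'm set \<Rightarrow> 'm \<Rightarrow> bool" where
  "strict_optimal_solution f X p0 \<longleftrightarrow> p0 \<in> X \<and> \<not> (\<exists>p\<in>X. p \<noteq> p0 \<and> f p \<le> f p0)"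

end

theory Submission
  imports Defs
begin

text \<open>The heart of the matter is that \<open>p\<^sub>0\<close> can be joined to every feasible \<open>p\<close> by a geodesic; along it,
  convexity bounds the directional derivatives by the increments of the functions, and (i) and (ii)
  give \<open>f p\<^sub>0 \<le> f p\<close>.

  The geodesic is obtained without the exponential map. In a chart, the distance of two points is
  their distance in the norm frozen at one of them, up to a quadratic error. A maximal set of points
  between \<open>p\<close> and \<open>q\<close> on which the distance is additive has no gaps, since a closest point on a small
  compact sphere would fill one; so it is a curve \<open>c\<close> with \<open>d (c s) (c t) = L * \<bar>t - s\<bar>\<close>. Comparing
  \<open>c\<close> with its coordinate translates \<open>c + \<epsilon> w\<close> in a chart shows that its momentum \<open>g\<^sub>c(c', w)\<close> exists and has
  derivative \<open>\<partial>\<^sub>w g\<^sub>c(c', c') / 2\<close>, which is the geodesic equation.\<close>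

section \<open>Analytic preliminaries\<close>

text \<open>The obstacle is that c is a priori only Lipschitz, so neither a first variation nor a
  length integral along it is available. Translates serve as competitors because a constant shift
  leaves every chord \<open>c (u + h) - c u\<close> unchanged and acts only on the metric
  coefficients, which are smooth: the derivative of g enters without any derivative of c. The
  comparison runs through the two-point function d, which is linear along c by construction. Its
  quadratic chart error is harmless, since over n equal steps it adds up to order 1 / n. Passing to
  the translate and back changes the length, to first order in \<epsilon>, by the momenta at the two
  ends, and w and - w together turn the inequality into an equation. All this is done with forward
  difference quotients and explicit rates, hence the many constants. Completeness is used once, in
  its metric form: Cauchy sequences make the maximal set closed. Only spheres small enough to lie in
  one chart are shown to be compact, never arbitrary closed balls.\<close>

lemma sqrt_le_amgm:
  assumes "0 < (k::real)" "0 \<le> q"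
  shows "sqrt q \<le> (q / k + k) / 2"
proof -
  have "0 \<le> (sqrt q - k)\<^sup>2" by simp
  then have "2 * k * sqrt q \<le> q + k\<^sup>2" using assms by (simp add: power2_diff algebra_simps)
  then show ?thesis using assms by (simp add: field_simps power2_eq_square)
qed

lemma le_sqrt_self: "0 \<le> x \<Longrightarrow> x \<le> 1 \<Longrightarrow> x \<le> sqrt x" for x :: real
  by (intro real_le_rsqrt) (simp add: power2_eq_square mult_left_le)

text \<open>Subdividing the interval removes the quadratic error.\<close>

lemma chain_bound:
  fixes \<delta> :: "'a \<Rightarrow> 'a \<Rightarrow> real"
  assumes tri: "\<And>x y z. \<delta> x z \<le> \<delta> x y + \<delta> y z"
    and step: "\<And>u h. s \<le> u \<Longrightarrow> 0 < h \<Longrightarrow> u + h \<le> t \<Longrightarrow>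
                 \<delta> (F u) (F (u + h)) \<le> K * h + K' * h\<^sup>2"
    and st: "s < t"
  shows "\<delta> (F s) (F t) \<le> K * (t - s)"
proof -
  have part: "\<delta> (F s) (F t) \<le> K * (t - s) + K' * (t - s)\<^sup>2 * inverse (real (Suc n))" for n
  proof -
    define h where "h = (t - s) / real (Suc n)"
    have h: "0 < h" "h * real (Suc n) = t - s" using st by (auto simp: h_def)
    have "\<delta> (F s) (F (s + real (Suc i) * h)) \<le> real (Suc i) * (K * h + K' * h\<^sup>2)" if "i \<le> n" for i
      using that
    proof (induction i)
      case 0
      have "h * 1 \<le> h * real (Suc n)" using h by (intro mult_left_mono) auto
      then have "s + h \<le> t" using h by linarith
      then show ?case using step[of s h] h by simp
    next
      case (Suc i)
      have "s + real (Suc (Suc i)) * h \<le> s + real (Suc n) * h"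
        using Suc h by (intro add_left_mono mult_right_mono) auto
      then have le: "s + real (Suc i) * h + h \<le> t" using h by (simp add: algebra_simps)
      have "\<delta> (F s) (F (s + real (Suc (Suc i)) * h)) \<le> \<delta> (F s) (F (s + real (Suc i) * h))
              + \<delta> (F (s + real (Suc i) * h)) (F (s + real (Suc i) * h + h))"
        using tri by (simp add: algebra_simps)
      also have "\<dots> \<le> real (Suc i) * (K * h + K' * h\<^sup>2) + (K * h + K' * h\<^sup>2)"
        using Suc h le by (intro add_mono step) auto
      finally show ?case by (simp add: algebra_simps)
    qed
    from this[of n] have "\<delta> (F s) (F t) \<le> real (Suc n) * (K * h + K' * h\<^sup>2)"
      using h by (simp add: mult.commute)
    also have "\<dots> = K * (t - s) + K' * (t - s)\<^sup>2 * inverse (real (Suc n))"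
      by (simp add: h_def power2_eq_square field_simps del: of_nat_Suc)
    finally show ?thesis .
  qed
  have "(\<lambda>n. K * (t - s) + K' * (t - s)\<^sup>2 * inverse (real (Suc n))) \<longlonglongrightarrow> K * (t - s) + K' * (t - s)\<^sup>2 * 0"
    by (intro tendsto_intros LIMSEQ_inverse_real_of_nat)
  then show ?thesis using part by (intro LIMSEQ_le_const) auto
qed

text \<open>Any remainder smaller than the increment would give a derivative; the exponent 3/2 is
  what the shift \<epsilon> = \<tau> sqrt \<tau> / 2 of \<open>momentum_growth\<close> leaves
  behind.\<close>

lemma has_vector_derivative_of_power_bound:
  fixes f :: "real \<Rightarrow> 'a::real_normed_vector"
  assumes "0 < \<eta>"
    and bound: "\<And>y. y \<in> I \<Longrightarrow> \<bar>y - x\<bar> \<le> \<eta> \<Longrightarrow>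
      norm (f y - f x - (y - x) *\<^sub>R d) \<le> K * (\<bar>y - x\<bar> * sqrt \<bar>y - x\<bar>)"
  shows "(f has_vector_derivative d) (at x within I)"
  unfolding has_vector_derivative_def has_derivative_within_alt
proof (intro conjI allI impI)
  show "bounded_linear (\<lambda>h. h *\<^sub>R d)" by (rule bounded_linear_scaleR_left)
  fix \<epsilon> :: real assume e: "0 < \<epsilon>"
  define \<theta> where "\<theta> = min \<eta> ((\<epsilon> / (\<bar>K\<bar> + 1))\<^sup>2)"
  have "0 < \<theta>" using e assms by (simp add: \<theta>_def)
  moreover have "norm (f y - f x - (y - x) *\<^sub>R d) \<le> \<epsilon> * norm (y - x)"
    if y: "y \<in> I" "norm (y - x) < \<theta>" for y
  proof -
    have "sqrt \<bar>y - x\<bar> \<le> sqrt ((\<epsilon> / (\<bar>K\<bar> + 1))\<^sup>2)"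
      using y by (intro real_sqrt_le_mono) (simp add: \<theta>_def)
    also have "\<dots> = \<epsilon> / (\<bar>K\<bar> + 1)" using e by simp
    finally have "(\<bar>K\<bar> + 1) * sqrt \<bar>y - x\<bar> \<le> \<epsilon>" by (simp add: field_simps)
    moreover have "K * sqrt \<bar>y - x\<bar> \<le> (\<bar>K\<bar> + 1) * sqrt \<bar>y - x\<bar>"
      by (intro mult_right_mono) auto
    ultimately have "\<bar>y - x\<bar> * (K * sqrt \<bar>y - x\<bar>) \<le> \<bar>y - x\<bar> * \<epsilon>"
      by (intro mult_left_mono) auto
    then show ?thesis using bound[of y] y by (simp add: \<theta>_def algebra_simps)
  qed
  ultimately show "\<exists>\<theta>>0. \<forall>y\<in>I. norm (y - x) < \<theta> \<longrightarrow>
      norm (f y - f x - (y - x) *\<^sub>R d) \<le> \<epsilon> * norm (y - x)" by blast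
qed

lemma Icc_nontrivial: "a < b \<Longrightarrow> t \<in> {a..b} \<Longrightarrow> at t within {a..b} \<noteq> bot" for a b t :: real
  using trivial_limit_within[of t "{a..b}"] islimpt_Icc by auto

lemma point_in_segment: "t \<in> {0..1} \<Longrightarrow> x + t *\<^sub>R (y - x) \<in> closed_segment x y"
  by (auto simp: closed_segment_def algebra_simps intro!: exI[of _ t])

lemma linear_bound_basis:
  fixes l :: "'a::euclidean_space \<Rightarrow> real"
  assumes "linear l" and "\<And>i. i \<in> Basis \<Longrightarrow> \<bar>l i\<bar> \<le> c i"
  shows "\<bar>l w\<bar> \<le> (\<Sum>i\<in>Basis. c i) * norm w"
proof -
  have "l w = l (\<Sum>i\<in>Basis. (w \<bullet> i) *\<^sub>R i)" by (simp add: euclidean_representation)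
  also have "\<dots> = (\<Sum>i\<in>Basis. (w \<bullet> i) * l i)"
    using assms(1) by (simp add: linear_sum linear_scale)
  finally have "\<bar>l w\<bar> \<le> (\<Sum>i\<in>Basis. \<bar>(w \<bullet> i) * l i\<bar>)" by simp
  also have "\<dots> \<le> (\<Sum>i\<in>Basis. norm w * c i)"
    using assms(2) Basis_le_norm by (intro sum_mono) (auto simp: abs_mult intro!: mult_mono)
  finally show ?thesis by (simp add: sum_distrib_right sum_distrib_left mult.commute)
qed

text \<open>The factor q, common to all basis entries, carries the dependence on points and
  directions, such as norm (y - x). One matrix of constants c then serves values, increments and
  derivatives alike.\<close>

lemma bilinear_bound_basis:
  fixes \<beta> :: "'a::euclidean_space \<Rightarrow> 'b::euclidean_space \<Rightarrow> real"
  assumes "bilinear \<beta>" and "\<And>i j. i \<in> Basis \<Longrightarrow> j \<in> Basis \<Longrightarrow> \<bar>\<beta> i j\<bar> \<le> c i j * q"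
  shows "\<bar>\<beta> u v\<bar> \<le> (\<Sum>i\<in>Basis. \<Sum>j\<in>Basis. c i j) * q * norm u * norm v"
proof -
  have l: "linear (\<lambda>u. \<beta> u v)" "\<And>u. linear (\<beta> u)" for v using assms(1) by (auto simp: bilinear_def)
  have "\<bar>\<beta> i v\<bar> \<le> (\<Sum>j\<in>Basis. c i j * q) * norm v" if "i \<in> Basis" for i
    by (intro linear_bound_basis[OF l(2)] assms(2) that)
  from linear_bound_basis[OF l(1) this]
  have "\<bar>\<beta> u v\<bar> \<le> (\<Sum>i\<in>Basis. (\<Sum>j\<in>Basis. c i j * q) * norm v) * norm u" .
  also have "\<dots> = (\<Sum>i\<in>Basis. \<Sum>j\<in>Basis. c i j) * q * norm u * norm v"
    by (simp add: sum_distrib_right sum_distrib_left mult_ac)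
  finally show ?thesis .
qed

text \<open>Smoothness of a metric is given for fixed vectors only; expanding the moving vector in
  the basis yields joint continuity.\<close>

lemma continuous_on_quadratic_form:
  fixes g :: "'x::topological_space \<Rightarrow> 'e::euclidean_space \<Rightarrow> 'e \<Rightarrow> real"
  assumes g: "\<And>x. x \<in> U \<Longrightarrow> bilinear (g x)" "\<And>i j. continuous_on U (\<lambda>x. g x i j)"
    and x: "continuous_on T x" "\<And>t. t \<in> T \<Longrightarrow> x t \<in> U" and v: "continuous_on T v"
  shows "continuous_on T (\<lambda>t. g (x t) (v t) (v t))"
proof -
  have "continuous_on T (\<lambda>t. \<Sum>i\<in>Basis. \<Sum>j\<in>Basis. (v t \<bullet> i) * (v t \<bullet> j) * g (x t) i j)"
    using x by (intro continuous_intros v continuous_on_compose2[OF g(2)]) auto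
  moreover have "g (x t) (v t) (v t) = (\<Sum>i\<in>Basis. \<Sum>j\<in>Basis. (v t \<bullet> i) * (v t \<bullet> j) * g (x t) i j)"
    if "t \<in> T" for t
  proof -
    have b: "bilinear (g (x t))" using g(1) x(2) that by blast
    have "g (x t) (v t) (v t)
        = g (x t) (\<Sum>i\<in>Basis. (v t \<bullet> i) *\<^sub>R i) (\<Sum>j\<in>Basis. (v t \<bullet> j) *\<^sub>R j)"
      by (simp add: euclidean_representation)
    also have "\<dots> = (\<Sum>(i,j)\<in>Basis \<times> Basis. g (x t) ((v t \<bullet> i) *\<^sub>R i) ((v t \<bullet> j) *\<^sub>R j))"
      by (rule bilinear_sum[OF b])
    finally show ?thesis
      using b by (simp add: bilinear_lmul bilinear_rmul sum.cartesian_product mult_ac)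
  qed
  ultimately show ?thesis by (subst continuous_on_cong[OF refl]) auto
qed

lemma smooth_on_differentiable: "smooth_on S f \<Longrightarrow> x \<in> S \<Longrightarrow> f differentiable (at x)"
  unfolding smooth_on_def by (metis Ck_on.simps(2))

lemma smooth_on_continuous_on: "smooth_on S f \<Longrightarrow> continuous_on S f"
  unfolding smooth_on_def by (metis Ck_on.simps(1))

lemma smooth_on_frechet_derivative:
  "smooth_on S f \<Longrightarrow> smooth_on S (\<lambda>x. frechet_derivative f (at x) v)"
  unfolding smooth_on_def by (metis Ck_on.simps(2))

lemma smooth_on_has_derivative:
  "smooth_on S f \<Longrightarrow> x \<in> S \<Longrightarrow> (f has_derivative frechet_derivative f (at x)) (at x)"
  using smooth_on_differentiable frechet_derivative_works by blast

lemma smooth_on_deriv_bound: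
  fixes f :: "'a::euclidean_space \<Rightarrow> real"
  assumes "smooth_on S f" "compact K" "K \<subseteq> S"
  obtains C where "0 \<le> C" "\<And>x w. x \<in> K \<Longrightarrow> \<bar>frechet_derivative f (at x) w\<bar> \<le> C * norm w"
proof -
  have "\<exists>c\<ge>0. \<forall>x\<in>K. \<bar>frechet_derivative f (at x) i\<bar> \<le> c" for i
  proof -
    have "continuous_on K (\<lambda>x. frechet_derivative f (at x) i)"
      using smooth_on_continuous_on[OF smooth_on_frechet_derivative[OF assms(1)]] assms(3)
      by (rule continuous_on_subset)
    then have "bounded ((\<lambda>x. frechet_derivative f (at x) i) ` K)"
      using assms(2) compact_continuous_image compact_imp_bounded by blast
    then obtain b where "0 < b" "\<forall>x\<in>K. \<bar>frechet_derivative f (at x) i\<bar> \<le> b"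
      by (auto simp: bounded_pos)
    then show ?thesis by (intro exI[of _ b]) auto
  qed
  then obtain c where c: "\<And>i. 0 \<le> c i" "\<And>i x. x \<in> K \<Longrightarrow> \<bar>frechet_derivative f (at x) i\<bar> \<le> c i" by metis
  show ?thesis
  proof
    show "0 \<le> (\<Sum>i\<in>Basis. c i)" using c by (simp add: sum_nonneg)
    fix x w assume x: "x \<in> K"
    have "linear (frechet_derivative f (at x))"
      using smooth_on_has_derivative[OF assms(1), of x] x assms(3) has_derivative_linear by blast
    then show "\<bar>frechet_derivative f (at x) w\<bar> \<le> (\<Sum>i\<in>Basis. c i) * norm w"
      using c x by (intro linear_bound_basis) auto
  qed
qed

lemma smooth_on_lipschitz:
  fixes f :: "'a::euclidean_space \<Rightarrow> real"
  assumes "smooth_on S f" "compact K" "convex K" "K \<subseteq> S"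
  obtains C where "0 \<le> C" "\<And>x y. x \<in> K \<Longrightarrow> y \<in> K \<Longrightarrow> \<bar>f y - f x\<bar> \<le> C * norm (y - x)"
proof -
  obtain C where C: "0 \<le> C" "\<And>x w. x \<in> K \<Longrightarrow> \<bar>frechet_derivative f (at x) w\<bar> \<le> C * norm w"
    using smooth_on_deriv_bound[OF assms(1,2,4)] by blast
  have "\<bar>f y - f x\<bar> \<le> C * norm (y - x)" if "x \<in> K" "y \<in> K" for x y
  proof -
    have "norm (f y - f x) \<le> C * norm (y - x)"
    proof (rule differentiable_bound[OF assms(3)])
      fix z assume "z \<in> K"
      then show "(f has_derivative frechet_derivative f (at z)) (at z within K)"
        using smooth_on_has_derivative[OF assms(1)] assms(4) has_derivative_at_withinI by blast
      show "onorm (frechet_derivative f (at z)) \<le> C" using C \<open>z \<in> K\<close> by (intro onorm_le) simp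
    qed (use that in auto)
    then show ?thesis by simp
  qed
  then show ?thesis using C that by blast
qed

text \<open>The second-order bound comes from the first derivative alone: each directional
  derivative is again smooth, so the derivative is Lipschitz on K, and the mean value inequality for
  f minus its linearization gives the quadratic remainder.\<close>

lemma smooth_on_estimates:
  fixes f :: "'a::euclidean_space \<Rightarrow> real"
  assumes f: "smooth_on S f" and K: "compact K" "convex K" "K \<subseteq> S"
  obtains C where "0 \<le> C"
    "\<And>x. x \<in> K \<Longrightarrow> \<bar>f x\<bar> \<le> C"
    "\<And>x y. x \<in> K \<Longrightarrow> y \<in> K \<Longrightarrow> \<bar>f y - f x\<bar> \<le> C * norm (y - x)"
    "\<And>x w. x \<in> K \<Longrightarrow> \<bar>frechet_derivative f (at x) w\<bar> \<le> C * norm w"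
    "\<And>x y w. x \<in> K \<Longrightarrow> y \<in> K \<Longrightarrow>
      \<bar>frechet_derivative f (at y) w - frechet_derivative f (at x) w\<bar> \<le> C * (norm (y - x) * norm w)"
    "\<And>x y. x \<in> K \<Longrightarrow> y \<in> K \<Longrightarrow>
      \<bar>f y - f x - frechet_derivative f (at x) (y - x)\<bar> \<le> C * (norm (y - x))\<^sup>2"
proof -
  let ?D = "\<lambda>x. frechet_derivative f (at x)"
  have "bounded (f ` K)"
    using K f smooth_on_continuous_on compact_continuous_image compact_imp_bounded
      continuous_on_subset by metis
  then obtain c0 where "0 < c0" and c0: "\<And>x. x \<in> K \<Longrightarrow> \<bar>f x\<bar> \<le> c0"
    by (auto simp: bounded_pos)
  then have c0: "0 \<le> c0" "\<And>x. x \<in> K \<Longrightarrow> \<bar>f x\<bar> \<le> c0" by auto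
  obtain c1 where c1: "0 \<le> c1" "\<And>x y. x \<in> K \<Longrightarrow> y \<in> K \<Longrightarrow> \<bar>f y - f x\<bar> \<le> c1 * norm (y - x)"
    using smooth_on_lipschitz[OF f K] by blast
  obtain c2 where c2: "0 \<le> c2" "\<And>x w. x \<in> K \<Longrightarrow> \<bar>?D x w\<bar> \<le> c2 * norm w"
    using smooth_on_deriv_bound[OF f K(1,3)] by blast
  have "\<exists>c\<ge>0. \<forall>x\<in>K. \<forall>y\<in>K. \<bar>?D y i - ?D x i\<bar> \<le> c * norm (y - x)" for i
    using smooth_on_lipschitz[OF smooth_on_frechet_derivative[OF f] K] by metis
  then obtain c where c: "\<And>i. 0 \<le> c i"
    "\<And>i x y. x \<in> K \<Longrightarrow> y \<in> K \<Longrightarrow> \<bar>?D y i - ?D x i\<bar> \<le> c i * norm (y - x)" by metis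
  define c3 where "c3 = (\<Sum>i\<in>Basis. c i)"
  have c30: "0 \<le> c3" using c by (simp add: c3_def sum_nonneg)
  have D: "(f has_derivative ?D x) (at x)" "linear (?D x)" if "x \<in> K" for x
    using smooth_on_has_derivative[OF f, of x] that K has_derivative_linear by auto
  have c3: "\<bar>?D y w - ?D x w\<bar> \<le> c3 * (norm (y - x) * norm w)" if "x \<in> K" "y \<in> K" for x y w
  proof -
    have "linear (\<lambda>w. ?D y w - ?D x w)" using D that by (intro linear_compose_sub) auto
    from linear_bound_basis[OF this, of "\<lambda>i. c i * norm (y - x)"] c(2) that
    show ?thesis by (simp add: c3_def sum_distrib_right mult_ac)
  qed
  have c4: "\<bar>f y - f x - ?D x (y - x)\<bar> \<le> c3 * (norm (y - x))\<^sup>2" if xy: "x \<in> K" "y \<in> K" for x y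
  proof -
    have seg: "closed_segment x y \<subseteq> K" using K(2) xy by (simp add: closed_segment_subset)
    have "norm (f y - f x - ?D x (y - x)) \<le> norm (y - x) * (c3 * norm (y - x))"
    proof (rule differentiable_bound_linearization)
      show "x + t *\<^sub>R (y - x) \<in> closed_segment x y" if "t \<in> {0..1}" for t
        using that by (auto simp: closed_segment_def algebra_simps intro!: exI[of _ t])
      fix z assume z: "z \<in> closed_segment x y"
      then have zK: "z \<in> K" using seg by auto
      show "(f has_derivative ?D z) (at z within closed_segment x y)"
        using D(1)[OF zK] by (rule has_derivative_at_withinI)
      have n: "norm (z - x) \<le> norm (y - x)"
        using segment_bound(1)[OF z] by (simp add: norm_minus_commute)
      have "\<bar>?D z w - ?D x w\<bar> \<le> c3 * norm (y - x) * norm w" for w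
      proof -
        have "\<bar>?D z w - ?D x w\<bar> \<le> c3 * (norm (z - x) * norm w)" by (rule c3[OF xy(1) zK])
        also have "\<dots> \<le> c3 * (norm (y - x) * norm w)"
          using n c30 by (intro mult_left_mono mult_right_mono) auto
        finally show ?thesis by (simp add: mult_ac)
      qed
      then show "onorm (?D z - ?D x) \<le> c3 * norm (y - x)" by (intro onorm_le) (simp add: fun_diff_def)
    qed auto
    then show ?thesis by (simp add: power2_eq_square mult_ac)
  qed
  let ?C = "c0 + c1 + c2 + c3"
  show ?thesis
  proof (rule that[of ?C])
    show "0 \<le> ?C" using c0 c1 c2 c30 by simp
    fix x y w :: 'a assume x: "x \<in> K"
    show "\<bar>f x\<bar> \<le> ?C" using c0(2)[OF x] c0 c1 c2 c30 by simp
    have "c2 * norm w \<le> ?C * norm w"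
      using c0 c1 c2 c30 by (intro mult_right_mono) auto
    then show "\<bar>?D x w\<bar> \<le> ?C * norm w" using c2(2)[OF x, of w] by simp
    assume y: "y \<in> K"
    have "c1 * norm (y - x) \<le> ?C * norm (y - x)"
      using c0 c1 c2 c30 by (intro mult_right_mono) auto
    then show "\<bar>f y - f x\<bar> \<le> ?C * norm (y - x)" using c1(2)[OF x y] by simp
    have "c3 * (norm (y - x) * norm w) \<le> ?C * (norm (y - x) * norm w)"
      using c0 c1 c2 c30 by (intro mult_right_mono) auto
    then show "\<bar>?D y w - ?D x w\<bar> \<le> ?C * (norm (y - x) * norm w)"
      using c3[OF x y, of w] by simp
    have "c3 * (norm (y - x))\<^sup>2 \<le> ?C * (norm (y - x))\<^sup>2"
      using c0 c1 c2 c30 by (intro mult_right_mono) auto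
    then show "\<bar>f y - f x - ?D x (y - x)\<bar> \<le> ?C * (norm (y - x))\<^sup>2"
      using c4[OF x y] by simp
  qed
qed

section \<open>Metrics in a chart\<close>

text \<open>What the variational argument uses of a smooth metric on a compact convex piece of a
  chart: ellipticity with a constant k, squared in \<open>coercive\<close> so that
  \<open>k * norm u \<le> nrm x u\<close>, and one constant C for all upper, Lipschitz and Taylor
  bounds. \<open>dg x w\<close> stands for the derivative of the coefficients at x in direction
  w.\<close>

locale local_metric =
  fixes g :: "'e::euclidean_space \<Rightarrow> 'e \<Rightarrow> 'e \<Rightarrow> real"
    and dg :: "'e \<Rightarrow> 'e \<Rightarrow> 'e \<Rightarrow> 'e \<Rightarrow> real"
    and S :: "'e set" and k C :: real
  assumes k_pos: "0 < k" and C_pos: "0 < C"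
    and bilin: "x \<in> S \<Longrightarrow> bilinear (g x)"
    and sym: "x \<in> S \<Longrightarrow> g x u v = g x v u"
    and coercive: "x \<in> S \<Longrightarrow> (k * norm u)\<^sup>2 \<le> g x u u"
    and g_bound: "x \<in> S \<Longrightarrow> \<bar>g x u v\<bar> \<le> C * norm u * norm v"
    and g_lip: "x \<in> S \<Longrightarrow> y \<in> S \<Longrightarrow> \<bar>g y u v - g x u v\<bar> \<le> C * norm (y - x) * norm u * norm v"
    and taylor: "x \<in> S \<Longrightarrow> y \<in> S \<Longrightarrow>
      \<bar>g y u v - g x u v - dg x (y - x) u v\<bar> \<le> C * (norm (y - x))\<^sup>2 * norm u * norm v"
    and dg_bilin: "x \<in> S \<Longrightarrow> bilinear (dg x w)"
    and dg_linear: "x \<in> S \<Longrightarrow> linear (\<lambda>w. dg x w u v)"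
    and dg_sym: "x \<in> S \<Longrightarrow> dg x w u v = dg x w v u"
    and dg_bound: "x \<in> S \<Longrightarrow> \<bar>dg x w u v\<bar> \<le> C * norm w * norm u * norm v"
    and dg_lip: "x \<in> S \<Longrightarrow> y \<in> S \<Longrightarrow>
      \<bar>dg y w u v - dg x w u v\<bar> \<le> C * norm (y - x) * norm w * norm u * norm v"
begin

definition nrm :: "'e \<Rightarrow> 'e \<Rightarrow> real" where "nrm x u = sqrt (g x u u)"

lemma g_nonneg: "x \<in> S \<Longrightarrow> 0 \<le> g x u u"
  using coercive[of x u] by (meson order_trans zero_le_power2)

lemma nrm_nonneg: "x \<in> S \<Longrightarrow> 0 \<le> nrm x u"
  by (simp add: nrm_def g_nonneg)

lemma nrm_sq: "x \<in> S \<Longrightarrow> (nrm x u)\<^sup>2 = g x u u"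
  by (simp add: nrm_def g_nonneg)

lemma nrm_ge: "x \<in> S \<Longrightarrow> k * norm u \<le> nrm x u"
  unfolding nrm_def using coercive[of x u] k_pos by (intro real_le_rsqrt)

text \<open>Turns bounds on momenta into bounds on vectors. Only w = X / norm X is tested when X is
  nonzero, so a one-sided bound suffices; coercivity does the rest.\<close>

lemma norm_le_of_unit_bound:
  assumes x: "x \<in> S" and le: "\<And>w. norm w \<le> 1 \<Longrightarrow> g x X w \<le> K"
  shows "norm X \<le> K / k\<^sup>2"
proof (cases "X = 0")
  case True
  then have "0 \<le> K" using le[of 0] bilinear_rzero[OF bilin[OF x]] by simp
  then show ?thesis using True k_pos by simp
next
  case False
  let ?w = "(1 / norm X) *\<^sub>R X"
  have "(k * norm X)\<^sup>2 / norm X \<le> g x X X / norm X"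
    using coercive[OF x, of X] by (intro divide_right_mono) auto
  also have "\<dots> = g x X ?w" using bilinear_rmul[OF bilin[OF x]] by simp
  also have "\<dots> \<le> K" using False by (intro le) simp
  finally show ?thesis using False k_pos by (simp add: field_simps power2_eq_square)
qed

text \<open>A difference of roots is the difference of the squares over the sum, and coercivity
  keeps that sum above k * norm u.\<close>

lemma nrm_lipschitz:
  assumes "x \<in> S" "y \<in> S"
  shows "\<bar>nrm y u - nrm x u\<bar> \<le> C / k * norm (y - x) * norm u"
proof (cases "u = 0")
  case True
  then show ?thesis using bilinear_lzero[OF bilin] assms by (simp add: nrm_def)
next
  case False
  have n: "k * norm u \<le> nrm x u" "k * norm u \<le> nrm y u" using assms by (auto intro: nrm_ge)
  have kn: "0 < k * norm u" using k_pos False by simp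
  have "\<bar>nrm y u - nrm x u\<bar> * (k * norm u) \<le> \<bar>nrm y u - nrm x u\<bar> * (nrm y u + nrm x u)"
    using n kn by (intro mult_left_mono) auto
  also have "\<dots> = \<bar>(nrm y u - nrm x u) * (nrm y u + nrm x u)\<bar>"
    using n kn by (simp add: abs_mult)
  also have "(nrm y u - nrm x u) * (nrm y u + nrm x u) = (nrm y u)\<^sup>2 - (nrm x u)\<^sup>2"
    by (simp add: power2_eq_square algebra_simps)
  also have "\<bar>\<dots>\<bar> \<le> C * norm (y - x) * norm u * norm u"
    using g_lip assms by (simp add: nrm_sq)
  finally show ?thesis using k_pos False by (simp add: field_simps)
qed

lemma Cauchy_Schwarz:
  assumes x: "x \<in> S" shows "g x u v \<le> nrm x u * nrm x v"
proof (cases "u = 0 \<or> v = 0")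
  case True
  then show ?thesis using bilinear_lzero[OF bilin[OF x]] bilinear_rzero[OF bilin[OF x]] by (auto simp: nrm_def)
next
  case False
  let ?a = "nrm x u" and ?b = "nrm x v"
  have "0 < k * norm u" "0 < k * norm v" using k_pos False by auto
  then have pos: "0 < ?a" "0 < ?b" using nrm_ge[OF x, of u] nrm_ge[OF x, of v] by linarith+
  have "0 \<le> g x (?b *\<^sub>R u - ?a *\<^sub>R v) (?b *\<^sub>R u - ?a *\<^sub>R v)" by (rule g_nonneg[OF x])
  also have "\<dots> = ?b\<^sup>2 * g x u u + ?a\<^sup>2 * g x v v - 2 * ?a * ?b * g x u v"
    using bilin[OF x] sym[OF x, of v u]
    by (simp add: bilinear_lsub bilinear_rsub bilinear_lmul bilinear_rmul power2_eq_square algebra_simps)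
  also have "\<dots> = 2 * (?a * ?b) * (?a * ?b) - 2 * (?a * ?b) * g x u v"
    unfolding nrm_sq[OF x, symmetric] by (simp add: power2_eq_square algebra_simps)
  finally have "2 * (?a * ?b) * g x u v \<le> 2 * (?a * ?b) * (?a * ?b)" by simp
  then show ?thesis using pos by simp
qed

lemma mono:
  assumes "S' \<subseteq> S" "C \<le> C'"
  shows "local_metric g dg S' k C'"
proof (rule local_metric.intro)
  show "0 < k" "0 < C'" using k_pos C_pos assms by auto
  have weaken: "t \<le> C' * q" if "t \<le> C * q" "0 \<le> q" for t q
    using that assms(2) by (meson mult_right_mono order_trans)
  fix x y w u v assume x: "x \<in> S'"
  then have xS: "x \<in> S" using assms by auto
  show "bilinear (g x)" "g x u v = g x v u" "bilinear (dg x w)" "dg x w u v = dg x w v u"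
    "linear (\<lambda>w. dg x w u v)" "(k * norm u)\<^sup>2 \<le> g x u u"
    using bilin sym dg_bilin dg_sym dg_linear coercive xS by blast+
  show "\<bar>g x u v\<bar> \<le> C' * norm u * norm v"
    using weaken[of _ "norm u * norm v"] g_bound[OF xS] by (simp add: mult.assoc)
  show "\<bar>dg x w u v\<bar> \<le> C' * norm w * norm u * norm v"
    using weaken[of _ "norm w * norm u * norm v"] dg_bound[OF xS] by (simp add: mult.assoc)
  assume y: "y \<in> S'"
  then have yS: "y \<in> S" using assms by auto
  show "\<bar>g y u v - g x u v\<bar> \<le> C' * norm (y - x) * norm u * norm v"
    using weaken[of _ "norm (y - x) * norm u * norm v"] g_lip[OF xS yS] by (simp add: mult.assoc)
  show "\<bar>g y u v - g x u v - dg x (y - x) u v\<bar> \<le> C' * (norm (y - x))\<^sup>2 * norm u * norm v"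
    using weaken[of _ "(norm (y - x))\<^sup>2 * norm u * norm v"] taylor[OF xS yS] by (simp add: mult.assoc)
  show "\<bar>dg y w u v - dg x w u v\<bar> \<le> C' * norm (y - x) * norm w * norm u * norm v"
    using weaken[of _ "norm (y - x) * norm w * norm u * norm v"] dg_lip[OF xS yS] by (simp add: mult.assoc)
qed

text \<open>Raises an index. The map sending z to the values g x z b on the basis is linear and, by
  coercivity, injective, hence onto. The uniqueness part later evaluates the \<open>THE\<close> in
  \<open>christoffel\<close>.\<close>

lemma riesz:
  assumes x: "x \<in> S" and l: "linear \<alpha>"
  obtains z where "\<And>w. g x z w = \<alpha> w" "\<And>z'. (\<And>w. g x z' w = \<alpha> w) \<Longrightarrow> z' = z"
proof -
  define T where "T z = (\<Sum>b\<in>Basis. g x z b *\<^sub>R b)" for z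
  have Tb: "T z \<bullet> b = g x z b" if "b \<in> Basis" for z b
    unfolding T_def using that by (simp add: inner_sum_left_Basis)
  have ext: "g x z w = \<alpha>' w" if "linear \<alpha>'" "\<And>b. b \<in> Basis \<Longrightarrow> g x z b = \<alpha>' b" for z \<alpha>' w
  proof -
    have "linear (g x z)" using bilin[OF x] by (simp add: bilinear_def)
    then have "g x z = \<alpha>'" using that by (intro linear_eq_stdbasis) auto
    then show ?thesis by simp
  qed
  have inj0: "z = 0" if "\<And>w. g x z w = 0" for z
    using coercive[OF x, of z] that[of z] k_pos by simp
  have lin: "linear T"
    unfolding T_def using bilin[OF x]
    by (intro linearI) (auto simp: bilinear_ladd bilinear_lmul scaleR_add_left sum.distrib scaleR_sum_right)
  have "inj T"
    unfolding linear_injective_0[OF lin]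
  proof (intro allI impI)
    fix z assume "T z = 0"
    then have "g x z b = 0" if "b \<in> Basis" for b using Tb[OF that, of z] by simp
    then have "g x z w = 0" for w using ext[of "\<lambda>_. 0" z w] by (simp add: module_hom_zero)
    then show "z = 0" by (rule inj0)
  qed
  then have "surj T" using lin by (intro linear_injective_imp_surjective) auto
  then obtain z where "T z = (\<Sum>b\<in>Basis. \<alpha> b *\<^sub>R b)" by (metis surjD)
  then have "g x z b = \<alpha> b" if "b \<in> Basis" for b
    using Tb[OF that, of z] that by (simp add: inner_sum_left_Basis)
  then have z: "g x z w = \<alpha> w" for w by (rule ext[OF l])
  moreover have "z' = z" if "\<And>w. g x z' w = \<alpha> w" for z'
  proof -
    have "g x (z' - z) w = 0" for w using z that bilinear_lsub[OF bilin[OF x]] by simp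
    then show ?thesis using inj0[of "z' - z"] by simp
  qed
  ultimately show ?thesis using that by blast
qed

end

lemma local_metric_exists:
  fixes g :: "'e::euclidean_space \<Rightarrow> 'e \<Rightarrow> 'e \<Rightarrow> real"
  assumes U: "open U"
    and bil: "\<And>x. x \<in> U \<Longrightarrow> bilinear (g x)"
    and sym: "\<And>x u v. x \<in> U \<Longrightarrow> g x u v = g x v u"
    and pos: "\<And>x u. x \<in> U \<Longrightarrow> u \<noteq> 0 \<Longrightarrow> 0 < g x u u"
    and smooth: "\<And>u v. smooth_on U (\<lambda>x. g x u v)"
    and K: "compact K" "convex K" "K \<subseteq> U" "K \<noteq> {}"
  obtains k C where "local_metric g (\<lambda>x w u v. frechet_derivative (\<lambda>y. g y u v) (at x) w) K k C"
proof -
  let ?dg = "\<lambda>x w u v. frechet_derivative (\<lambda>y. g y u v) (at x) w"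
  have d: "((\<lambda>y. g y u v) has_derivative (\<lambda>w. ?dg x w u v)) (at x)" if "x \<in> U" for x u v
    using smooth_on_has_derivative[OF smooth that] .
  \<comment> \<open>The algebraic identities of g hold on all of the open set U, so they may be
    differentiated; this is how \<open>?dg\<close> inherits bilinearity and symmetry.\<close>
  have uniq: "?dg x w u v = D w" if "x \<in> U" "(f has_derivative D) (at x)" "\<And>y. y \<in> U \<Longrightarrow> f y = g y u v"
    for x u v w f D
  proof -
    have "((\<lambda>y. g y u v) has_derivative D) (at x)"
      by (rule has_derivative_transform_within_open[OF that(2) U that(1,3)])
    then show ?thesis using frechet_derivative_at by metis
  qed
  have dbil: "bilinear (?dg x w)" if x: "x \<in> U" for x w
    unfolding bilinear_def linear_iff
  proof (intro conjI allI)
    fix u u' v and r :: real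
    show "?dg x w u (v + u') = ?dg x w u v + ?dg x w u u'"
      by (rule uniq[OF x has_derivative_add[OF d[OF x] d[OF x]]]) (simp add: bilinear_radd[OF bil])
    show "?dg x w (v + u') u = ?dg x w v u + ?dg x w u' u"
      by (rule uniq[OF x has_derivative_add[OF d[OF x] d[OF x]]]) (simp add: bilinear_ladd[OF bil])
    show "?dg x w u (r *\<^sub>R v) = r *\<^sub>R ?dg x w u v"
      by (rule uniq[OF x has_derivative_scaleR_right[OF d[OF x]]]) (simp add: bilinear_rmul[OF bil])
    show "?dg x w (r *\<^sub>R v) u = r *\<^sub>R ?dg x w v u"
      by (rule uniq[OF x has_derivative_scaleR_right[OF d[OF x]]]) (simp add: bilinear_lmul[OF bil])
  qed
  have dsym: "?dg x w u v = ?dg x w v u" if x: "x \<in> U" for x w u v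
    by (rule uniq[OF x d[OF x]]) (rule sym)
  define P where "P i j C \<longleftrightarrow> 0 \<le> C \<and> (\<forall>x\<in>K. \<bar>g x i j\<bar> \<le> C) \<and>
      (\<forall>x\<in>K. \<forall>y\<in>K. \<bar>g y i j - g x i j\<bar> \<le> C * norm (y - x)) \<and>
      (\<forall>x\<in>K. \<forall>w. \<bar>?dg x w i j\<bar> \<le> C * norm w) \<and>
      (\<forall>x\<in>K. \<forall>y\<in>K. \<forall>w. \<bar>?dg y w i j - ?dg x w i j\<bar> \<le> C * (norm (y - x) * norm w)) \<and>
      (\<forall>x\<in>K. \<forall>y\<in>K. \<bar>g y i j - g x i j - ?dg x (y - x) i j\<bar> \<le> C * (norm (y - x))\<^sup>2)" for i j C
  have "\<exists>C. P i j C" for i j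
    unfolding P_def by (rule smooth_on_estimates[OF smooth[of i j] K(1-3)]) blast
  then obtain c where "\<And>i j. P i j (c i j)" by metis
  then have c: "\<And>i j. 0 \<le> c i j" "\<And>i j x. x \<in> K \<Longrightarrow> \<bar>g x i j\<bar> \<le> c i j"
    "\<And>i j x y. x \<in> K \<Longrightarrow> y \<in> K \<Longrightarrow> \<bar>g y i j - g x i j\<bar> \<le> c i j * norm (y - x)"
    "\<And>i j x w. x \<in> K \<Longrightarrow> \<bar>?dg x w i j\<bar> \<le> c i j * norm w"
    "\<And>i j x y w. x \<in> K \<Longrightarrow> y \<in> K \<Longrightarrow> \<bar>?dg y w i j - ?dg x w i j\<bar> \<le> c i j * (norm (y - x) * norm w)"
    "\<And>i j x y. x \<in> K \<Longrightarrow> y \<in> K \<Longrightarrow> \<bar>g y i j - g x i j - ?dg x (y - x) i j\<bar> \<le> c i j * (norm (y - x))\<^sup>2"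
    unfolding P_def by blast+
  define C where "C = (\<Sum>i\<in>(Basis::'e set). \<Sum>j\<in>(Basis::'e set). c i j) + 1"
  have C0: "(\<Sum>i\<in>(Basis::'e set). \<Sum>j\<in>(Basis::'e set). c i j) \<le> C" by (simp add: C_def)
  have bnd: "\<bar>\<beta> u v\<bar> \<le> C * q * norm u * norm v"
    if "bilinear \<beta>" "\<And>i j. \<bar>\<beta> i j\<bar> \<le> c i j * q" "0 \<le> q" for \<beta> q u v
  proof -
    have "\<bar>\<beta> u v\<bar> \<le> (\<Sum>i\<in>Basis. \<Sum>j\<in>Basis. c i j) * q * norm u * norm v"
      using that by (intro bilinear_bound_basis) auto
    also have "\<dots> \<le> C * q * norm u * norm v" using that C0 by (intro mult_right_mono) auto
    finally show ?thesis .
  qed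
  have bdiff: "bilinear (\<lambda>u v. \<beta> u v - \<beta>' u v)" if "bilinear \<beta>" "bilinear \<beta>'"
    for \<beta> \<beta>' :: "'e \<Rightarrow> 'e \<Rightarrow> real"
    using that unfolding bilinear_def by (auto intro!: linear_compose_sub)
  \<comment> \<open>Ellipticity: g x u u attains a positive minimum on the compact product of K with
    the unit sphere, and homogeneity extends the bound to all u.\<close>
  have "\<exists>\<mu>>0. \<forall>x\<in>K. \<forall>u. \<mu> * (norm u)\<^sup>2 \<le> g x u u"
  proof -
    let ?P = "K \<times> sphere (0::'e) 1" and ?f = "\<lambda>(x, u). g x u u"
    have "continuous_on ?P (\<lambda>p. g (fst p) (snd p) (snd p))"
      using K(3) by (intro continuous_on_quadratic_form[of U g] bil smooth_on_continuous_on[OF smooth])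
        (auto intro!: continuous_intros)
    then have "continuous_on ?P ?f" by (simp add: split_beta)
    moreover have "compact ?P" using K by (intro compact_Times) auto
    moreover have "?P \<noteq> {}" using K by simp
    ultimately obtain p where p: "p \<in> ?P" "\<And>p'. p' \<in> ?P \<Longrightarrow> ?f p \<le> ?f p'"
      using continuous_attains_inf[of ?P ?f] by blast
    have "0 < ?f p" using p(1) K pos by (auto simp: split_beta) (metis norm_zero subset_eq zero_neq_one)
    moreover have "?f p * (norm u)\<^sup>2 \<le> g x u u" if "x \<in> K" for x u
    proof (cases "u = 0")
      case False
      let ?u = "(1 / norm u) *\<^sub>R u"
      have "?f p \<le> g x ?u ?u" using p(2)[of "(x, ?u)"] that False by simp
      then show ?thesis using False that K bil[of x]
        by (simp add: bilinear_lmul bilinear_rmul field_simps power2_eq_square subset_eq)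
    next
      case True
      then show ?thesis using bilinear_lzero[OF bil] that K by auto
    qed
    ultimately show ?thesis by blast
  qed
  then obtain \<mu> where \<mu>: "0 < \<mu>" "\<And>x u. x \<in> K \<Longrightarrow> \<mu> * (norm u)\<^sup>2 \<le> g x u u" by blast
  have KU: "x \<in> U" if "x \<in> K" for x using that K by auto
  have "local_metric g ?dg K (sqrt \<mu>) C"
  proof (rule local_metric.intro)
    show "0 < sqrt \<mu>" using \<mu> by simp
    show "0 < C" using c by (simp add: C_def sum_nonneg add_nonneg_pos)
    fix x y w u v :: 'e assume x: "x \<in> K"
    show "bilinear (g x)" "g x u v = g x v u" "bilinear (?dg x w)" "?dg x w u v = ?dg x w v u"
      using bil sym dbil dsym KU[OF x] by blast+
    show "linear (\<lambda>w. ?dg x w u v)" using d[OF KU[OF x]] by (rule has_derivative_linear)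
    show "(sqrt \<mu> * norm u)\<^sup>2 \<le> g x u u" using \<mu> x by (simp add: power_mult_distrib)
    show "\<bar>g x u v\<bar> \<le> C * norm u * norm v"
      using bnd[OF bil[OF KU[OF x]], of 1] c(2)[OF x] by simp
    show "\<bar>?dg x w u v\<bar> \<le> C * norm w * norm u * norm v"
      using c(4)[OF x] by (intro bnd dbil KU x) auto
    assume y: "y \<in> K"
    show "\<bar>g y u v - g x u v\<bar> \<le> C * norm (y - x) * norm u * norm v"
      using c(3)[OF x y] by (intro bnd bdiff bil KU x y) auto
    show "\<bar>g y u v - g x u v - ?dg x (y - x) u v\<bar> \<le> C * (norm (y - x))\<^sup>2 * norm u * norm v"
      using c(6)[OF x y] by (intro bnd bdiff bil dbil KU x y) auto
    have "\<bar>?dg y w u v - ?dg x w u v\<bar> \<le> C * (norm (y - x) * norm w) * norm u * norm v"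
      using c(5)[OF x y] by (intro bnd bdiff dbil KU x y) auto
    then show "\<bar>?dg y w u v - ?dg x w u v\<bar> \<le> C * norm (y - x) * norm w * norm u * norm v"
      by (simp add: mult_ac)
  qed
  then show ?thesis using that by blast
qed

section \<open>Regularity of minimizing curves\<close>

text \<open>A curve parametrized proportionally to arc length with respect to a distance \<open>\<delta>\<close> that agrees
  with the norm of \<open>g\<close> up to a quadratic error.\<close>

locale minimizer = local_metric +
  fixes \<delta> :: "'a::euclidean_space \<Rightarrow> 'a \<Rightarrow> real" and c :: "real \<Rightarrow> 'a"
    and a b L r :: real
  assumes ab: "a < b" "b \<le> a + 1" and L_pos: "0 < L" and r_pos: "0 < r"
    and near: "t \<in> {a..b} \<Longrightarrow> norm w \<le> r \<Longrightarrow> c t + w \<in> S"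
    and tri: "\<delta> x z \<le> \<delta> x y + \<delta> y z"
    and \<delta>_refl: "\<delta> x x = 0"
    and \<delta>_upper: "x \<in> S \<Longrightarrow> y \<in> S \<Longrightarrow> \<delta> x y \<le> sqrt (g x (y - x) (y - x)) + C * (norm (y - x))\<^sup>2"
    and \<delta>_lower: "s \<in> {a..b} \<Longrightarrow> t \<in> {a..b} \<Longrightarrow>
      sqrt (g (c s) (c t - c s) (c t - c s)) \<le> \<delta> (c s) (c t) + C * (norm (c t - c s))\<^sup>2"
    and \<delta>_coercive: "s \<in> {a..b} \<Longrightarrow> t \<in> {a..b} \<Longrightarrow> k * norm (c t - c s) \<le> \<delta> (c s) (c t)"
    and geo: "a \<le> s \<Longrightarrow> s \<le> t \<Longrightarrow> t \<le> b \<Longrightarrow> \<delta> (c s) (c t) = L * (t - s)"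
begin

text \<open>M is the Lipschitz constant of c in coordinates. K1 is the cubic excess of a squared
  chord over L^2 h^2, K2 the part of the shifted length quadratic in the shift, K3 the part
  quadratic in the step, K4 the error of a ramp, and K5 the total after multiplication by L /
  \<epsilon>.\<close>

definition "M = L / k"
definition "K1 = 2 * L * C * M\<^sup>2 + C\<^sup>2 * M ^ 4"
definition "K2 = C * M\<^sup>2 / (2 * L)"
definition "K3 = K1 / (2 * L) + C * M\<^sup>2"
definition "K4 = K1 / (2 * L) + C / (2 * L) + C * (M + 1)\<^sup>2 / (2 * L) + C * (M + 1)\<^sup>2"
definition "K5 = L * K2 + 6 * L * K4"

lemma M_pos: "0 < M" using L_pos k_pos by (simp add: M_def)
lemma K1_nonneg: "0 \<le> K1" using L_pos C_pos by (simp add: K1_def)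
lemma K2_nonneg: "0 \<le> K2" using L_pos C_pos by (simp add: K2_def)
lemma K4_nonneg: "0 \<le> K4" using L_pos C_pos K1_nonneg by (simp add: K4_def)
lemma K5_nonneg: "0 \<le> K5" using L_pos K2_nonneg K4_nonneg by (simp add: K5_def)

lemma c_in: "t \<in> {a..b} \<Longrightarrow> c t \<in> S"
  using near[of t 0] r_pos by simp

lemma lipschitz:
  assumes "a \<le> s" "s \<le> t" "t \<le> b"
  shows "norm (c t - c s) \<le> M * (t - s)"
proof -
  have "k * norm (c t - c s) \<le> L * (t - s)"
    using \<delta>_coercive[of s t] geo[of s t] assms by auto
  then show ?thesis using k_pos by (simp add: M_def field_simps)
qed

lemma lipschitz':
  assumes "s \<in> {a..b}" "t \<in> {a..b}"
  shows "norm (c t - c s) \<le> M * \<bar>t - s\<bar>"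
  using lipschitz[of s t] lipschitz[of t s] assms by (cases "s \<le> t") (auto simp: norm_minus_commute)

text \<open>Measured at its starting point, a chord has norm at most L h up to a quadratic error.
  The bound is kept in squared form because g, unlike its root, expands algebraically when base
  point and vector are perturbed.\<close>

lemma energy:
  assumes "a \<le> u" "0 < h" "u + h \<le> b"
  shows "g (c u) (c (u + h) - c u) (c (u + h) - c u) \<le> L\<^sup>2 * h\<^sup>2 + K1 * h ^ 3"
proof -
  let ?D = "c (u + h) - c u"
  have u: "c u \<in> S" using assms by (intro c_in) auto
  have n: "norm ?D \<le> M * h" using lipschitz[of u "u + h"] assms by simp
  have "nrm (c u) ?D \<le> L * h + C * (norm ?D)\<^sup>2"
    using \<delta>_lower[of u "u + h"] geo[of u "u + h"] assms by (auto simp: nrm_def)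
  also have "\<dots> \<le> L * h + C * (M * h)\<^sup>2"
    using n C_pos by (intro add_left_mono mult_left_mono power_mono) auto
  finally have "(nrm (c u) ?D)\<^sup>2 \<le> (L * h + C * (M * h)\<^sup>2)\<^sup>2"
    using nrm_nonneg[OF u] by (intro power_mono)
  also have "\<dots> = L\<^sup>2 * h\<^sup>2 + (2 * L * C * M\<^sup>2) * h ^ 3 + (C\<^sup>2 * M ^ 4) * h ^ 4"
    by (simp add: power2_eq_square power3_eq_cube power4_eq_xxxx algebra_simps)
  \<comment> \<open>The interval has length at most 1, so h \<le> 1 and the fourth power is absorbed
    by the third.\<close>
  also have "\<dots> \<le> L\<^sup>2 * h\<^sup>2 + (2 * L * C * M\<^sup>2) * h ^ 3 + (C\<^sup>2 * M ^ 4) * h ^ 3"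
    using assms ab by (intro add_left_mono mult_left_mono power_decreasing) auto
  also have "\<dots> = L\<^sup>2 * h\<^sup>2 + K1 * h ^ 3" by (simp add: K1_def algebra_simps)
  finally show ?thesis by (simp add: nrm_sq[OF u])
qed

text \<open>The chord itself does not change under translation; only the base point of the metric
  moves, and the Taylor expansion of g in \<epsilon> w gives its effect.\<close>

lemma shift_step:
  assumes u: "a \<le> u" "0 < h" "u + h \<le> b" and w: "norm w \<le> 1" and e: "0 < \<epsilon>" "\<epsilon> \<le> r"
    and B: "dg (c u) w (c (u + h) - c u) (c (u + h) - c u) \<le> B * h\<^sup>2"
  shows "\<delta> (c u + \<epsilon> *\<^sub>R w) (c (u + h) + \<epsilon> *\<^sub>R w) \<le> (L + \<epsilon> * B / (2 * L) + K2 * \<epsilon>\<^sup>2) * h + K3 * h\<^sup>2"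
proof -
  let ?D = "c (u + h) - c u" and ?x = "c u + \<epsilon> *\<^sub>R w"
  have ew: "norm (\<epsilon> *\<^sub>R w) \<le> \<epsilon>" using w e by (simp add: mult_left_le)
  have x: "c u \<in> S" using u by (intro c_in) auto
  have y: "?x \<in> S" using u e by (intro near order.trans[OF ew]) auto
  have y': "c (u + h) + \<epsilon> *\<^sub>R w \<in> S" using u e by (intro near order.trans[OF ew]) auto
  have n: "norm ?D \<le> M * h" using lipschitz[of u "u + h"] u by simp
  then have n2: "(norm ?D)\<^sup>2 \<le> M\<^sup>2 * h\<^sup>2"
    by (metis norm_ge_zero power_mono power_mult_distrib)
  have "g ?x ?D ?D \<le> g (c u) ?D ?D + dg (c u) (\<epsilon> *\<^sub>R w) ?D ?D + C * (norm (\<epsilon> *\<^sub>R w))\<^sup>2 * norm ?D * norm ?D"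
    using taylor[OF x y, of ?D ?D] by (simp add: abs_le_iff)
  also have "dg (c u) (\<epsilon> *\<^sub>R w) ?D ?D = \<epsilon> * dg (c u) w ?D ?D"
    using linear_scale[OF dg_linear[OF x]] by simp
  also have "C * (norm (\<epsilon> *\<^sub>R w))\<^sup>2 * norm ?D * norm ?D \<le> C * \<epsilon>\<^sup>2 * (M\<^sup>2 * h\<^sup>2)"
    using n2 ew C_pos unfolding mult.assoc power2_eq_square[of "norm ?D", symmetric]
    by (intro mult_mono power_mono) auto
  also have "\<epsilon> * dg (c u) w ?D ?D \<le> \<epsilon> * (B * h\<^sup>2)"
    using B e by (intro mult_left_mono) auto
  also have "g (c u) ?D ?D \<le> L\<^sup>2 * h\<^sup>2 + K1 * h ^ 3" by (rule energy[OF u])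
  finally have G: "g ?x ?D ?D \<le> L\<^sup>2 * h\<^sup>2 + K1 * h ^ 3 + \<epsilon> * (B * h\<^sup>2) + C * \<epsilon>\<^sup>2 * (M\<^sup>2 * h\<^sup>2)" by simp
  have "\<delta> ?x (c (u + h) + \<epsilon> *\<^sub>R w) \<le> sqrt (g ?x ?D ?D) + C * (norm ?D)\<^sup>2"
    using \<delta>_upper[OF y y'] by simp
  \<comment> \<open>The tangent of the root is taken at (L h)^2, the value of the squared chord up
    to higher order in h and \<epsilon>, so this linearization loses nothing at first order.\<close>
  also have "sqrt (g ?x ?D ?D) \<le> (g ?x ?D ?D / (L * h) + L * h) / 2"
    using L_pos u g_nonneg[OF y] by (intro sqrt_le_amgm) auto
  also have "\<dots> \<le> ((L\<^sup>2 * h\<^sup>2 + K1 * h ^ 3 + \<epsilon> * (B * h\<^sup>2) + C * \<epsilon>\<^sup>2 * (M\<^sup>2 * h\<^sup>2)) / (L * h) + L * h) / 2"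
    using G L_pos u by (intro divide_right_mono add_right_mono) auto
  also have "\<dots> = L * h + K1 / (2 * L) * h\<^sup>2 + (\<epsilon> * B / (2 * L)) * h + K2 * \<epsilon>\<^sup>2 * h"
    using L_pos u by (simp add: K2_def field_simps power2_eq_square power3_eq_cube)
  also have "C * (norm ?D)\<^sup>2 \<le> C * M\<^sup>2 * h\<^sup>2"
    using n2 C_pos by simp
  finally show ?thesis by (simp add: K3_def algebra_simps)
qed

text \<open>Finer and finer subdivisions remove the K3 term. The K2 term is linear in the parameter
  and survives, but it is of second order in \<epsilon>.\<close>

lemma shift_middle:
  assumes s: "a \<le> s" "s \<le> t" "t \<le> b" and w: "norm w \<le> 1" and e: "0 < \<epsilon>" "\<epsilon> \<le> r"
    and B: "\<And>u h. s \<le> u \<Longrightarrow> 0 < h \<Longrightarrow> u + h \<le> t \<Longrightarrow>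
       dg (c u) w (c (u + h) - c u) (c (u + h) - c u) \<le> B * h\<^sup>2"
  shows "\<delta> (c s + \<epsilon> *\<^sub>R w) (c t + \<epsilon> *\<^sub>R w) \<le> (L + \<epsilon> * B / (2 * L) + K2 * \<epsilon>\<^sup>2) * (t - s)"
proof (cases "s = t")
  case False
  then show ?thesis
    using s w e B by (intro chain_bound[where F = "\<lambda>u. c u + \<epsilon> *\<^sub>R w" and K' = K3] tri shift_step) auto
qed (simp add: \<delta>_refl)

text \<open>Covers both transitions of the competitor: the outgoing one starts at x = c t, the
  returning one at the translate and runs in direction - w. Expanding the squared length and
  dividing by 2 L \<tau> leaves the momentum of the chord as the term linear in \<epsilon>, with
  errors \<tau>^2 and \<epsilon>^2 / \<tau>.\<close>

lemma ramp:
  assumes t: "a \<le> t" "0 < \<tau>" "t + \<tau> \<le> b" and w: "norm w \<le> 1" and e: "0 < \<epsilon>" "\<epsilon> \<le> \<tau>"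
    and x: "x \<in> S" "y \<in> S" "norm (x - c t) \<le> \<epsilon>" and xy: "y - x = c (t + \<tau>) - c t + \<epsilon> *\<^sub>R w"
  shows "\<delta> x y \<le> L * \<tau> + \<epsilon> / (L * \<tau>) * g (c t) (c (t + \<tau>) - c t) w + K4 * (\<tau>\<^sup>2 + \<epsilon>\<^sup>2 / \<tau>)"
proof -
  define D where "D = c (t + \<tau>) - c t"
  define X where "X = D + \<epsilon> *\<^sub>R w"
  have yx: "y - x = X" using xy by (simp add: X_def D_def)
  have ct: "c t \<in> S" using t by (intro c_in) auto
  have ew: "norm (\<epsilon> *\<^sub>R w) \<le> \<epsilon>" using w e by (simp add: mult_left_le)
  have D: "norm D \<le> M * \<tau>" using lipschitz[of t "t + \<tau>"] t by (simp add: D_def)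
  have "norm X \<le> norm D + norm (\<epsilon> *\<^sub>R w)" unfolding X_def by (rule norm_triangle_ineq)
  moreover have "(M + 1) * \<tau> = M * \<tau> + \<tau>" by (simp add: algebra_simps)
  ultimately have X: "norm X \<le> (M + 1) * \<tau>" using D ew e by linarith
  then have X2: "(norm X)\<^sup>2 \<le> (M + 1)\<^sup>2 * \<tau>\<^sup>2"
    by (metis norm_ge_zero power_mono power_mult_distrib)
  have "g x X X \<le> g (c t) X X + C * norm (x - c t) * norm X * norm X"
    using g_lip[OF ct x(1), of X X] by (simp add: abs_le_iff)
  also have "C * norm (x - c t) * norm X * norm X = C * norm (x - c t) * (norm X)\<^sup>2"
    by (simp add: power2_eq_square)
  \<comment> \<open>Replacing the metric at x by the one at c t costs a factor of at most \<epsilon>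
    \<le> \<tau>, hence a cubic term in \<tau>.\<close>
  also have "\<dots> \<le> C * \<tau> * ((M + 1)\<^sup>2 * \<tau>\<^sup>2)"
    using X2 x(3) e C_pos by (intro mult_mono) auto
  also have "g (c t) X X = g (c t) D D + 2 * \<epsilon> * g (c t) D w + \<epsilon>\<^sup>2 * g (c t) w w"
    unfolding X_def using bilin[OF ct] sym[OF ct, of w D]
    by (simp add: bilinear_ladd bilinear_radd bilinear_lmul bilinear_rmul power2_eq_square algebra_simps)
  also have "\<epsilon>\<^sup>2 * g (c t) w w \<le> \<epsilon>\<^sup>2 * C"
  proof -
    have "g (c t) w w \<le> C * norm w * norm w" using g_bound[OF ct, of w w] by simp
    also have "\<dots> \<le> C * 1 * 1" using w C_pos by (intro mult_mono) auto
    finally show ?thesis by (simp add: mult_left_mono)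
  qed
  also have "g (c t) D D \<le> L\<^sup>2 * \<tau>\<^sup>2 + K1 * \<tau> ^ 3" unfolding D_def by (rule energy[OF t])
  finally have G: "g x X X \<le> L\<^sup>2 * \<tau>\<^sup>2 + K1 * \<tau> ^ 3 + 2 * \<epsilon> * g (c t) D w + \<epsilon>\<^sup>2 * C
      + C * \<tau> * ((M + 1)\<^sup>2 * \<tau>\<^sup>2)" by simp
  have "\<delta> x y \<le> sqrt (g x X X) + C * (norm X)\<^sup>2" using \<delta>_upper[OF x(1,2)] by (simp add: yx)
  also have "sqrt (g x X X) \<le> (g x X X / (L * \<tau>) + L * \<tau>) / 2"
    using L_pos t g_nonneg[OF x(1)] by (intro sqrt_le_amgm) auto
  also have "\<dots> \<le> ((L\<^sup>2 * \<tau>\<^sup>2 + K1 * \<tau> ^ 3 + 2 * \<epsilon> * g (c t) D w + \<epsilon>\<^sup>2 * C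
      + C * \<tau> * ((M + 1)\<^sup>2 * \<tau>\<^sup>2)) / (L * \<tau>) + L * \<tau>) / 2"
    using G L_pos t by (intro divide_right_mono add_right_mono) auto
  also have "\<dots> = L * \<tau> + K1 / (2 * L) * \<tau>\<^sup>2 + \<epsilon> / (L * \<tau>) * g (c t) D w
       + C / (2 * L) * (\<epsilon>\<^sup>2 / \<tau>) + C * (M + 1)\<^sup>2 / (2 * L) * \<tau>\<^sup>2"
    using L_pos t by (simp add: field_simps power2_eq_square power3_eq_cube)
  also have "C * (norm X)\<^sup>2 \<le> C * (M + 1)\<^sup>2 * \<tau>\<^sup>2"
    using X2 C_pos by simp
  finally have "\<delta> x y \<le> L * \<tau> + \<epsilon> / (L * \<tau>) * g (c t) D w
    + ((K1 / (2 * L) + C * (M + 1)\<^sup>2 / (2 * L) + C * (M + 1)\<^sup>2) * \<tau>\<^sup>2 + C / (2 * L) * (\<epsilon>\<^sup>2 / \<tau>))"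
    by (simp add: algebra_simps)
  also have "\<dots> \<le> L * \<tau> + \<epsilon> / (L * \<tau>) * g (c t) D w + (K4 * \<tau>\<^sup>2 + K4 * (\<epsilon>\<^sup>2 / \<tau>))"
    using L_pos C_pos K1_nonneg t by (intro add_left_mono add_mono mult_right_mono) (auto simp: K4_def)
  finally show ?thesis by (simp add: D_def distrib_left)
qed

section \<open>Momenta of difference quotients\<close>

definition D :: "real \<Rightarrow> real \<Rightarrow> 'a" where "D \<tau> t = (1 / \<tau>) *\<^sub>R (c (t + \<tau>) - c t)"

text \<open>The competitor moves to the translate \<open>c + \<epsilon> w\<close> during \<open>[s, s + \<tau>]\<close>, follows it until \<open>t\<close>, and
  returns to \<open>c\<close> during \<open>[t, t + \<sigma>]\<close>. The choice \<open>\<epsilon> = \<tau> sqrt \<tau> / 2\<close> balances the two error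
  terms \<open>\<tau>\<^sup>2 / \<epsilon>\<close> and \<open>\<epsilon> / \<tau>\<close>.\<close>

lemma momentum_growth:
  assumes s: "a \<le> s" "0 < \<tau>" "s + \<tau> \<le> t" "t + \<sigma> \<le> b" "\<tau> / 2 \<le> \<sigma>" "\<sigma> \<le> \<tau>" "\<tau> \<le> r"
    and w: "norm w \<le> 1"
    and B: "\<And>u h. s + \<tau> \<le> u \<Longrightarrow> 0 < h \<Longrightarrow> u + h \<le> t \<Longrightarrow>
       dg (c u) w (c (u + h) - c u) (c (u + h) - c u) \<le> B * h\<^sup>2"
  shows "g (c t) (D \<sigma> t) w - g (c s) (D \<tau> s) w \<le> B / 2 * (t - s - \<tau>) + K5 * sqrt \<tau>"
proof -
  \<comment> \<open>The factor 1/2 ensures e \<le> \<tau> / 2 \<le> \<sigma>, so that the shorter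
    returning ramp also meets the condition of \<open>ramp\<close>.\<close>
  define e where "e = \<tau> * sqrt \<tau> / 2"
  have t1: "\<tau> \<le> 1" "0 < sqrt \<tau>" "sqrt \<tau> \<le> 1" "0 < \<sigma>" using s ab by auto
  then have "\<tau> * sqrt \<tau> \<le> \<tau>" using s by (intro mult_left_le) auto
  then have "e \<le> \<tau> / 2" "0 < e" using s by (auto simp: e_def)
  then have e: "0 < e" "e \<le> \<sigma>" "e \<le> \<tau>" "e \<le> r" "e \<le> 1" "e \<le> \<tau> / 2" using s t1 by linarith+
  have ew: "norm (e *\<^sub>R w) \<le> e" using w e by (simp add: mult_left_le)
  have cs: "c s \<in> S" "c t \<in> S" "c (t + \<sigma>) \<in> S" using s t1 by (auto intro!: c_in)
  have S1: "c (s + \<tau>) + e *\<^sub>R w \<in> S" "c t + e *\<^sub>R w \<in> S" using s t1 e by (auto intro!: near order.trans[OF ew])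
  let ?Gs = "g (c s) (c (s + \<tau>) - c s) w" and ?Gt = "g (c t) (c (t + \<sigma>) - c t) w"
  have r1: "\<delta> (c s) (c (s + \<tau>) + e *\<^sub>R w) \<le> L * \<tau> + e / (L * \<tau>) * ?Gs + K4 * (\<tau>\<^sup>2 + e\<^sup>2 / \<tau>)"
    using s t1 e w cs S1 by (intro ramp) auto
  have m: "\<delta> (c (s + \<tau>) + e *\<^sub>R w) (c t + e *\<^sub>R w) \<le> (L + e * B / (2 * L) + K2 * e\<^sup>2) * (t - (s + \<tau>))"
    using s t1 e w B by (intro shift_middle) auto
  have "\<delta> (c t + e *\<^sub>R w) (c (t + \<sigma>))
      \<le> L * \<sigma> + e / (L * \<sigma>) * g (c t) (c (t + \<sigma>) - c t) (- w) + K4 * (\<sigma>\<^sup>2 + e\<^sup>2 / \<sigma>)"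
    using s t1 e w cs S1 ew by (intro ramp) auto
  then have r2: "\<delta> (c t + e *\<^sub>R w) (c (t + \<sigma>)) \<le> L * \<sigma> - e / (L * \<sigma>) * ?Gt + K4 * (\<sigma>\<^sup>2 + e\<^sup>2 / \<sigma>)"
    using bilinear_rneg[OF bilin[OF cs(2)]] by simp
  \<comment> \<open>Minimality enters here: the competitor cannot undercut the distance of its ends.
    The main terms L \<tau>, L (t - s - \<tau>) and L \<sigma> of its three pieces add up to that
    distance and cancel.\<close>
  have "L * (t + \<sigma> - s) = \<delta> (c s) (c (t + \<sigma>))" using geo[of s "t + \<sigma>"] s t1 by simp
  also have "\<dots> \<le> \<delta> (c s) (c (s + \<tau>) + e *\<^sub>R w) + (\<delta> (c (s + \<tau>) + e *\<^sub>R w) (c t + e *\<^sub>R w)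
      + \<delta> (c t + e *\<^sub>R w) (c (t + \<sigma>)))"
    using tri[of "c s" "c (t + \<sigma>)" "c (s + \<tau>) + e *\<^sub>R w"]
      tri[of "c (s + \<tau>) + e *\<^sub>R w" "c (t + \<sigma>)" "c t + e *\<^sub>R w"] by linarith
  finally have "e / (L * \<sigma>) * ?Gt - e / (L * \<tau>) * ?Gs \<le> (e * B / (2 * L) + K2 * e\<^sup>2) * (t - (s + \<tau>))
      + K4 * (\<tau>\<^sup>2 + e\<^sup>2 / \<tau>) + K4 * (\<sigma>\<^sup>2 + e\<^sup>2 / \<sigma>)"
    using r1 m r2 by (simp add: algebra_simps)
  then have "(L / e) * (e / (L * \<sigma>) * ?Gt - e / (L * \<tau>) * ?Gs) \<le> (L / e) * ((e * B / (2 * L) + K2 * e\<^sup>2) * (t - (s + \<tau>))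
      + K4 * (\<tau>\<^sup>2 + e\<^sup>2 / \<tau>) + K4 * (\<sigma>\<^sup>2 + e\<^sup>2 / \<sigma>))"
    using L_pos e by (intro mult_left_mono) auto
  also have "(L / e) * (e / (L * \<sigma>) * ?Gt - e / (L * \<tau>) * ?Gs) = ?Gt / \<sigma> - ?Gs / \<tau>"
    using L_pos e s t1 by (simp add: field_simps)
  also have "\<dots> = g (c t) (D \<sigma> t) w - g (c s) (D \<tau> s) w"
    using bilinear_lmul[OF bilin[OF cs(2)]] bilinear_lmul[OF bilin[OF cs(1)]] by (simp add: D_def)
  also have "(L / e) * ((e * B / (2 * L) + K2 * e\<^sup>2) * (t - (s + \<tau>))
      + K4 * (\<tau>\<^sup>2 + e\<^sup>2 / \<tau>) + K4 * (\<sigma>\<^sup>2 + e\<^sup>2 / \<sigma>))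
      = B / 2 * (t - s - \<tau>) + L * K2 * (e * (t - s - \<tau>)) + L * K4 * (\<tau>\<^sup>2 / e + \<sigma>\<^sup>2 / e + e / \<tau> + e / \<sigma>)"
    using L_pos e s t1 by (simp add: field_simps power2_eq_square)
  also have "\<dots> \<le> B / 2 * (t - s - \<tau>) + L * K2 * sqrt \<tau> + L * K4 * (6 * sqrt \<tau>)"
  proof (rule add_mono[OF add_mono[OF order_refl mult_left_mono] mult_left_mono])
    have "e * (t - s - \<tau>) \<le> e * 1" using e s ab t1 by (intro mult_left_mono) auto
    also have "\<dots> \<le> 1 * sqrt \<tau>" unfolding e_def using t1 s by simp
    finally show "e * (t - s - \<tau>) \<le> sqrt \<tau>" by simp
    have "\<tau>\<^sup>2 / e = 2 * sqrt \<tau>" using s by (simp add: e_def field_simps power2_eq_square)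
    moreover have "\<sigma>\<^sup>2 / e \<le> \<tau>\<^sup>2 / e" using s t1 e by (intro divide_right_mono power_mono) auto
    moreover have "e / \<tau> = sqrt \<tau> / 2" using s by (simp add: e_def)
    moreover have "e / \<sigma> \<le> sqrt \<tau>"
    proof -
      have "e / \<sigma> \<le> e / (\<tau> / 2)" using s t1 e by (intro divide_left_mono) auto
      also have "\<dots> = sqrt \<tau>" using s by (simp add: e_def)
      finally show ?thesis .
    qed
    \<comment> \<open>The sum 2 + 2 + 1/2 + 1, rounded up, is the 6 in \<open>K5\<close>.\<close>
    ultimately have "\<tau>\<^sup>2 / e + \<sigma>\<^sup>2 / e + e / \<tau> + e / \<sigma> \<le> 2 * sqrt \<tau> + 2 * sqrt \<tau> + sqrt \<tau> / 2 + sqrt \<tau>"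
      by (intro add_mono) auto
    then show "\<tau>\<^sup>2 / e + \<sigma>\<^sup>2 / e + e / \<tau> + e / \<sigma> \<le> 6 * sqrt \<tau>" using t1 by linarith
  qed (use L_pos K2_nonneg K4_nonneg in auto)
  finally show ?thesis by (simp add: K5_def algebra_simps)
qed

section \<open>Convergence of the difference quotients\<close>

definition "K6 = (2 * C * M\<^sup>2 + K5) / k\<^sup>2"

lemma K6_nonneg: "0 \<le> K6" using C_pos K5_nonneg by (simp add: K6_def)

lemma norm_D: "a \<le> s \<Longrightarrow> 0 < \<tau> \<Longrightarrow> s + \<tau> \<le> b \<Longrightarrow> norm (D \<tau> s) \<le> M"
  using lipschitz[of s "s + \<tau>"] by (simp add: D_def divide_le_eq mult.commute del: scaleR_right_diff_distrib)

text \<open>The crude bound B = C M^2 limits the growth of the momenta; measuring both quotients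
  with the metric at c s costs another C M^2 (t - s). \<open>norm_le_of_unit_bound\<close> then
  removes w.\<close>

lemma D_diff:
  assumes s: "a \<le> s" "0 < \<tau>" "s + \<tau> \<le> t" "t + \<sigma> \<le> b" "\<tau> / 2 \<le> \<sigma>" "\<sigma> \<le> \<tau>" "\<tau> \<le> r"
  shows "norm (D \<sigma> t - D \<tau> s) \<le> K6 * (t - s + sqrt \<tau>)"
proof -
  have cs: "c s \<in> S" "c t \<in> S" using s by (auto intro!: c_in)
  have "g (c s) (D \<sigma> t - D \<tau> s) w \<le> 2 * C * M\<^sup>2 * (t - s) + K5 * sqrt \<tau>" if w: "norm w \<le> 1" for w
  proof -
    have "dg (c u) w (c (u + h) - c u) (c (u + h) - c u) \<le> (C * M\<^sup>2) * h\<^sup>2"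
      if "s + \<tau> \<le> u" "0 < h" "u + h \<le> t" for u h
    proof -
      have n: "norm (c (u + h) - c u) \<le> M * h" using lipschitz[of u "u + h"] that s by simp
      have "c u \<in> S" using that s by (intro c_in) auto
      from dg_bound[OF this, of w "c (u + h) - c u" "c (u + h) - c u"]
      have "dg (c u) w (c (u + h) - c u) (c (u + h) - c u)
          \<le> C * norm w * norm (c (u + h) - c u) * norm (c (u + h) - c u)" by simp
      also have "\<dots> \<le> C * 1 * (M * h) * (M * h)"
        using n w C_pos M_pos that by (intro mult_mono) auto
      finally show ?thesis by (simp add: power2_eq_square algebra_simps)
    qed
    from momentum_growth[OF s w this]
    have "g (c t) (D \<sigma> t) w - g (c s) (D \<tau> s) w \<le> C * M\<^sup>2 / 2 * (t - s - \<tau>) + K5 * sqrt \<tau>" .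
    also have "C * M\<^sup>2 / 2 * (t - s - \<tau>) \<le> C * M\<^sup>2 * (t - s)"
      using C_pos M_pos s by (intro mult_mono) auto
    finally have 1: "g (c t) (D \<sigma> t) w - g (c s) (D \<tau> s) w \<le> C * M\<^sup>2 * (t - s) + K5 * sqrt \<tau>" by simp
    have "g (c s) (D \<sigma> t) w - g (c t) (D \<sigma> t) w \<le> C * norm (c t - c s) * norm (D \<sigma> t) * norm w"
      using g_lip[OF cs, of "D \<sigma> t" w] by (simp add: abs_le_iff)
    also have "\<dots> \<le> C * (M * (t - s)) * M * 1"
      using lipschitz[of s t] norm_D[of t \<sigma>] s w C_pos M_pos by (intro mult_mono) auto
    finally have "g (c s) (D \<sigma> t) w - g (c t) (D \<sigma> t) w \<le> C * M\<^sup>2 * (t - s)"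
      by (simp add: power2_eq_square algebra_simps)
    moreover have "g (c s) (D \<sigma> t - D \<tau> s) w = g (c s) (D \<sigma> t) w - g (c s) (D \<tau> s) w"
      by (rule bilinear_lsub[OF bilin[OF cs(1)]])
    ultimately show ?thesis using 1 by linarith
  qed
  from norm_le_of_unit_bound[OF cs(1) this]
  have "norm (D \<sigma> t - D \<tau> s) \<le> (2 * C * M\<^sup>2 * (t - s) + K5 * sqrt \<tau>) / k\<^sup>2" .
  also have "\<dots> \<le> ((2 * C * M\<^sup>2 + K5) * (t - s) + (2 * C * M\<^sup>2 + K5) * sqrt \<tau>) / k\<^sup>2"
    using C_pos M_pos K5_nonneg s by (intro divide_right_mono add_mono mult_right_mono) auto
  also have "\<dots> = K6 * (t - s + sqrt \<tau>)" by (simp add: K6_def field_simps)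
  finally show ?thesis .
qed

text \<open>Minimality compares quotients only at places so far apart that the ramps do not overlap.
  Two step sizes at the same s are therefore both compared with the quotient at s + \<tau>; this is
  why the two ramps in \<open>momentum_growth\<close> may differ in length.\<close>

lemma D_Cauchy_step:
  assumes s: "a \<le> s" "0 < \<tau>" "s + 2 * \<tau> \<le> b" "\<tau> / 2 \<le> \<sigma>" "\<sigma> \<le> \<tau>" "\<tau> \<le> r"
  shows "norm (D \<tau> s - D \<sigma> s) \<le> 4 * K6 * sqrt \<tau>"
proof -
  have "\<tau> \<le> sqrt \<tau>" using s ab by (intro le_sqrt_self) auto
  then have K: "K6 * \<tau> \<le> K6 * sqrt \<tau>" using K6_nonneg by (rule mult_left_mono)
  have "norm (D \<sigma> (s + \<tau>) - D \<tau> s) \<le> K6 * (s + \<tau> - s + sqrt \<tau>)"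
    using s by (intro D_diff) auto
  then have 1: "norm (D \<sigma> (s + \<tau>) - D \<tau> s) \<le> 2 * K6 * sqrt \<tau>" using K by (simp add: algebra_simps)
  have "norm (D \<sigma> (s + \<tau>) - D \<sigma> s) \<le> K6 * (s + \<tau> - s + sqrt \<sigma>)"
    using s by (intro D_diff) auto
  moreover have "K6 * sqrt \<sigma> \<le> K6 * sqrt \<tau>" using s K6_nonneg by (intro mult_left_mono) auto
  ultimately have 2: "norm (D \<sigma> (s + \<tau>) - D \<sigma> s) \<le> 2 * K6 * sqrt \<tau>"
    using K by (simp add: algebra_simps)
  have "norm (D \<tau> s - D \<sigma> s) \<le> norm (D \<sigma> (s + \<tau>) - D \<sigma> s) + norm (D \<sigma> (s + \<tau>) - D \<tau> s)"
    using norm_triangle_ineq4[of "D \<sigma> (s + \<tau>) - D \<sigma> s" "D \<sigma> (s + \<tau>) - D \<tau> s"] by simp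
  then show ?thesis using 1 2 by simp
qed

text \<open>Repeated halving reaches every smaller step. The errors form a geometric series, bounded
  with ratio 3/4, and 16 solves 4 + (3/4) * 16 = 16.\<close>

lemma D_Cauchy:
  assumes "a \<le> s" "0 < \<tau>" "s + 2 * \<tau> \<le> b" "\<tau> \<le> r" "0 < \<sigma>" "\<sigma> \<le> \<tau>"
  shows "norm (D \<tau> s - D \<sigma> s) \<le> 16 * K6 * sqrt \<tau>"
proof -
  have "norm (D \<tau> s - D \<sigma> s) \<le> 16 * K6 * sqrt \<tau>"
    if "0 < \<tau>" "s + 2 * \<tau> \<le> b" "\<tau> \<le> r" "\<sigma> \<le> \<tau>" "\<tau> / 2 ^ n \<le> \<sigma>" for n \<tau>
    using that
  proof (induction n arbitrary: \<tau>)
    case 0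
    then have "\<sigma> = \<tau>" by simp
    then show ?case using K6_nonneg 0 by simp
  next
    case (Suc n)
    have "4 * K6 * sqrt \<tau> \<le> 16 * K6 * sqrt \<tau>" using K6_nonneg Suc by (intro mult_right_mono) auto
    show ?case
    proof (cases "\<tau> / 2 \<le> \<sigma>")
      case True
      then have "norm (D \<tau> s - D \<sigma> s) \<le> 4 * K6 * sqrt \<tau>" using assms Suc by (intro D_Cauchy_step) auto
      also have "\<dots> \<le> 16 * K6 * sqrt \<tau>" using K6_nonneg Suc by (intro mult_right_mono) auto
      finally show ?thesis .
    next
      case False
      have "norm (D (\<tau> / 2) s - D \<sigma> s) \<le> 16 * K6 * sqrt (\<tau> / 2)"
        using False Suc.prems by (intro Suc.IH) auto
      \<comment> \<open>1/2 is enlarged to 9/16 to make its root rational.\<close>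
      also have "\<dots> \<le> 16 * K6 * sqrt ((3 / 4)\<^sup>2 * \<tau>)"
        using Suc.prems K6_nonneg
        by (intro mult_left_mono real_sqrt_le_mono) (auto simp: power2_eq_square)
      also have "\<dots> = 12 * K6 * sqrt \<tau>" by (simp add: real_sqrt_mult)
      finally have 1: "norm (D (\<tau> / 2) s - D \<sigma> s) \<le> 12 * K6 * sqrt \<tau>" .
      have 2: "norm (D \<tau> s - D (\<tau> / 2) s) \<le> 4 * K6 * sqrt \<tau>"
        using assms Suc.prems by (intro D_Cauchy_step) auto
      have "norm (D \<tau> s - D \<sigma> s) \<le> norm (D \<tau> s - D (\<tau> / 2) s) + norm (D (\<tau> / 2) s - D \<sigma> s)"
        using norm_triangle_ineq[of "D \<tau> s - D (\<tau> / 2) s" "D (\<tau> / 2) s - D \<sigma> s"] by simp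
      then show ?thesis using 1 2 by simp
    qed
  qed
  moreover obtain n where "\<tau> / 2 ^ n \<le> \<sigma>"
  proof -
    obtain n where "\<tau> / \<sigma> < 2 ^ n" using real_arch_pow[of 2 "\<tau> / \<sigma>"] by auto
    then show ?thesis using that[of n] assms by (simp add: field_simps)
  qed
  ultimately show ?thesis using assms by blast
qed

end

text \<open>Forward difference quotients need room up to \<open>b\<close>; a right endpoint is handled later by
  reversing the curve.\<close>

locale minimizer_sub = minimizer +
  fixes e :: real
  assumes e: "a < e" "e < b"
begin

text \<open>Every point of [a, e] has room 2 * \<open>\<eta>\<close> before b, as
  \<open>D_Cauchy\<close> demands, and steps up to r keep the shifts, which never exceed the step,
  inside S. The velocity is defined through one sequence of steps; \<open>D_v\<close> extends the
  convergence to all small steps, with a rate.\<close>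

definition "\<eta> = min r ((b - e) / 2)"
definition "\<tau> n = \<eta> / real (Suc n)"
definition "v s = lim (\<lambda>n. D (\<tau> n) s)"
definition "K7 = 16 * K6"

lemma K7_nonneg: "0 \<le> K7" using K6_nonneg by (simp add: K7_def)

lemma \<eta>_pos: "0 < \<eta>" using r_pos e by (simp add: \<eta>_def)
lemma \<eta>_le: "\<eta> \<le> r" "2 * \<eta> \<le> b - e" "\<eta> \<le> 1" using e ab by (auto simp: \<eta>_def min_def)

lemma \<tau>_pos: "0 < \<tau> n" using \<eta>_pos by (simp add: \<tau>_def)
lemma \<tau>_le: "\<tau> n \<le> \<eta>" using \<eta>_pos by (simp add: \<tau>_def field_simps)
lemma \<tau>_lim: "\<tau> \<longlonglongrightarrow> 0"
  using tendsto_mult[OF tendsto_const LIMSEQ_inverse_real_of_nat, of \<eta>]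
  unfolding \<tau>_def by (simp add: divide_inverse)
lemma sqrt_\<tau>_lim: "(\<lambda>n. sqrt (\<tau> n)) \<longlonglongrightarrow> 0"
  using tendsto_real_sqrt[OF \<tau>_lim] by simp
lemma \<tau>_antimono: "m \<le> n \<Longrightarrow> \<tau> n \<le> \<tau> m"
  unfolding \<tau>_def using \<eta>_pos by (intro divide_left_mono) auto

lemma subinterval: "s \<in> {a..e} \<Longrightarrow> 0 < \<sigma> \<Longrightarrow> \<sigma> \<le> \<eta> \<Longrightarrow> a \<le> s \<and> s + 2 * \<sigma> \<le> b \<and> s + \<sigma> \<le> b \<and> \<sigma> \<le> r \<and> s \<le> b"
  using \<eta>_le by auto

lemma v_lim:
  assumes s: "s \<in> {a..e}"
  shows "(\<lambda>n. D (\<tau> n) s) \<longlonglongrightarrow> v s"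
proof -
  have "Cauchy (\<lambda>n. D (\<tau> n) s)"
  proof (rule CauchyI)
    fix \<epsilon> :: real assume "0 < \<epsilon>"
    have "(\<lambda>n. 2 * K7 * sqrt (\<tau> n)) \<longlonglongrightarrow> 2 * K7 * 0" by (intro tendsto_intros sqrt_\<tau>_lim)
    then have "\<forall>\<^sub>F n in sequentially. 2 * K7 * sqrt (\<tau> n) < \<epsilon>"
      using \<open>0 < \<epsilon>\<close> by (intro order_tendstoD) auto
    then obtain N where N: "2 * K7 * sqrt (\<tau> N) < \<epsilon>" by (auto simp: eventually_sequentially)
    have *: "norm (D (\<tau> N) s - D (\<tau> n) s) \<le> K7 * sqrt (\<tau> N)" if "n \<ge> N" for n
      using subinterval[OF s \<tau>_pos \<tau>_le, of N] \<tau>_pos \<tau>_antimono[OF that] unfolding K7_def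
      by (intro D_Cauchy) auto
    have "norm (D (\<tau> m) s - D (\<tau> n) s) < \<epsilon>" if "m \<ge> N" "n \<ge> N" for m n
      using norm_triangle_ineq4[of "D (\<tau> N) s - D (\<tau> n) s" "D (\<tau> N) s - D (\<tau> m) s"]
        *[OF that(1)] *[OF that(2)] N by (simp add: norm_minus_commute)
    then show "\<exists>M. \<forall>m\<ge>M. \<forall>n\<ge>M. norm (D (\<tau> m) s - D (\<tau> n) s) < \<epsilon>" by blast
  qed
  then show ?thesis unfolding v_def using Cauchy_convergent convergent_LIMSEQ_iff by blast
qed

lemma D_v:
  assumes s: "s \<in> {a..e}" and \<sigma>: "0 < \<sigma>" "\<sigma> \<le> \<eta>"
  shows "norm (D \<sigma> s - v s) \<le> K7 * sqrt \<sigma>"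
proof (rule LIMSEQ_le_const2)
  show "(\<lambda>n. norm (D \<sigma> s - D (\<tau> n) s)) \<longlonglongrightarrow> norm (D \<sigma> s - v s)"
    by (intro tendsto_intros v_lim s)
  have "\<forall>\<^sub>F n in sequentially. \<tau> n < \<sigma>" using \<sigma> by (intro order_tendstoD(2)[OF \<tau>_lim])
  then obtain N where N: "\<And>n. n \<ge> N \<Longrightarrow> \<tau> n < \<sigma>" by (auto simp: eventually_sequentially)
  show "\<exists>N. \<forall>n\<ge>N. norm (D \<sigma> s - D (\<tau> n) s) \<le> K7 * sqrt \<sigma>"
    using N subinterval[OF s \<sigma>] \<sigma> \<tau>_pos unfolding K7_def
    by (intro exI[of _ N] allI impI D_Cauchy) (auto intro: less_imp_le)
qed

lemma norm_v: assumes s: "s \<in> {a..e}" shows "norm (v s) \<le> M"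
  by (rule LIMSEQ_le_const2[OF tendsto_norm[OF v_lim[OF s]]])
    (use subinterval[OF s \<tau>_pos \<tau>_le] \<tau>_pos norm_D in auto)

text \<open>The term sqrt \<tau> in \<open>D_diff\<close> disappears in the limit, for fixed s and
  t.\<close>

lemma v_lipschitz:
  assumes s: "s \<in> {a..e}" "t \<in> {a..e}"
  shows "norm (v t - v s) \<le> K6 * \<bar>t - s\<bar>"
proof -
  have *: "norm (v t - v s) \<le> K6 * (t - s)" if s: "s \<in> {a..e}" "t \<in> {a..e}" "s < t" for s t
  proof (rule LIMSEQ_le)
    show "(\<lambda>n. norm (D (\<tau> n) t - D (\<tau> n) s)) \<longlonglongrightarrow> norm (v t - v s)"
      by (intro tendsto_intros v_lim s)
    have "(\<lambda>n. K6 * (t - s + sqrt (\<tau> n))) \<longlonglongrightarrow> K6 * (t - s + 0)"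
      by (intro tendsto_intros sqrt_\<tau>_lim)
    then show "(\<lambda>n. K6 * (t - s + sqrt (\<tau> n))) \<longlonglongrightarrow> K6 * (t - s)" by simp
    have "\<forall>\<^sub>F n in sequentially. \<tau> n < t - s" using s by (intro order_tendstoD(2)[OF \<tau>_lim]) auto
    then obtain N where N: "\<And>n. n \<ge> N \<Longrightarrow> \<tau> n < t - s" by (auto simp: eventually_sequentially)
    have "norm (D (\<tau> n) t - D (\<tau> n) s) \<le> K6 * (t - s + sqrt (\<tau> n))" if "n \<ge> N" for n
      using N[OF that] subinterval[OF s(2) \<tau>_pos \<tau>_le, of n] s \<tau>_pos[of n] \<tau>_le[of n] \<eta>_le by (intro D_diff) auto
    then show "\<exists>N. \<forall>n\<ge>N. norm (D (\<tau> n) t - D (\<tau> n) s) \<le> K6 * (t - s + sqrt (\<tau> n))" by blast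
  qed
  show ?thesis
    using *[of s t] *[of t s] s by (cases s t rule: linorder_cases) (auto simp: norm_minus_commute)
qed

section \<open>Differentiability of the curve\<close>

definition "K8 = K7 + K6"

lemma K8_nonneg: "0 \<le> K8" using K7_nonneg K6_nonneg by (simp add: K8_def)

text \<open>To the right of s this is \<open>D_v\<close>. To the left the forward quotients at s
  give no information; the expansion is made at t instead, and v t is exchanged for v s by Lipschitz
  continuity.\<close>

lemma c_expand:
  assumes s: "s \<in> {a..e}" "t \<in> {a..e}" "\<bar>t - s\<bar> \<le> \<eta>"
  shows "norm (c t - c s - (t - s) *\<^sub>R v s) \<le> K8 * (\<bar>t - s\<bar> * sqrt \<bar>t - s\<bar>)"
proof -
  have *: "norm (c t - c s - (t - s) *\<^sub>R v s) \<le> K7 * ((t - s) * sqrt (t - s))"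
    if s: "s \<in> {a..e}" "t \<in> {a..e}" "t - s \<le> \<eta>" "s < t" for s t
  proof -
    have "c t - c s - (t - s) *\<^sub>R v s = (t - s) *\<^sub>R (D (t - s) s - v s)"
      using s by (simp add: D_def algebra_simps)
    then have "norm (c t - c s - (t - s) *\<^sub>R v s) = (t - s) * norm (D (t - s) s - v s)"
      using s by simp
    also have "\<dots> \<le> (t - s) * (K7 * sqrt (t - s))"
      using s by (intro mult_left_mono D_v) auto
    finally show ?thesis by (simp add: algebra_simps)
  qed
  consider "s = t" | "s < t" | "t < s" by linarith
  then show ?thesis
  proof cases
    case 1 then show ?thesis by simp
  next
    case 2
    then have "norm (c t - c s - (t - s) *\<^sub>R v s) \<le> K7 * ((t - s) * sqrt (t - s))" using s by (intro *) auto
    also have "\<dots> \<le> K8 * ((t - s) * sqrt (t - s))"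
      using 2 K6_nonneg by (intro mult_right_mono) (auto simp: K8_def)
    finally show ?thesis using 2 by simp
  next
    case 3
    let ?h = "s - t"
    have "c t - c s - (t - s) *\<^sub>R v s = - (c s - c t - ?h *\<^sub>R v t) + ?h *\<^sub>R (v s - v t)"
      by (simp add: algebra_simps)
    then have "norm (c t - c s - (t - s) *\<^sub>R v s) \<le> norm (c s - c t - ?h *\<^sub>R v t) + ?h * norm (v s - v t)"
      using norm_triangle_ineq[of "- (c s - c t - ?h *\<^sub>R v t)" "?h *\<^sub>R (v s - v t)"] 3
      by (simp only: norm_minus_cancel norm_scaleR)
    also have "norm (c s - c t - ?h *\<^sub>R v t) \<le> K7 * (?h * sqrt ?h)" using 3 s by (intro *) auto
    also have "?h * norm (v s - v t) \<le> ?h * (K6 * sqrt ?h)"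
    proof (intro mult_left_mono)
      have "?h \<le> sqrt ?h" using 3 s \<eta>_le by (intro le_sqrt_self) auto
      then have "K6 * ?h \<le> K6 * sqrt ?h" using K6_nonneg by (rule mult_left_mono)
      then show "norm (v s - v t) \<le> K6 * sqrt ?h" using v_lipschitz[of t s] s 3 by auto
    qed (use 3 in auto)
    finally show ?thesis using 3 by (simp add: K8_def algebra_simps)
  qed
qed

lemma c_has_vector_derivative:
  assumes "s \<in> {a..e}" shows "(c has_vector_derivative v s) (at s within {a..e})"
  using c_expand[OF assms] \<eta>_pos by (intro has_vector_derivative_of_power_bound) auto

section \<open>The momentum equation and the geodesic equation\<close>

definition "K9 = C * M ^ 3 + 2 * C * M * K8"

lemma K9_nonneg: "0 \<le> K9" using C_pos M_pos K8_nonneg by (simp add: K9_def)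

lemma dg_estimate:
  assumes x: "x \<in> S" "y \<in> S" and w: "norm w \<le> 1" and u: "norm u \<le> M" "norm u' \<le> M"
  shows "\<bar>dg y w u' u' - dg x w u u\<bar> \<le> C * M\<^sup>2 * norm (y - x) + 2 * C * M * norm (u' - u)"
proof -
  have w0: "0 \<le> norm w" "0 \<le> M" "0 \<le> C" using M_pos C_pos by auto
  have "\<bar>dg y w u' u' - dg x w u' u'\<bar> \<le> C * norm (y - x) * norm w * norm u' * norm u'" by (rule dg_lip[OF x])
  also have "\<dots> \<le> C * norm (y - x) * 1 * M * M" using w u w0 by (intro mult_mono) auto
  finally have 1: "\<bar>dg y w u' u' - dg x w u' u'\<bar> \<le> C * M\<^sup>2 * norm (y - x)"
    by (simp add: power2_eq_square mult_ac)
  have "\<bar>dg x w (u' - u) u'\<bar> \<le> C * norm w * norm (u' - u) * norm u'" by (rule dg_bound[OF x(1)])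
  also have "\<dots> \<le> C * 1 * norm (u' - u) * M" using w u w0 by (intro mult_mono) auto
  finally have 2: "\<bar>dg x w (u' - u) u'\<bar> \<le> C * M * norm (u' - u)" by (simp add: mult_ac)
  have "\<bar>dg x w u (u' - u)\<bar> \<le> C * norm w * norm u * norm (u' - u)" by (rule dg_bound[OF x(1)])
  also have "\<dots> \<le> C * 1 * M * norm (u' - u)" using w u w0 by (intro mult_mono) auto
  finally have 3: "\<bar>dg x w u (u' - u)\<bar> \<le> C * M * norm (u' - u)" by (simp add: mult_ac)
  have "dg y w u' u' - dg x w u u = (dg y w u' u' - dg x w u' u') + dg x w (u' - u) u' + dg x w u (u' - u)"
    using bilinear_lsub[OF dg_bilin[OF x(1)]] bilinear_rsub[OF dg_bilin[OF x(1)]] by simp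
  then show ?thesis using 1 2 3 by linarith
qed

text \<open>On [s, t] all quotients of c are within a multiple of sqrt (t - s) of v s. Hence
  \<open>momentum_growth\<close> applies with B equal to the derivative of the metric at s plus a
  small error, and the limit \<tau> to 0 removes its own error term.\<close>

lemma momentum_upper:
  assumes s: "s \<in> {a..e}" "t \<in> {a..e}" "s < t" "t - s \<le> \<eta>" and w: "norm w \<le> 1"
  shows "g (c t) (v t) w - g (c s) (v s) w - (t - s) / 2 * dg (c s) w (v s) (v s)
    \<le> K9 * ((t - s) * sqrt (t - s))"
proof -
  let ?B = "dg (c s) w (v s) (v s) + K9 * sqrt (t - s)"
  have cs: "c s \<in> S" "c t \<in> S" using s e by (auto intro!: c_in)
  have B: "dg (c u) w (c (u + h) - c u) (c (u + h) - c u) \<le> ?B * h\<^sup>2"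
    if u: "s \<le> u" "0 < h" "u + h \<le> t" for u h
  proof -
    have cu: "c u \<in> S" using u s e by (intro c_in) auto
    have h: "h \<le> \<eta>" "u \<in> {a..e}" using u s by auto
    have "norm (D h u - v s) \<le> norm (D h u - v u) + norm (v u - v s)"
      using norm_triangle_ineq[of "D h u - v u" "v u - v s"] by simp
    also have "norm (D h u - v u) \<le> K7 * sqrt h" using u h by (intro D_v) auto
    also have "\<dots> \<le> K7 * sqrt (t - s)" using u K7_nonneg by (intro mult_left_mono) auto
    also have "norm (v u - v s) \<le> K6 * (u - s)" using v_lipschitz[of s u] h s u by auto
    also have "\<dots> \<le> K6 * sqrt (t - s)"
    proof (intro mult_left_mono K6_nonneg)
      show "u - s \<le> sqrt (t - s)" using le_sqrt_self[of "t - s"] u s \<eta>_le by auto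
    qed
    finally have vd: "norm (D h u - v s) \<le> K8 * sqrt (t - s)" by (simp add: K8_def algebra_simps)
    have "u - s \<le> sqrt (t - s)" using le_sqrt_self[of "t - s"] u s \<eta>_le by auto
    moreover have "norm (c u - c s) \<le> M * (u - s)" using lipschitz[of s u] u s e by auto
    ultimately have cd: "norm (c u - c s) \<le> M * sqrt (t - s)"
      using M_pos by (meson mult_left_mono order_trans less_imp_le)
    have "\<bar>dg (c u) w (D h u) (D h u) - dg (c s) w (v s) (v s)\<bar>
        \<le> C * M\<^sup>2 * norm (c u - c s) + 2 * C * M * norm (D h u - v s)"
      using subinterval[OF h(2) u(2) h(1)] u s by (intro dg_estimate cs cu w norm_v norm_D) auto
    also have "\<dots> \<le> C * M\<^sup>2 * (M * sqrt (t - s)) + 2 * C * M * (K8 * sqrt (t - s))"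
      using vd cd C_pos M_pos by (intro add_mono mult_left_mono) auto
    also have "\<dots> = K9 * sqrt (t - s)" by (simp add: K9_def power2_eq_square power3_eq_cube algebra_simps)
    finally have "dg (c u) w (D h u) (D h u) \<le> ?B" by (simp add: abs_le_iff)
    then have "dg (c u) w (D h u) (D h u) * h\<^sup>2 \<le> ?B * h\<^sup>2" by (intro mult_right_mono) auto
    moreover have "c (u + h) - c u = h *\<^sub>R D h u" using u by (simp add: D_def)
    ultimately show ?thesis
      using bilinear_lmul[OF dg_bilin[OF cu]] bilinear_rmul[OF dg_bilin[OF cu]]
      by (simp add: power2_eq_square mult_ac)
  qed
  have lim: "(\<lambda>n. g (c x) (D (\<tau> n) x) w) \<longlonglongrightarrow> g (c x) (v x) w" if "x \<in> {a..e}" "c x \<in> S" for x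
  proof -
    have "bounded_bilinear (g (c x))" using bilin[OF that(2)] by (simp add: bilinear_conv_bounded_bilinear)
    then show ?thesis by (intro bounded_bilinear.tendsto[where prod = "g (c x)"] v_lim that tendsto_const)
  qed
  have "g (c t) (v t) w - g (c s) (v s) w \<le> ?B / 2 * (t - s)"
  proof (rule LIMSEQ_le)
    show "(\<lambda>n. g (c t) (D (\<tau> n) t) w - g (c s) (D (\<tau> n) s) w) \<longlonglongrightarrow> g (c t) (v t) w - g (c s) (v s) w"
      using s cs by (intro tendsto_diff lim) auto
    have "(\<lambda>n. ?B / 2 * (t - s - \<tau> n) + K5 * sqrt (\<tau> n)) \<longlonglongrightarrow> ?B / 2 * (t - s - 0) + K5 * 0"
      by (intro tendsto_intros \<tau>_lim sqrt_\<tau>_lim)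
    then show "(\<lambda>n. ?B / 2 * (t - s - \<tau> n) + K5 * sqrt (\<tau> n)) \<longlonglongrightarrow> ?B / 2 * (t - s)" by simp
    have "\<forall>\<^sub>F n in sequentially. \<tau> n < t - s" using s by (intro order_tendstoD(2)[OF \<tau>_lim]) auto
    then obtain N where N: "\<And>n. n \<ge> N \<Longrightarrow> \<tau> n < t - s" by (auto simp: eventually_sequentially)
    have "g (c t) (D (\<tau> n) t) w - g (c s) (D (\<tau> n) s) w \<le> ?B / 2 * (t - s - \<tau> n) + K5 * sqrt (\<tau> n)"
      if "n \<ge> N" for n
      using N[OF that] subinterval[OF s(2) \<tau>_pos \<tau>_le, of n] s \<tau>_pos[of n] w \<tau>_le[of n] \<eta>_le
      by (intro momentum_growth B) auto
    then show "\<exists>N. \<forall>n\<ge>N. g (c t) (D (\<tau> n) t) w - g (c s) (D (\<tau> n) s) w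
        \<le> ?B / 2 * (t - s - \<tau> n) + K5 * sqrt (\<tau> n)" by blast
  qed
  moreover have "K9 / 2 * ((t - s) * sqrt (t - s)) \<le> K9 * ((t - s) * sqrt (t - s))"
    using K9_nonneg s by (intro mult_right_mono) auto
  moreover have "?B / 2 * (t - s) = (t - s) / 2 * dg (c s) w (v s) (v s) + K9 / 2 * ((t - s) * sqrt (t - s))"
    by (simp add: field_simps)
  ultimately show ?thesis by linarith
qed

text \<open>Every term inside the absolute value is odd in w, so the upper bound for - w is the
  lower bound for w.\<close>

lemma momentum_abs:
  assumes s: "s \<in> {a..e}" "t \<in> {a..e}" "s < t" "t - s \<le> \<eta>" and w: "norm w \<le> 1"
  shows "\<bar>g (c t) (v t) w - g (c s) (v s) w - (t - s) / 2 * dg (c s) w (v s) (v s)\<bar>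
    \<le> K9 * ((t - s) * sqrt (t - s))"
proof -
  have cs: "c s \<in> S" "c t \<in> S" using s e by (auto intro!: c_in)
  have "dg (c s) (- w) (v s) (v s) = - dg (c s) w (v s) (v s)"
    by (rule linear_neg[OF dg_linear[OF cs(1)]])
  then have "- (g (c t) (v t) w - g (c s) (v s) w - (t - s) / 2 * dg (c s) w (v s) (v s))
      \<le> K9 * ((t - s) * sqrt (t - s))"
    using momentum_upper[OF s, of "- w"] w bilinear_rneg[OF bilin[OF cs(1)]] bilinear_rneg[OF bilin[OF cs(2)]]
    by simp
  then show ?thesis using momentum_upper[OF s w] by (simp add: abs_le_iff)
qed

definition "K10 = K9 + C * M ^ 3 + 2 * C * M * K6"

text \<open>For y < x the previous estimate has the derivative of the metric at y; moving it to x
  costs a multiple of h^2, which is at most h sqrt h because h \<le> 1.\<close>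

lemma momentum:
  assumes s: "x \<in> {a..e}" "y \<in> {a..e}" "\<bar>y - x\<bar> \<le> \<eta>" and w: "norm w \<le> 1"
  shows "\<bar>g (c y) (v y) w - g (c x) (v x) w - (y - x) / 2 * dg (c x) w (v x) (v x)\<bar>
    \<le> K10 * (\<bar>y - x\<bar> * sqrt \<bar>y - x\<bar>)"
proof -
  let ?h = "\<bar>y - x\<bar>"
  have K: "K9 \<le> K10" using C_pos M_pos K6_nonneg by (simp add: K10_def)
  consider "x = y" | "x < y" | "y < x" by linarith
  then show ?thesis
  proof cases
    case 1 then show ?thesis by simp
  next
    case 2
    then have "\<bar>g (c y) (v y) w - g (c x) (v x) w - (y - x) / 2 * dg (c x) w (v x) (v x)\<bar>
      \<le> K9 * ((y - x) * sqrt (y - x))" using s w by (intro momentum_abs) auto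
    also have "\<dots> \<le> K10 * ((y - x) * sqrt (y - x))" using K 2 by (intro mult_right_mono) auto
    finally show ?thesis using 2 by simp
  next
    case 3
    have cs: "c x \<in> S" "c y \<in> S" using s e by (auto intro!: c_in)
    have "\<bar>g (c x) (v x) w - g (c y) (v y) w - (x - y) / 2 * dg (c y) w (v y) (v y)\<bar>
      \<le> K9 * ((x - y) * sqrt (x - y))" using s w 3 by (intro momentum_abs) auto
    then have 1: "\<bar>g (c x) (v x) w - g (c y) (v y) w - ?h / 2 * dg (c y) w (v y) (v y)\<bar>
      \<le> K9 * (?h * sqrt ?h)" using 3 by simp
    have hs: "?h \<le> sqrt ?h" using s \<eta>_le by (intro le_sqrt_self) auto
    have "\<bar>dg (c y) w (v y) (v y) - dg (c x) w (v x) (v x)\<bar>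
      \<le> C * M\<^sup>2 * norm (c y - c x) + 2 * C * M * norm (v y - v x)"
      using s by (intro dg_estimate cs w norm_v)
    also have "\<dots> \<le> C * M\<^sup>2 * (M * ?h) + 2 * C * M * (K6 * ?h)"
      using lipschitz'[of x y] v_lipschitz[of x y] s e C_pos M_pos by (intro add_mono mult_left_mono) auto
    also have "\<dots> = (C * M ^ 3 + 2 * C * M * K6) * ?h"
      by (simp add: power2_eq_square power3_eq_cube algebra_simps)
    also have "\<dots> \<le> (C * M ^ 3 + 2 * C * M * K6) * sqrt ?h"
      using hs C_pos M_pos K6_nonneg by (intro mult_left_mono) auto
    finally have "?h / 2 * \<bar>dg (c y) w (v y) (v y) - dg (c x) w (v x) (v x)\<bar>
       \<le> ?h * ((C * M ^ 3 + 2 * C * M * K6) * sqrt ?h)"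
      by (intro mult_mono) auto
    also have "?h / 2 * \<bar>dg (c y) w (v y) (v y) - dg (c x) w (v x) (v x)\<bar>
        = \<bar>?h / 2 * (dg (c y) w (v y) (v y) - dg (c x) w (v x) (v x))\<bar>"
      by (simp only: abs_mult) simp
    finally have 2: "\<bar>?h / 2 * dg (c y) w (v y) (v y) - ?h / 2 * dg (c x) w (v x) (v x)\<bar>
       \<le> (C * M ^ 3 + 2 * C * M * K6) * (?h * sqrt ?h)"
      by (simp add: right_diff_distrib mult_ac)
    have "(y - x) / 2 * dg (c x) w (v x) (v x) = - (?h / 2 * dg (c x) w (v x) (v x))"
      using 3 by (simp add: field_simps)
    moreover have "K10 * (?h * sqrt ?h) = K9 * (?h * sqrt ?h) + (C * M ^ 3 + 2 * C * M * K6) * (?h * sqrt ?h)"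
      by (simp add: K10_def algebra_simps)
    ultimately show ?thesis using 1 2 by linarith
  qed
qed

text \<open>The product rule solved for v': the derivative of g (c) (v, w) is half of dg w (v, v),
  and the part due to the motion of c is dg v (v, w). As v is not yet known to be differentiable,
  the rule is carried out on increments. The vector z is the Christoffel term of v with
  itself.\<close>

lemma v_has_vector_derivative:
  assumes x: "x \<in> {a..e}"
    and z: "\<And>w. g (c x) z w = dg (c x) (v x) (v x) w - dg (c x) w (v x) (v x) / 2"
  shows "(v has_vector_derivative - z) (at x within {a..e})"
proof -
  define K where "K = K10 + C * K8 * M + C * M * K6 + C * M\<^sup>2 * M"
  have "norm (v y - v x - (y - x) *\<^sub>R (- z)) \<le> K / k\<^sup>2 * (\<bar>y - x\<bar> * sqrt \<bar>y - x\<bar>)"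
    if y: "y \<in> {a..e}" "\<bar>y - x\<bar> \<le> \<eta>" for y
  proof -
    let ?h = "\<bar>y - x\<bar>" and ?Y = "v y - v x - (y - x) *\<^sub>R (- z)"
    let ?q = "?h * sqrt ?h"
    have cs: "c x \<in> S" "c y \<in> S" using x y e by (auto intro!: c_in)
    have hs: "?h \<le> sqrt ?h" using y \<eta>_le by (intro le_sqrt_self) auto
    then have hq: "?h\<^sup>2 \<le> ?q" using mult_left_mono[OF hs, of ?h] by (simp add: power2_eq_square)
    have M0: "0 \<le> M" "0 \<le> C" using M_pos C_pos by auto
    have "g (c x) ?Y w \<le> K * ?q" if w: "norm w \<le> 1" for w
    proof -
      let ?d = "c y - c x"
      let ?r = "?d - (y - x) *\<^sub>R v x"
      note bl = bilin[OF cs(1)] and dbl = dg_bilin[OF cs(1)]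
      have "\<bar>g (c y) (v y) w - g (c x) (v y) w - dg (c x) ?d (v y) w\<bar> \<le> C * (norm ?d)\<^sup>2 * norm (v y) * norm w"
        by (rule taylor[OF cs])
      also have "\<dots> \<le> C * (M * ?h)\<^sup>2 * M * 1"
        using lipschitz'[of x y] x y e norm_v w M0 by (intro mult_mono power_mono) auto
      also have "\<dots> = C * M\<^sup>2 * M * ?h\<^sup>2" by (simp add: power2_eq_square)
      also have "\<dots> \<le> C * M\<^sup>2 * M * ?q" using hq M0 by (intro mult_left_mono) auto
      finally have 1: "\<bar>g (c y) (v y) w - g (c x) (v y) w - dg (c x) ?d (v y) w\<bar> \<le> C * M\<^sup>2 * M * ?q" .
      have "\<bar>dg (c x) ?r (v y) w\<bar> \<le> C * norm ?r * norm (v y) * norm w" by (rule dg_bound[OF cs(1)])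
      also have "\<dots> \<le> C * (K8 * ?q) * M * 1"
        using c_expand[OF x y] norm_v[OF y(1)] w M0 K8_nonneg by (intro mult_mono) auto
      finally have 2: "\<bar>dg (c x) ?r (v y) w\<bar> \<le> C * K8 * M * ?q" by (simp add: mult_ac)
      have "\<bar>dg (c x) (v x) (v y - v x) w\<bar> \<le> C * norm (v x) * norm (v y - v x) * norm w" by (rule dg_bound[OF cs(1)])
      also have "\<dots> \<le> C * M * (K6 * ?h) * 1"
        using v_lipschitz[OF x y(1)] norm_v[OF x] w M0 K6_nonneg by (intro mult_mono) auto
      finally have "?h * \<bar>dg (c x) (v x) (v y - v x) w\<bar> \<le> ?h * (C * M * (K6 * ?h))"
        by (intro mult_left_mono) auto
      also have "\<dots> = C * M * K6 * ?h\<^sup>2" by (simp add: power2_eq_square mult_ac)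
      also have "\<dots> \<le> C * M * K6 * ?q" using hq M0 K6_nonneg by (intro mult_left_mono) auto
      finally have 3: "\<bar>(y - x) * dg (c x) (v x) (v y - v x) w\<bar> \<le> C * M * K6 * ?q" by (simp add: abs_mult)
      have lin: "dg (c x) ?d (v y) w = (y - x) * dg (c x) (v x) (v y) w + dg (c x) ?r (v y) w"
        using linear_diff[OF dg_linear[OF cs(1), of "v y" w]] linear_scale[OF dg_linear[OF cs(1), of "v y" w]]
        by simp
      have lin2: "dg (c x) (v x) (v y) w = dg (c x) (v x) (v x) w + dg (c x) (v x) (v y - v x) w"
        using bilinear_lsub[OF dbl] by simp
      have "g (c x) ?Y w = g (c x) (v y) w - g (c x) (v x) w + (y - x) * g (c x) z w"
        using bilinear_lsub[OF bl] bilinear_ladd[OF bl] bilinear_lmul[OF bl] by simp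
      \<comment> \<open>Four remainders of order 3/2: the momentum equation, the Taylor expansion of
        g, the expansion of c, and the variation of v inside dg.\<close>
      also have "\<dots> = (g (c y) (v y) w - g (c x) (v x) w - (y - x) / 2 * dg (c x) w (v x) (v x))
         - (g (c y) (v y) w - g (c x) (v y) w - dg (c x) ?d (v y) w)
         - dg (c x) ?r (v y) w - (y - x) * dg (c x) (v x) (v y - v x) w"
        unfolding z lin lin2 by (simp add: algebra_simps)
      also have "\<dots> \<le> K10 * ?q + C * M\<^sup>2 * M * ?q + C * K8 * M * ?q + C * M * K6 * ?q"
        using 1 2 3 momentum[OF x y w] by linarith
      also have "\<dots> \<le> K * ?q" unfolding K_def using M0 by (simp add: algebra_simps mult_left_mono[OF _ M0(1)])
      finally show ?thesis .
    qed
    from norm_le_of_unit_bound[OF cs(1) this] show ?thesis by simp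
  qed
  then show ?thesis
    by (intro has_vector_derivative_of_power_bound[OF \<eta>_pos, where K = "K / k\<^sup>2"])
qed

end

section \<open>Piecewise smooth curves and their lengths\<close>

text \<open>The integrand of \<open>curve_length\<close> with the derivative taken relative to an
  arbitrary interval, so that pieces of a curve can be measured with their own one-sided
  derivatives.\<close>

definition speed_within ::
    "('m, 'e::euclidean_space) chart set \<Rightarrow> ('m, 'e) metric \<Rightarrow> real set \<Rightarrow> (real \<Rightarrow> 'm) \<Rightarrow> real \<Rightarrow> real" where
  "speed_within A G I c t =
     (let \<phi> = (SOME \<phi>. \<phi> \<in> A \<and> c t \<in> cdom \<phi>); v = vector_derivative (cmap \<phi> \<circ> c) (at t within I)
      in sqrt (G \<phi> (cmap \<phi> (c t)) v v))"

text \<open>The last argument is the length of the curve on the interval.\<close>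

inductive pw_curve ::
    "('m::topological_space, 'e::euclidean_space) chart set \<Rightarrow> ('m, 'e) metric \<Rightarrow> (real \<Rightarrow> 'm) \<Rightarrow>
     real \<Rightarrow> real \<Rightarrow> real \<Rightarrow> bool" for A G c where
  base: "a < b \<Longrightarrow> continuous_on {a..b} c \<Longrightarrow> C1_curve A {a..b} c \<Longrightarrow>
    (speed_within A G {a..b} c has_integral l) {a..b} \<Longrightarrow> pw_curve A G c a b l"
| join: "pw_curve A G c a b l \<Longrightarrow> pw_curve A G c b e l' \<Longrightarrow> pw_curve A G c a e (l + l')"

lemma pw_curve_less: "pw_curve A G c a b l \<Longrightarrow> a < b"
  by (induction rule: pw_curve.induct) auto

lemma pw_curve_continuous: "pw_curve A G c a b l \<Longrightarrow> continuous_on {a..b} c"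
proof (induction rule: pw_curve.induct)
  case (join a b l e l')
  have "a < b" "b < e" using pw_curve_less[OF join(1)] pw_curve_less[OF join(2)] by auto
  then have "{a..e} = {a..b} \<union> {b..e}" by auto
  then show ?case using join by (auto intro!: continuous_on_closed_Un)
qed auto

locale riemannian =
  fixes A :: "('m::{t2_space, second_countable_topology}, 'e::euclidean_space) chart set"
    and G :: "('m, 'e) metric"
  assumes atlas: "smooth_atlas A" and metric: "riemannian_metric A G"
begin

lemma chart:
  assumes "\<phi> \<in> A"
  shows "open (cdom \<phi>)" "open (cmap \<phi> ` cdom \<phi>)" "continuous_on (cdom \<phi>) (cmap \<phi>)"
    "continuous_on (cmap \<phi> ` cdom \<phi>) (cinv \<phi>)"
    "\<And>p. p \<in> cdom \<phi> \<Longrightarrow> cinv \<phi> (cmap \<phi> p) = p"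
    "\<And>x. x \<in> cmap \<phi> ` cdom \<phi> \<Longrightarrow> cmap \<phi> (cinv \<phi> x) = x"
    "\<And>x. x \<in> cmap \<phi> ` cdom \<phi> \<Longrightarrow> cinv \<phi> x \<in> cdom \<phi>"
proof -
  have "is_chart \<phi>" using atlas assms by (auto simp: smooth_atlas_def)
  then have "open (cdom \<phi>)" "open (cmap \<phi> ` cdom \<phi>)"
    and h: "homeomorphism (cdom \<phi>) (cmap \<phi> ` cdom \<phi>) (cmap \<phi>) (cinv \<phi>)" by (auto simp: is_chart_def)
  then show "open (cdom \<phi>)" "open (cmap \<phi> ` cdom \<phi>)" by auto
  show "continuous_on (cdom \<phi>) (cmap \<phi>)" "continuous_on (cmap \<phi> ` cdom \<phi>) (cinv \<phi>)"
    "\<And>p. p \<in> cdom \<phi> \<Longrightarrow> cinv \<phi> (cmap \<phi> p) = p"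
    "\<And>x. x \<in> cmap \<phi> ` cdom \<phi> \<Longrightarrow> cmap \<phi> (cinv \<phi> x) = x"
    "\<And>x. x \<in> cmap \<phi> ` cdom \<phi> \<Longrightarrow> cinv \<phi> x \<in> cdom \<phi>"
    using h by (auto simp: homeomorphism_def)
qed

lemma chart_at: obtains \<phi> where "\<phi> \<in> A" "p \<in> cdom \<phi>"
proof -
  have "p \<in> (\<Union>\<phi>\<in>A. cdom \<phi>)" using atlas by (simp add: smooth_atlas_def)
  then show ?thesis using that by blast
qed

lemma some_chart:
  "(SOME \<phi>. \<phi> \<in> A \<and> p \<in> cdom \<phi>) \<in> A" "p \<in> cdom (SOME \<phi>. \<phi> \<in> A \<and> p \<in> cdom \<phi>)"
proof -
  obtain \<phi> where "\<phi> \<in> A \<and> p \<in> cdom \<phi>" using chart_at by blast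
  then have "(SOME \<phi>. \<phi> \<in> A \<and> p \<in> cdom \<phi>) \<in> A \<and> p \<in> cdom (SOME \<phi>. \<phi> \<in> A \<and> p \<in> cdom \<phi>)"
    by (rule someI)
  then show "(SOME \<phi>. \<phi> \<in> A \<and> p \<in> cdom \<phi>) \<in> A" "p \<in> cdom (SOME \<phi>. \<phi> \<in> A \<and> p \<in> cdom \<phi>)" by auto
qed

lemma open_chart_preimage:
  assumes "\<phi> \<in> A" "open W"
  shows "open (cdom \<phi> \<inter> cmap \<phi> -` W)"
  using continuous_open_preimage[OF chart(3,1)[OF assms(1)] assms(2)] .

lemma open_chart_image:
  assumes "\<phi> \<in> A" "open V" "V \<subseteq> cdom \<phi>"
  shows "open (cmap \<phi> ` V)"
proof -
  have "cmap \<phi> ` V = (cmap \<phi> ` cdom \<phi>) \<inter> cinv \<phi> -` V"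
    using chart(5)[OF assms(1)] assms(3) by force
  then show ?thesis using continuous_open_preimage[OF chart(4,2)[OF assms(1)] assms(2)] by simp
qed

lemma transition_smooth:
  assumes "\<phi> \<in> A" "\<psi> \<in> A"
  shows "smooth_on (cmap \<phi> ` (cdom \<phi> \<inter> cdom \<psi>)) (transition \<phi> \<psi>)"
  using atlas assms by (auto simp: smooth_atlas_def)

lemma transition_derivative:
  assumes "\<phi> \<in> A" "\<psi> \<in> A" "p \<in> cdom \<phi>" "p \<in> cdom \<psi>"
  shows "(transition \<phi> \<psi> has_derivative frechet_derivative (transition \<phi> \<psi>) (at (cmap \<phi> p))) (at (cmap \<phi> p))"
  using assms by (intro smooth_on_has_derivative[OF transition_smooth[OF assms(1,2)]]) auto

lemma metric_bilinear: "\<phi> \<in> A \<Longrightarrow> x \<in> cmap \<phi> ` cdom \<phi> \<Longrightarrow> bilinear (G \<phi> x)"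
  and metric_sym: "\<phi> \<in> A \<Longrightarrow> x \<in> cmap \<phi> ` cdom \<phi> \<Longrightarrow> G \<phi> x u v = G \<phi> x v u"
  and metric_pos: "\<phi> \<in> A \<Longrightarrow> x \<in> cmap \<phi> ` cdom \<phi> \<Longrightarrow> u \<noteq> 0 \<Longrightarrow> 0 < G \<phi> x u u"
  and metric_smooth: "\<phi> \<in> A \<Longrightarrow> smooth_on (cmap \<phi> ` cdom \<phi>) (\<lambda>x. G \<phi> x u v)"
  and metric_transition: "\<phi> \<in> A \<Longrightarrow> \<psi> \<in> A \<Longrightarrow> p \<in> cdom \<phi> \<Longrightarrow> p \<in> cdom \<psi> \<Longrightarrow>
    G \<phi> (cmap \<phi> p) u v = G \<psi> (cmap \<psi> p) (frechet_derivative (transition \<phi> \<psi>) (at (cmap \<phi> p)) u)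
      (frechet_derivative (transition \<phi> \<psi>) (at (cmap \<phi> p)) v)"
  using metric unfolding riemannian_metric_def Let_def by blast+

lemma metric_nonneg: "\<phi> \<in> A \<Longrightarrow> x \<in> cmap \<phi> ` cdom \<phi> \<Longrightarrow> 0 \<le> G \<phi> x u u"
  using metric_pos[of \<phi> x u] bilinear_lzero[OF metric_bilinear, of \<phi> x] by (cases "u = 0") (auto intro: less_imp_le)

text \<open>The factorization through the transition map holds only while c stays in the domain of
  \<phi>; by continuity this is so near t, which suffices for derivatives.\<close>

lemma change_chart:
  assumes \<phi>: "\<phi> \<in> A" "\<psi> \<in> A" "c t \<in> cdom \<phi>" "c t \<in> cdom \<psi>"
    and c: "continuous (at t within I) c" "t \<in> I"
    and v: "(cmap \<phi> \<circ> c has_vector_derivative v) (at t within I)"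
  shows "(cmap \<psi> \<circ> c has_vector_derivative
      frechet_derivative (transition \<phi> \<psi>) (at (cmap \<phi> (c t))) v) (at t within I)"
proof -
  let ?D = "frechet_derivative (transition \<phi> \<psi>) (at (cmap \<phi> (c t)))"
  have "(transition \<phi> \<psi> has_derivative ?D) (at ((cmap \<phi> \<circ> c) t) within (cmap \<phi> \<circ> c) ` I)"
    using transition_derivative[OF \<phi>] by (simp add: has_derivative_at_withinI)
  from vector_derivative_diff_chain_within[OF v this]
  have "(transition \<phi> \<psi> \<circ> (cmap \<phi> \<circ> c) has_derivative (\<lambda>h. h *\<^sub>R ?D v)) (at t within I)"
    unfolding has_vector_derivative_def .
  moreover have "\<forall>\<^sub>F s in at t within I. c s \<in> cdom \<phi>"
    using c(1) chart(1)[OF \<phi>(1)] \<phi>(3) unfolding continuous_within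
    by (rule topological_tendstoD)
  then have "\<forall>\<^sub>F s in at t within I. (transition \<phi> \<psi> \<circ> (cmap \<phi> \<circ> c)) s = (cmap \<psi> \<circ> c) s"
    by eventually_elim (simp add: transition_def chart(5)[OF \<phi>(1)])
  ultimately have "(cmap \<psi> \<circ> c has_derivative (\<lambda>h. h *\<^sub>R ?D v)) (at t within I)"
    by (rule has_derivative_transform_eventually)
      (use \<phi> c(2) in \<open>simp_all add: transition_def chart(5)[OF \<phi>(1)]\<close>)
  then show ?thesis by (simp add: has_vector_derivative_def)
qed

text \<open>The chart picked by \<open>SOME\<close> varies with the point in an uncontrolled way;
  the transformation law of G allows any fixed chart in its place.\<close>

lemma speed_within_chart:
  assumes \<phi>: "\<phi> \<in> A" "c t \<in> cdom \<phi>"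
    and c: "continuous (at t within I) c" "t \<in> I" "at t within I \<noteq> bot"
    and v: "(cmap \<phi> \<circ> c has_vector_derivative v) (at t within I)"
  shows "speed_within A G I c t = sqrt (G \<phi> (cmap \<phi> (c t)) v v)"
proof -
  define \<psi> where "\<psi> = (SOME \<psi>. \<psi> \<in> A \<and> c t \<in> cdom \<psi>)"
  have \<psi>: "\<psi> \<in> A" "c t \<in> cdom \<psi>" unfolding \<psi>_def by (rule some_chart)+
  let ?D = "frechet_derivative (transition \<phi> \<psi>) (at (cmap \<phi> (c t)))"
  have "vector_derivative (cmap \<psi> \<circ> c) (at t within I) = ?D v"
    using change_chart[OF \<phi>(1) \<psi>(1) \<phi>(2) \<psi>(2) c(1,2) v] c(3) by (rule vector_derivative_within[rotated])
  then show ?thesis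
    using metric_transition[OF \<phi>(1) \<psi>(1) \<phi>(2) \<psi>(2), of v v]
    by (simp add: speed_within_def \<psi>_def Let_def)
qed

lemma speed_within_nonneg: "0 \<le> speed_within A G I c t"
  by (simp add: speed_within_def Let_def metric_nonneg some_chart)

lemma C1_speed_continuous:
  assumes ab: "a < b" and c: "continuous_on {a..b} c" and C1: "C1_curve A {a..b} c"
  shows "continuous_on {a..b} (speed_within A G {a..b} c)"
  unfolding continuous_on_eq_continuous_within
proof
  fix t assume t: "t \<in> {a..b}"
  obtain \<phi> where \<phi>: "\<phi> \<in> A" "c t \<in> cdom \<phi>" using chart_at by blast
  let ?T = "{t \<in> {a..b}. c t \<in> cdom \<phi>}"
  obtain v where v: "continuous_on ?T v"
    "\<And>t. t \<in> ?T \<Longrightarrow> (cmap \<phi> \<circ> c has_vector_derivative v t) (at t within {a..b})"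
    using C1 \<phi>(1) unfolding C1_curve_def Let_def by blast
  have "continuous_on ?T (\<lambda>t. sqrt (G \<phi> (cmap \<phi> (c t)) (v t) (v t)))"
  proof (rule continuous_on_real_sqrt, rule continuous_on_quadratic_form[where g = "G \<phi>"])
    show "continuous_on ?T v" by (rule v(1))
    show "bilinear (G \<phi> x)" if "x \<in> cmap \<phi> ` cdom \<phi>" for x by (rule metric_bilinear[OF \<phi>(1) that])
    show "continuous_on (cmap \<phi> ` cdom \<phi>) (\<lambda>x. G \<phi> x i j)" for i j
      by (rule smooth_on_continuous_on[OF metric_smooth[OF \<phi>(1)]])
    show "continuous_on ?T (\<lambda>t. cmap \<phi> (c t))"
      by (rule continuous_on_compose2[OF chart(3)[OF \<phi>(1)] continuous_on_subset[OF c]]) auto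
  qed auto
  moreover have "speed_within A G {a..b} c t = sqrt (G \<phi> (cmap \<phi> (c t)) (v t) (v t))" if "t \<in> ?T" for t
    using that ab c \<phi>(1) v(2) Icc_nontrivial
    by (intro speed_within_chart) (auto simp: continuous_on_eq_continuous_within)
  ultimately have "continuous_on ?T (speed_within A G {a..b} c)" by (subst continuous_on_cong[OF refl]) auto
  then have "continuous (at t within ?T) (speed_within A G {a..b} c)"
    using t \<phi> by (simp add: continuous_on_eq_continuous_within)
  \<comment> \<open>The set \<open>?T\<close> is a relative neighbourhood of t, being the preimage
    of an open set under the continuous c.\<close>
  moreover have "at t within ?T = at t within {a..b}"
  proof -
    obtain U where U: "open U" "U \<inter> {a..b} = c -` cdom \<phi> \<inter> {a..b}"
      using c chart(1)[OF \<phi>(1)] unfolding continuous_on_open_invariant by blast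
    then have "?T \<inter> U = {a..b} \<inter> U" by blast
    moreover have "t \<in> U" using U(2) t \<phi> by blast
    ultimately show ?thesis using U(1) by (intro at_within_nhd[of t U]) auto
  qed
  ultimately show "continuous (at t within {a..b}) (speed_within A G {a..b} c)" by simp
qed

lemma C1_pw_curve:
  assumes "a < b" "continuous_on {a..b} c" "C1_curve A {a..b} c"
  shows "pw_curve A G c a b (integral {a..b} (speed_within A G {a..b} c))"
  using assms C1_speed_continuous[OF assms]
  by (intro pw_curve.base) (auto intro: integrable_continuous_real integrable_integral)

lemma pw_curve_nonneg: "pw_curve A G c a b l \<Longrightarrow> 0 \<le> l"
proof (induction rule: pw_curve.induct)
  case (base a b l)
  then show ?case using has_integral_nonneg[OF base(4)] speed_within_nonneg by blast
qed auto

text \<open>Away from the break points, the speed does not depend on the interval.\<close>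

lemma pw_curve_has_integral:
  assumes "pw_curve A G c a b l" "u \<le> a" "b \<le> w"
  shows "(speed_within A G {u..w} c has_integral l) {a..b}"
  using assms
proof (induction rule: pw_curve.induct)
  case (base a b l)
  have "speed_within A G {u..w} c t = speed_within A G {a..b} c t" if "t \<in> {a..b} - {a, b}" for t
  proof -
    have "at t within {u..w} = at t within {a..b}"
      using that base.prems by (subst (1 2) at_within_Icc_at) auto
    then show ?thesis by (simp add: speed_within_def)
  qed
  then show ?case using base by (intro has_integral_spike_finite[OF _ _ base(4), of "{a, b}"]) auto
next
  case (join a b l e l')
  then have "a < b" "b < e" using pw_curve_less by auto
  then show ?case using join by (intro has_integral_combine[of a b e]) auto
qed

lemma pw_curve_length_eq:
  assumes "pw_curve A G c 0 1 l" shows "curve_length A G c = l"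
proof -
  have "speed A G c t = speed_within A G {0..1} c t" for t
    by (simp add: speed_def speed_within_def velocity_def some_chart)
  then have "speed A G c = speed_within A G {0..1} c" by auto
  then show ?thesis
    using pw_curve_has_integral[OF assms, of 0 1] by (simp add: curve_length_def integral_unique)
qed

lemma C1_curve_subset:
  assumes "C1_curve A I c" "J \<subseteq> I"
  shows "C1_curve A J c"
  unfolding C1_curve_def Let_def
proof
  fix \<phi> assume "\<phi> \<in> A"
  then obtain v where "continuous_on {t \<in> I. c t \<in> cdom \<phi>} v"
    "\<forall>t\<in>{t \<in> I. c t \<in> cdom \<phi>}. (cmap \<phi> \<circ> c has_vector_derivative v t) (at t within I)"
    using assms(1) unfolding C1_curve_def Let_def by blast
  then show "\<exists>v. continuous_on {t \<in> J. c t \<in> cdom \<phi>} v \<and>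
      (\<forall>t\<in>{t \<in> J. c t \<in> cdom \<phi>}. (cmap \<phi> \<circ> c has_vector_derivative v t) (at t within J))"
    using assms(2)
    by (intro exI[of _ v] conjI)
      (auto elim: continuous_on_subset intro: has_vector_derivative_within_subset)
qed

lemma pw_curve_split:
  assumes "pw_curve A G c a b l" "a < u" "u < b"
  obtains l1 l2 where "pw_curve A G c a u l1" "pw_curve A G c u b l2" "l = l1 + l2"
proof -
  have "\<exists>l1 l2. pw_curve A G c a u l1 \<and> pw_curve A G c u b l2 \<and> l = l1 + l2"
    using assms
  proof (induction rule: pw_curve.induct)
    case (base a b l)
    have "pw_curve A G c a u (integral {a..u} (speed_within A G {a..u} c))"
      using base by (intro C1_pw_curve) (auto elim: continuous_on_subset C1_curve_subset)
    moreover have "pw_curve A G c u b (integral {u..b} (speed_within A G {u..b} c))"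
      using base by (intro C1_pw_curve) (auto elim: continuous_on_subset C1_curve_subset)
    ultimately have p: "pw_curve A G c a u (integral {a..u} (speed_within A G {a..u} c))"
       "pw_curve A G c u b (integral {u..b} (speed_within A G {u..b} c))" by auto
    have "(speed_within A G {a..b} c has_integral (integral {a..u} (speed_within A G {a..u} c) + integral {u..b} (speed_within A G {u..b} c))) {a..b}"
      using pw_curve_has_integral[OF p(1), of a b] pw_curve_has_integral[OF p(2), of a b] base.prems
      by (intro has_integral_combine[of a u b]) auto
    then have "l = integral {a..u} (speed_within A G {a..u} c) + integral {u..b} (speed_within A G {u..b} c)"
      using base(4) has_integral_unique by blast
    then show ?case using p by blast
  next
    case (join a m l e l')
    consider "u < m" | "u = m" | "m < u" by linarith
    then show ?case
    proof cases
      case 1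
      then obtain l1 l2 where "pw_curve A G c a u l1" "pw_curve A G c u m l2" "l = l1 + l2" using join by blast
      then show ?thesis using join(2) by (metis pw_curve.join add.assoc)
    next
      case 2 then show ?thesis using join by blast
    next
      case 3
      then obtain l1 l2 where "pw_curve A G c m u l1" "pw_curve A G c u e l2" "l' = l1 + l2" using join by blast
      then show ?thesis using join(1) by (metis pw_curve.join add.assoc)
    qed
  qed
  then show ?thesis using that by blast
qed

text \<open>Treats rescaling and reversal together, as m may be negative: the speed is multiplied by
  the absolute value of m, which cancels the factor from the substitution. The assumption
  \<open>im\<close> has the shape in which \<open>has_integral_affinity\<close> returns its
  domain.\<close>

lemma pw_curve_affine_base:
  assumes ab: "a < b" "a' < b'" and c: "continuous_on {a..b} c" and C1: "C1_curve A {a..b} c"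
    and l: "(speed_within A G {a..b} c has_integral l) {a..b}"
    and m: "m \<noteq> 0" and im: "(\<lambda>x. (1 / m) *\<^sub>R x + - ((1 / m) *\<^sub>R q)) ` {a..b} = {a'..b'}"
  shows "pw_curve A G (\<lambda>t. c (m * t + q)) a' b' l"
proof -
  define \<alpha> where "\<alpha> t = m * t + q" for t
  have \<alpha>: "\<alpha> t \<in> {a..b}" if "t \<in> {a'..b'}" for t
  proof -
    have "t \<in> (\<lambda>x. (1 / m) *\<^sub>R x + - ((1 / m) *\<^sub>R q)) ` {a..b}" unfolding im by (rule that)
    then obtain x where x: "x \<in> {a..b}" "t = (1 / m) *\<^sub>R x + - ((1 / m) *\<^sub>R q)" by (rule imageE)
    have "\<alpha> t = x" unfolding \<alpha>_def x(2) using m by (simp add: field_simps)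
    then show ?thesis using x(1) by simp
  qed
  have \<alpha>d: "(\<alpha> has_vector_derivative m) (at t within J)" for t J
    unfolding \<alpha>_def by (auto intro!: derivative_eq_intros simp: has_real_derivative_iff_has_vector_derivative[symmetric])
  have \<alpha>c: "continuous_on J \<alpha>" for J unfolding \<alpha>_def by (intro continuous_intros)
  have cc: "continuous_on {a'..b'} (c \<circ> \<alpha>)"
    using c \<alpha> by (intro continuous_on_compose \<alpha>c) (auto elim: continuous_on_subset)
  have der: "(cmap \<phi> \<circ> (c \<circ> \<alpha>) has_vector_derivative m *\<^sub>R v) (at t within {a'..b'})"
    if "(cmap \<phi> \<circ> c has_vector_derivative v) (at (\<alpha> t) within {a..b})" "t \<in> {a'..b'}" for \<phi> v t
  proof -
    have "(cmap \<phi> \<circ> c has_vector_derivative v) (at (\<alpha> t) within \<alpha> ` {a'..b'})"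
      using that(1) by (rule has_vector_derivative_within_subset) (use \<alpha> in auto)
    from vector_diff_chain_within[OF \<alpha>d this] show ?thesis by (simp only: comp_assoc)
  qed
  have C1': "C1_curve A {a'..b'} (c \<circ> \<alpha>)"
    unfolding C1_curve_def Let_def
  proof
    fix \<phi> assume "\<phi> \<in> A"
    then obtain v where v: "continuous_on {t \<in> {a..b}. c t \<in> cdom \<phi>} v"
      "\<And>t. t \<in> {t \<in> {a..b}. c t \<in> cdom \<phi>} \<Longrightarrow> (cmap \<phi> \<circ> c has_vector_derivative v t) (at t within {a..b})"
      using C1 unfolding C1_curve_def Let_def by blast
    have "continuous_on {t \<in> {a'..b'}. (c \<circ> \<alpha>) t \<in> cdom \<phi>} (\<lambda>t. m *\<^sub>R v (\<alpha> t))"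
      using \<alpha> by (intro continuous_intros continuous_on_compose2[OF v(1) \<alpha>c]) auto
    then show "\<exists>v. continuous_on {t \<in> {a'..b'}. (c \<circ> \<alpha>) t \<in> cdom \<phi>} v \<and>
      (\<forall>t\<in>{t \<in> {a'..b'}. (c \<circ> \<alpha>) t \<in> cdom \<phi>}. (cmap \<phi> \<circ> (c \<circ> \<alpha>) has_vector_derivative v t) (at t within {a'..b'}))"
      using \<alpha> by (intro exI[of _ "\<lambda>t. m *\<^sub>R v (\<alpha> t)"] conjI ballI der v(2)) auto
  qed
  have sp: "\<bar>m\<bar> * speed_within A G {a..b} c (\<alpha> t) = speed_within A G {a'..b'} (c \<circ> \<alpha>) t" if t: "t \<in> {a'..b'}" for t
  proof -
    obtain \<phi> where \<phi>: "\<phi> \<in> A" "c (\<alpha> t) \<in> cdom \<phi>" using chart_at by blast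
    then obtain v where v: "(cmap \<phi> \<circ> c has_vector_derivative v) (at (\<alpha> t) within {a..b})"
      using C1 \<alpha>[OF t] unfolding C1_curve_def Let_def by blast
    have ccw: "continuous (at t within {a'..b'}) (c \<circ> \<alpha>)"
      using cc t unfolding continuous_on_eq_continuous_within by blast
    have "speed_within A G {a..b} c (\<alpha> t) = sqrt (G \<phi> (cmap \<phi> (c (\<alpha> t))) v v)"
      using \<alpha>[OF t] \<phi> v c Icc_nontrivial[OF ab(1)]
      by (intro speed_within_chart) (auto simp: continuous_on_eq_continuous_within)
    moreover have "speed_within A G {a'..b'} (c \<circ> \<alpha>) t = sqrt (G \<phi> (cmap \<phi> ((c \<circ> \<alpha>) t)) (m *\<^sub>R v) (m *\<^sub>R v))"
      using t \<phi> der[OF v t] ccw Icc_nontrivial[OF ab(2)]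
      by (intro speed_within_chart) auto
    moreover have "G \<phi> (cmap \<phi> (c (\<alpha> t))) (m *\<^sub>R v) (m *\<^sub>R v) = m\<^sup>2 * G \<phi> (cmap \<phi> (c (\<alpha> t))) v v"
      using metric_bilinear[OF \<phi>(1), of "cmap \<phi> (c (\<alpha> t))"] \<phi>(2)
      by (simp add: bilinear_lmul bilinear_rmul power2_eq_square)
    ultimately show ?thesis by (simp add: real_sqrt_mult)
  qed
  have "((\<lambda>t. speed_within A G {a..b} c (m *\<^sub>R t + q)) has_integral (1 / \<bar>m\<bar> ^ DIM(real)) *\<^sub>R l)
      ((\<lambda>x. (1 / m) *\<^sub>R x + - ((1 / m) *\<^sub>R q)) ` cbox a b)"
    using l m by (intro has_integral_affinity) auto
  then have "((\<lambda>t. speed_within A G {a..b} c (\<alpha> t)) has_integral (1 / \<bar>m\<bar>) * l) {a'..b'}"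
    using im by (simp add: \<alpha>_def)
  then have "((\<lambda>t. \<bar>m\<bar> * speed_within A G {a..b} c (\<alpha> t)) has_integral \<bar>m\<bar> * ((1 / \<bar>m\<bar>) * l)) {a'..b'}"
    by (rule has_integral_mult_right)
  then have "((\<lambda>t. \<bar>m\<bar> * speed_within A G {a..b} c (\<alpha> t)) has_integral l) {a'..b'}" using m by simp
  then have "(speed_within A G {a'..b'} (c \<circ> \<alpha>) has_integral l) {a'..b'}"
    using sp by (rule has_integral_eq[rotated]) auto
  then have "pw_curve A G (c \<circ> \<alpha>) a' b' l" using ab cc C1' by (intro pw_curve.base)
  then show ?thesis by (simp add: comp_def \<alpha>_def)
qed

lemma pw_curve_scale:
  assumes "pw_curve A G c a b l" "0 < m"
  shows "pw_curve A G (\<lambda>t. c (m * t + q)) ((a - q) / m) ((b - q) / m) l"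
  using assms
proof (induction rule: pw_curve.induct)
  case (base a b l)
  have "(\<lambda>x. (1 / m) *\<^sub>R x + - ((1 / m) *\<^sub>R q)) ` {a..b} = (\<lambda>x. 1 / m * x + - (q / m)) ` {a..b}"
    by simp
  also have "\<dots> = {(a - q) / m..(b - q) / m}"
    using base unfolding image_affinity_atLeastAtMost by (auto simp: diff_divide_distrib)
  finally have "(\<lambda>x. (1 / m) *\<^sub>R x + - ((1 / m) *\<^sub>R q)) ` {a..b} = {(a - q) / m..(b - q) / m}" .
  then show ?case using base by (intro pw_curve_affine_base) (auto simp: divide_strict_right_mono)
qed (blast intro: pw_curve.join)

lemma pw_curve_reverse:
  assumes "pw_curve A G c a b l"
  shows "pw_curve A G (\<lambda>t. c (- t)) (- b) (- a) l"
  using assms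
proof (induction rule: pw_curve.induct)
  case (base a b l)
  have "(\<lambda>x. (1 / (- 1)) *\<^sub>R x + - ((1 / (- 1)) *\<^sub>R 0)) ` {a..b} = {- b..- a}" by simp
  from pw_curve_affine_base[OF base(1) _ base(2-4) _ this] show ?case using base(1) by simp
next
  case (join a b l e l')
  then show ?case using pw_curve.join[OF join(4,3)] by (simp add: add.commute)
qed

text \<open>Derivatives within [a, b] see the curve on [a, b] only; this is what permits gluing
  curves by cases.\<close>

lemma pw_curve_cong:
  assumes "pw_curve A G c a b l" "\<And>t. t \<in> {a..b} \<Longrightarrow> c' t = c t"
  shows "pw_curve A G c' a b l"
  using assms
proof (induction rule: pw_curve.induct)
  case (base a b l)
  have vd: "(cmap \<phi> \<circ> c' has_vector_derivative v) (at t within {a..b}) \<longleftrightarrow>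
      (cmap \<phi> \<circ> c has_vector_derivative v) (at t within {a..b})" if "t \<in> {a..b}" for \<phi> :: "('m, 'e) chart" and v t
    using base.prems that by (auto elim!: has_vector_derivative_transform[rotated -1])
  have "continuous_on {a..b} c'"
    using base by (subst continuous_on_cong[OF refl, of _ c' c]) auto
  moreover have "C1_curve A {a..b} c'"
    unfolding C1_curve_def Let_def
  proof
    fix \<phi> assume "\<phi> \<in> A"
    then obtain v where v: "continuous_on {t \<in> {a..b}. c t \<in> cdom \<phi>} v"
      "\<forall>t\<in>{t \<in> {a..b}. c t \<in> cdom \<phi>}. (cmap \<phi> \<circ> c has_vector_derivative v t) (at t within {a..b})"
      using base(3) unfolding C1_curve_def Let_def by blast
    have "{t \<in> {a..b}. c' t \<in> cdom \<phi>} = {t \<in> {a..b}. c t \<in> cdom \<phi>}" using base.prems by auto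
    then show "\<exists>v. continuous_on {t \<in> {a..b}. c' t \<in> cdom \<phi>} v \<and>
      (\<forall>t\<in>{t \<in> {a..b}. c' t \<in> cdom \<phi>}. (cmap \<phi> \<circ> c' has_vector_derivative v t) (at t within {a..b}))"
      using v vd by (intro exI[of _ v]) auto
  qed
  moreover have "(speed_within A G {a..b} c' has_integral l) {a..b}"
  proof (rule has_integral_eq[OF _ base(4)])
    fix t assume t: "t \<in> {a..b}"
    have "vector_derivative (cmap \<phi> \<circ> c') (at t within {a..b}) = vector_derivative (cmap \<phi> \<circ> c) (at t within {a..b})"
      for \<phi> :: "('m, 'e) chart"
      using vd[OF t] by (simp add: vector_derivative_def)
    then show "speed_within A G {a..b} c t = speed_within A G {a..b} c' t"
      using base.prems[OF t] by (simp add: speed_within_def)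
  qed
  ultimately show ?case using base(1) by (intro pw_curve.base)
next
  case (join a b l e l')
  have "a < b" "b < e" using pw_curve_less[OF join(1)] pw_curve_less[OF join(2)] by auto
  then show ?case using join by (intro pw_curve.join) auto
qed

section \<open>Lengths of curves joining two points\<close>

definition reach :: "'m \<Rightarrow> 'm \<Rightarrow> real \<Rightarrow> bool" where
  "reach p q l \<longleftrightarrow> (\<exists>c. pw_curve A G c 0 1 l \<and> c 0 = p \<and> c 1 = q)"

lemma reachI:
  assumes "pw_curve A G c a b l" "c a = p" "c b = q"
  shows "reach p q l"
proof -
  have "a < b" using assms pw_curve_less by blast
  then have "pw_curve A G (\<lambda>t. c ((b - a) * t + a)) 0 1 l"
    using pw_curve_scale[OF assms(1), of "b - a" a] by simp
  then show ?thesis unfolding reach_def using assms by (intro exI[of _ "\<lambda>t. c ((b - a) * t + a)"]) auto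
qed

lemma reach_sym:
  assumes "reach p q l" shows "reach q p l"
proof -
  obtain c where c: "pw_curve A G c 0 1 l" "c 0 = p" "c 1 = q" using assms unfolding reach_def by blast
  show ?thesis by (rule reachI[OF pw_curve_reverse[OF c(1)]]) (use c in auto)
qed

lemma reach_trans:
  assumes "reach p q l" "reach q r l'"
  shows "reach p r (l + l')"
proof -
  obtain c c' where c: "pw_curve A G c 0 1 l" "c 0 = p" "c 1 = q" "pw_curve A G c' 0 1 l'" "c' 0 = q" "c' 1 = r"
    using assms unfolding reach_def by blast
  define j where "j t = (if t \<le> 1 then c t else c' (t - 1))" for t
  have "pw_curve A G (\<lambda>t. c' (1 * t + (- 1))) 1 2 l'"
    using pw_curve_scale[OF c(4), of 1 "- 1"] by simp
  moreover have "j t = c' (1 * t + (- 1))" if "t \<in> {1..2}" for t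
    using that c by (cases "t = 1") (auto simp: j_def)
  ultimately have "pw_curve A G j 1 2 l'" by (rule pw_curve_cong)
  moreover have "pw_curve A G j 0 1 l" by (rule pw_curve_cong[OF c(1)]) (auto simp: j_def)
  ultimately have "pw_curve A G j 0 2 (l + l')" by (intro pw_curve.join)
  then show ?thesis using c by (intro reachI[of j 0 2]) (auto simp: j_def)
qed

lemma reach_nonneg: "reach p q l \<Longrightarrow> 0 \<le> l"
  unfolding reach_def using pw_curve_nonneg by blast

text \<open>The point where two curves are joined lies in both sets of break points, so no
  consecutive pair of their union straddles it.\<close>

lemma pw_curve_imp_breaks:
  assumes "pw_curve A G c a b l"
  shows "\<exists>S. finite S \<and> a \<in> S \<and> b \<in> S \<and> S \<subseteq> {a..b} \<and>
    (\<forall>x\<in>S. \<forall>y\<in>S. x < y \<and> S \<inter> {x<..<y} = {} \<longrightarrow> C1_curve A {x..y} c)"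
  using assms
proof (induction rule: pw_curve.induct)
  case (base a b l)
  then show ?case by (intro exI[of _ "{a, b}"]) auto
next
  case (join a b l e l')
  obtain S S' where S: "finite S" "a \<in> S" "b \<in> S" "S \<subseteq> {a..b}"
      "\<forall>x\<in>S. \<forall>y\<in>S. x < y \<and> S \<inter> {x<..<y} = {} \<longrightarrow> C1_curve A {x..y} c"
    and S': "finite S'" "b \<in> S'" "e \<in> S'" "S' \<subseteq> {b..e}"
      "\<forall>x\<in>S'. \<forall>y\<in>S'. x < y \<and> S' \<inter> {x<..<y} = {} \<longrightarrow> C1_curve A {x..y} c"
    using join by blast
  have less: "a < b" "b < e" using pw_curve_less[OF join(1)] pw_curve_less[OF join(2)] by auto
  have "C1_curve A {x..y} c" if xy: "x \<in> S \<union> S'" "y \<in> S \<union> S'" "x < y" "(S \<union> S') \<inter> {x<..<y} = {}" for x y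
  proof (cases "y \<le> b")
    case True
    then have "x \<in> S" "y \<in> S" using xy S S' by force+
    then show ?thesis using S(5) xy by blast
  next
    case False
    then have "b \<le> x" using xy S(3) by fastforce
    then have "x \<in> S'" "y \<in> S'" using False xy S S' by force+
    then show ?thesis using S'(5) xy by blast
  qed
  then show ?case using S S' less by (intro exI[of _ "S \<union> S'"]) auto
qed

text \<open>Induction on the number of break points: cutting at an interior one leaves fewer on
  either side, as each side misses the opposite endpoint.\<close>

lemma breaks_imp_pw_curve:
  assumes "finite S" "a \<in> S" "b \<in> S" "S \<subseteq> {a..b}" "a < b" "continuous_on {a..b} c"
    "\<forall>x\<in>S. \<forall>y\<in>S. x < y \<and> S \<inter> {x<..<y} = {} \<longrightarrow> C1_curve A {x..y} c"
  shows "\<exists>l. pw_curve A G c a b l"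
  using assms
proof (induction "card S" arbitrary: S a b rule: less_induct)
  case less
  show ?case
  proof (cases "S \<inter> {a<..<b} = {}")
    case True
    then have "C1_curve A {a..b} c" using less.prems by blast
    then show ?thesis using C1_pw_curve less.prems by blast
  next
    case False
    then obtain u where u: "u \<in> S" "a < u" "u < b" by auto
    have part: "\<exists>l. pw_curve A G c x y l" if xy: "x \<in> S" "y \<in> S" "x < y" "{x, y} \<noteq> {a, b}" for x y
    proof (rule less.hyps[of "S \<inter> {x..y}"])
      have "\<not> S \<subseteq> {x..y}"
      proof
        assume "S \<subseteq> {x..y}"
        then have "x \<le> a" "b \<le> y" using less.prems(2,3) by auto
        moreover have "a \<le> x" "y \<le> b" using less.prems(4) xy(1,2) by auto
        ultimately show False using xy(4) by auto
      qed
      then show "card (S \<inter> {x..y}) < card S"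
        using less.prems(1) by (intro psubset_card_mono) blast+
      show "\<forall>u\<in>S \<inter> {x..y}. \<forall>w\<in>S \<inter> {x..y}. u < w \<and> S \<inter> {x..y} \<inter> {u<..<w} = {} \<longrightarrow> C1_curve A {u..w} c"
      proof (intro ballI impI)
        fix u w assume "u \<in> S \<inter> {x..y}" "w \<in> S \<inter> {x..y}" "u < w \<and> S \<inter> {x..y} \<inter> {u<..<w} = {}"
        moreover from this have "S \<inter> {u<..<w} = {}" by auto
        ultimately show "C1_curve A {u..w} c" using less.prems(7) by blast
      qed
      show "continuous_on {x..y} c"
        using less.prems(4) xy by (intro continuous_on_subset[OF less.prems(6)]) auto
    qed (use less.prems(1) xy in auto)
    have "\<exists>l. pw_curve A G c a u l" "\<exists>l. pw_curve A G c u b l"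
      using u less.prems(2,3) by (auto intro!: part simp: doubleton_eq_iff)
    then show ?thesis using pw_curve.join by blast
  qed
qed

lemma piecewise_C1_curve_iff: "piecewise_C1_curve A c \<longleftrightarrow> (\<exists>l. pw_curve A G c 0 1 l)"
proof
  assume "piecewise_C1_curve A c"
  then obtain S where "continuous_on {0..1} c" "finite S" "0 \<in> S" "1 \<in> S" "S \<subseteq> {0..1}"
    "\<forall>x\<in>S. \<forall>y\<in>S. x < y \<and> S \<inter> {x<..<y} = {} \<longrightarrow> C1_curve A {x..y} c"
    unfolding piecewise_C1_curve_def by blast
  then show "\<exists>l. pw_curve A G c 0 1 l" by (intro breaks_imp_pw_curve) auto
next
  assume "\<exists>l. pw_curve A G c 0 1 l"
  then show "piecewise_C1_curve A c"
    using pw_curve_imp_breaks pw_curve_continuous unfolding piecewise_C1_curve_def by metis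
qed

lemma riemannian_dist_eq: "riemannian_dist A G p q = Inf {l. reach p q l}"
proof -
  have "{curve_length A G c | c. piecewise_C1_curve A c \<and> c 0 = p \<and> c 1 = q} = {l. reach p q l}"
    unfolding reach_def piecewise_C1_curve_iff using pw_curve_length_eq by blast
  then show ?thesis by (simp add: riemannian_dist_def)
qed

section \<open>The Riemannian distance in charts\<close>

abbreviation dG :: "('m, 'e) chart \<Rightarrow> 'e \<Rightarrow> 'e \<Rightarrow> 'e \<Rightarrow> 'e \<Rightarrow> real" where
  "dG \<phi> \<equiv> \<lambda>x w u v. frechet_derivative (\<lambda>y. G \<phi> y u v) (at x) w"

lemma segment_C1:
  assumes \<phi>: "\<phi> \<in> A" and seg: "closed_segment x y \<subseteq> cmap \<phi> ` cdom \<phi>"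
  defines "c \<equiv> \<lambda>t. cinv \<phi> (x + t *\<^sub>R (y - x))"
  shows "continuous_on {0..1} c" "C1_curve A {0..1} c"
    "\<And>t. t \<in> {0..1} \<Longrightarrow> speed_within A G {0..1} c t = sqrt (G \<phi> (x + t *\<^sub>R (y - x)) (y - x) (y - x))"
proof -
  let ?l = "\<lambda>t. x + t *\<^sub>R (y - x)"
  have l: "?l t \<in> cmap \<phi> ` cdom \<phi>" if "t \<in> {0..1}" for t
    using seg point_in_segment[OF that] by auto
  have lc: "continuous_on T ?l" for T by (intro continuous_intros)
  have ld: "(?l has_vector_derivative (y - x)) (at t within I)" for t I
    by (auto intro!: derivative_eq_intros)
  show c: "continuous_on {0..1} c"
    unfolding c_def using l by (intro continuous_on_compose2[OF chart(4)[OF \<phi>] lc]) auto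
  show "C1_curve A {0..1} c"
    unfolding C1_curve_def Let_def
  proof
    fix \<psi> assume \<psi>: "\<psi> \<in> A"
    let ?T = "{t \<in> {0..1}. c t \<in> cdom \<psi>}" and ?W = "cmap \<phi> ` (cdom \<phi> \<inter> cdom \<psi>)"
    have W: "?l t \<in> ?W" if "t \<in> ?T" for t
      using that l[of t] chart(6,7)[OF \<phi>, of "?l t"] unfolding c_def
      by (intro image_eqI[of _ _ "cinv \<phi> (?l t)"]) auto
    let ?v = "\<lambda>t. frechet_derivative (transition \<phi> \<psi>) (at (?l t)) (y - x)"
    have "continuous_on ?T ?v"
      using W by (intro continuous_on_compose2[OF
        smooth_on_continuous_on[OF smooth_on_frechet_derivative[OF transition_smooth[OF \<phi> \<psi>]]] lc]) auto
    moreover have "(cmap \<psi> \<circ> c has_vector_derivative ?v t) (at t within {0..1})" if "t \<in> ?T" for t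
    proof -
      have "(transition \<phi> \<psi> has_derivative frechet_derivative (transition \<phi> \<psi>) (at (?l t)))
          (at (?l t) within ?l ` {0..1})"
        by (rule has_derivative_at_withinI[OF smooth_on_has_derivative[OF transition_smooth[OF \<phi> \<psi>] W[OF that]]])
      from vector_derivative_diff_chain_within[OF ld this] show ?thesis
        by (simp add: transition_def c_def comp_def)
    qed
    ultimately show "\<exists>v. continuous_on ?T v \<and>
       (\<forall>t\<in>?T. (cmap \<psi> \<circ> c has_vector_derivative v t) (at t within {0..1}))" by blast
  qed
  fix t :: real assume t: "t \<in> {0..1}"
  have "(cmap \<phi> \<circ> c has_vector_derivative (y - x)) (at t within {0..1})"
    using l chart(6)[OF \<phi>]
    by (intro has_vector_derivative_transform[OF t _ ld]) (simp add: c_def)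
  moreover have "continuous (at t within {0..1}) c"
    using c t by (simp add: continuous_on_eq_continuous_within)
  ultimately have "speed_within A G {0..1} c t = sqrt (G \<phi> (cmap \<phi> (c t)) (y - x) (y - x))"
    using \<phi> t l[OF t] chart(7)[OF \<phi>] Icc_nontrivial[of 0 1 t]
    by (intro speed_within_chart) (auto simp: c_def)
  then show "speed_within A G {0..1} c t = sqrt (G \<phi> (?l t) (y - x) (y - x))"
    using chart(6)[OF \<phi> l[OF t]] by (simp add: c_def)
qed

lemma segment_reach:
  assumes "\<phi> \<in> A" "closed_segment x y \<subseteq> cmap \<phi> ` cdom \<phi>"
  shows "\<exists>l. reach (cinv \<phi> x) (cinv \<phi> y) l"
  using reachI[OF C1_pw_curve[OF zero_less_one segment_C1(1,2)[OF assms]]] by auto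

text \<open>The coordinate segment has the constant velocity y - x. Freezing the metric at x changes
  its norm by at most C / k times the distance from x times norm (y - x), hence the quadratic
  error.\<close>

lemma segment_upper:
  assumes \<phi>: "\<phi> \<in> A" and K: "convex K" "K \<subseteq> cmap \<phi> ` cdom \<phi>"
    and lm: "local_metric (G \<phi>) (dG \<phi>) K k C" and xy: "x \<in> K" "y \<in> K"
  shows "\<exists>l. reach (cinv \<phi> x) (cinv \<phi> y) l \<and> l \<le> sqrt (G \<phi> x (y - x) (y - x)) + C / k * (norm (y - x))\<^sup>2"
proof -
  interpret local_metric "G \<phi>" "dG \<phi>" K k C by (rule lm)
  let ?c = "\<lambda>t. cinv \<phi> (x + t *\<^sub>R (y - x))"
  have segK: "closed_segment x y \<subseteq> K" using K xy by (simp add: closed_segment_subset)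
  then have seg: "closed_segment x y \<subseteq> cmap \<phi> ` cdom \<phi>" using K by auto
  note C1 = segment_C1[OF \<phi> seg]
  let ?s = "speed_within A G {0..1} ?c"
  have p: "pw_curve A G ?c 0 1 (integral {0..1} ?s)" using C1 by (intro C1_pw_curve) auto
  have "?s t \<le> nrm x (y - x) + C / k * (norm (y - x))\<^sup>2" if t: "t \<in> {0..1}" for t
  proof -
    let ?z = "x + t *\<^sub>R (y - x)"
    have z: "?z \<in> K" using segK point_in_segment[OF t] by auto
    have "nrm ?z (y - x) \<le> nrm x (y - x) + C / k * norm (?z - x) * norm (y - x)"
      using nrm_lipschitz[OF xy(1) z, of "y - x"] by linarith
    also have "C / k * norm (?z - x) * norm (y - x) \<le> C / k * norm (y - x) * norm (y - x)"
      using t C_pos k_pos by (intro mult_right_mono mult_left_mono) (auto simp: mult_left_le_one_le)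
    finally show ?thesis using C1(3)[OF t] by (simp add: nrm_def power2_eq_square)
  qed
  then have "integral {0..1} ?s \<le> integral {0..1} (\<lambda>t::real. nrm x (y - x) + C / k * (norm (y - x))\<^sup>2)"
    using C1 C1_speed_continuous[of 0 1 ?c]
    by (intro integral_le integrable_continuous_real) auto
  also have "\<dots> = nrm x (y - x) + C / k * (norm (y - x))\<^sup>2" by simp
  finally show ?thesis using reachI[OF p, of "cinv \<phi> x" "cinv \<phi> y"] by (auto simp: nrm_def)
qed

text \<open>A constant one-form \<theta> dominated by \<kappa> times the norm integrates along any
  curve to the difference of its end values, so it bounds all lengths from below at once.\<close>

lemma calibration:
  fixes \<theta> :: "'e \<Rightarrow> real"
  assumes "pw_curve A G c a b l" "\<phi> \<in> A" "linear \<theta>" "0 \<le> \<kappa>"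
    and "\<And>t. t \<in> {a..b} \<Longrightarrow> c t \<in> cdom \<phi>"
    and "\<And>t v. t \<in> {a..b} \<Longrightarrow> \<theta> v \<le> \<kappa> * sqrt (G \<phi> (cmap \<phi> (c t)) v v)"
  shows "\<theta> (cmap \<phi> (c b)) - \<theta> (cmap \<phi> (c a)) \<le> \<kappa> * l"
  using assms
proof (induction rule: pw_curve.induct)
  case (base a b l)
  have eq: "{t \<in> {a..b}. c t \<in> cdom \<phi>} = {a..b}" using base.prems by auto
  obtain v where "\<forall>t\<in>{t \<in> {a..b}. c t \<in> cdom \<phi>}. (cmap \<phi> \<circ> c has_vector_derivative v t) (at t within {a..b})"
    using base(3) base.prems(1) unfolding C1_curve_def Let_def by blast
  then have v: "\<And>t. t \<in> {a..b} \<Longrightarrow> (cmap \<phi> \<circ> c has_vector_derivative v t) (at t within {a..b})"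
    unfolding eq by blast
  have bl: "bounded_linear \<theta>" using base.prems(2) linear_conv_bounded_linear by blast
  have "((\<lambda>t. \<theta> (v t)) has_integral \<theta> ((cmap \<phi> \<circ> c) b) - \<theta> ((cmap \<phi> \<circ> c) a)) {a..b}"
    by (rule fundamental_theorem_of_calculus[OF less_imp_le[OF base(1)]
        bounded_linear.has_vector_derivative[OF bl v]])
  moreover have "((\<lambda>t. \<kappa> * speed_within A G {a..b} c t) has_integral \<kappa> * l) {a..b}"
    using base by (intro has_integral_mult_right)
  moreover have "\<theta> (v t) \<le> \<kappa> * speed_within A G {a..b} c t" if t: "t \<in> {a..b}" for t
  proof -
    have "speed_within A G {a..b} c t = sqrt (G \<phi> (cmap \<phi> (c t)) (v t) (v t))"
      using t base v Icc_nontrivial[OF base(1)]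
      by (intro speed_within_chart) (auto simp: continuous_on_eq_continuous_within)
    then show ?thesis using base.prems t by simp
  qed
  ultimately show ?case by (auto dest: has_integral_le)
next
  case (join a b l e l')
  have "a < b" "b < e" using pw_curve_less[OF join(1)] pw_curve_less[OF join(2)] by auto
  then have "\<theta> (cmap \<phi> (c b)) - \<theta> (cmap \<phi> (c a)) \<le> \<kappa> * l" "\<theta> (cmap \<phi> (c e)) - \<theta> (cmap \<phi> (c b)) \<le> \<kappa> * l'"
    using join by auto
  then show ?case by (simp add: algebra_simps)
qed

text \<open>Up to its first exit time the curve stays in the closed coordinate ball, where
  ellipticity holds, and it ends on the sphere at some z. The inner product with the radial
  direction of z calibrates this part.\<close>

lemma exit_bound:
  assumes \<phi>: "\<phi> \<in> A" and K: "cball x r \<subseteq> K" "K \<subseteq> cmap \<phi> ` cdom \<phi>"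
    and lm: "local_metric (G \<phi>) (dG \<phi>) K k C" and r: "0 < r"
    and l: "reach (cinv \<phi> x) q l" and q: "\<not> (q \<in> cdom \<phi> \<and> cmap \<phi> q \<in> ball x r)"
  shows "k * r \<le> l"
proof -
  interpret local_metric "G \<phi>" "dG \<phi>" K k C by (rule lm)
  obtain c where c: "pw_curve A G c 0 1 l" "c 0 = cinv \<phi> x" "c 1 = q" using l unfolding reach_def by blast
  have cc: "continuous_on {0..1} c" using pw_curve_continuous[OF c(1)] .
  define V where "V = cdom \<phi> \<inter> cmap \<phi> -` ball x r"
  have V: "open V" unfolding V_def by (rule open_chart_preimage[OF \<phi> open_ball])
  have "x \<in> cball x r" using r by simp
  then have x: "x \<in> cmap \<phi> ` cdom \<phi>" using K by blast
  have c0: "c 0 \<in> V" using c(2) chart(6,7)[OF \<phi> x] r by (simp add: V_def)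
  define B where "B = {0..1} \<inter> c -` (- V)"
  have "closed B" unfolding B_def by (intro continuous_closed_preimage cc) (use V in auto)
  moreover have "1 \<in> B" using c(3) q by (auto simp: B_def V_def)
  moreover have bdd: "bdd_below B" unfolding B_def by (meson Int_lower1 bdd_below_Icc bdd_below_mono)
  ultimately have tB: "Inf B \<in> B" using closed_contains_Inf by blast
  define t where "t = Inf B"
  have t: "0 < t" "t \<le> 1" "c t \<notin> V" using tB c0 by (auto simp: t_def B_def less_le)
  have before: "c s \<in> V" if "0 \<le> s" "s < t" for s
    using cInf_lower[of s B] bdd that t by (force simp: t_def B_def)
  \<comment> \<open>At the exit time the curve might have left the chart altogether. This is
    excluded because the image of the closed ball is compact, hence closed in the Hausdorff space,
    and contains all earlier points.\<close>
  have "compact (cinv \<phi> ` cball x r)"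
    using K by (intro compact_continuous_image continuous_on_subset[OF chart(4)[OF \<phi>]]) auto
  then have cl: "closed (cinv \<phi> ` cball x r)" by (rule compact_imp_closed)
  have inW: "c s \<in> cinv \<phi> ` cball x r" if "0 \<le> s" "s < t" for s
    using before[OF that] chart(5)[OF \<phi>, of "c s"]
    by (intro image_eqI[of _ _ "cmap \<phi> (c s)"]) (auto simp: V_def)
  have "c t \<in> cinv \<phi> ` cball x r"
  proof -
    have "continuous (at t within {0..1}) c" using cc t by (simp add: continuous_on_eq_continuous_within)
    then have "continuous (at t within {0..<t}) c" using t by (elim continuous_within_subset) auto
    then have "(c \<longlongrightarrow> c t) (at t within {0..<t})" by (simp add: continuous_within)
    moreover have "\<forall>\<^sub>F s in at t within {0..<t}. c s \<in> cinv \<phi> ` cball x r"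
      using inW by (auto simp: eventually_at_filter)
    moreover have "at t within {0..<t} \<noteq> bot"
    proof -
      have "t islimpt {0..<t}" using t islimpt_greaterThanLessThan2[of 0 t] islimpt_subset[of t "{0<..<t}" "{0..<t}"] by force
      then show ?thesis by (simp add: trivial_limit_within)
    qed
    ultimately show ?thesis using cl Lim_in_closed_set by blast
  qed
  then obtain z where z: "z \<in> cball x r" "c t = cinv \<phi> z" by blast
  have zi: "z \<in> cmap \<phi> ` cdom \<phi>" using z K by auto
  have inK: "c s \<in> cdom \<phi> \<and> cmap \<phi> (c s) \<in> cball x r" if "s \<in> {0..t}" for s
  proof (cases "s = t")
    case True then show ?thesis using z chart(6,7)[OF \<phi> zi] by simp
  next
    case False
    then show ?thesis using before[of s] that by (auto simp: V_def)
  qed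
  have zr: "norm (z - x) = r"
    using t(3) z inK[of t] t chart(6)[OF \<phi> zi] by (auto simp: V_def dist_norm norm_minus_commute)
  obtain l1 where l1: "pw_curve A G c 0 t l1" "l1 \<le> l"
  proof (cases "t = 1")
    case False
    then obtain l1 l2 where "pw_curve A G c 0 t l1" "pw_curve A G c t 1 l2" "l = l1 + l2"
      using pw_curve_split[OF c(1), of t] t by auto
    then show ?thesis using that pw_curve_nonneg[of c t 1 l2] by simp
  qed (use c in auto)
  define \<theta> where "\<theta> v = (v \<bullet> (z - x)) / r" for v
  have "\<theta> (cmap \<phi> (c t)) - \<theta> (cmap \<phi> (c 0)) \<le> 1 / k * l1"
  proof (rule calibration[OF l1(1) \<phi>])
    show "linear \<theta>" unfolding \<theta>_def by (rule linearI) (auto simp: inner_add_left add_divide_distrib)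
    show "0 \<le> 1 / k" using k_pos by simp
    fix s assume s: "s \<in> {0..t}"
    show "c s \<in> cdom \<phi>" using inK[OF s] by simp
    fix v
    have "\<theta> v \<le> norm v" using Cauchy_Schwarz_ineq2[of v "z - x"] r zr by (simp add: \<theta>_def field_simps)
    also have "\<dots> \<le> 1 / k * nrm (cmap \<phi> (c s)) v"
      using nrm_ge[of "cmap \<phi> (c s)" v] inK[OF s] K(1) k_pos by (simp add: field_simps subset_eq)
    finally show "\<theta> v \<le> 1 / k * sqrt (G \<phi> (cmap \<phi> (c s)) v v)" by (simp add: nrm_def)
  qed
  moreover have "\<theta> (cmap \<phi> (c t)) - \<theta> (cmap \<phi> (c 0)) = r"
  proof -
    have "\<theta> (cmap \<phi> (c t)) - \<theta> (cmap \<phi> (c 0)) = ((z - x) \<bullet> (z - x)) / r"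
      using c(2) z(2) chart(6)[OF \<phi> zi] chart(6)[OF \<phi> x] by (simp add: \<theta>_def inner_diff_left diff_divide_distrib)
    also have "\<dots> = r" using zr r by (simp add: power2_norm_eq_inner[symmetric] power2_eq_square)
    finally show ?thesis .
  qed
  ultimately have "r \<le> l1 / k" by simp
  then show ?thesis using l1(2) k_pos by (simp add: field_simps)
qed

text \<open>A curve shorter than k r cannot leave the ball, by \<open>exit_bound\<close>. There it
  is calibrated by pairing with u = y - x in the metric frozen at x, a form of dual norm 1 at x;
  passing to the metric along the curve costs the factor 1 + C r / k^2.\<close>

lemma lower_bound:
  assumes \<phi>: "\<phi> \<in> A" and K: "cball x r \<subseteq> K" "K \<subseteq> cmap \<phi> ` cdom \<phi>"
    and lm: "local_metric (G \<phi>) (dG \<phi>) K k C" and r: "0 < r"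
    and y: "y \<in> K" and l: "reach (cinv \<phi> x) (cinv \<phi> y) l" and lr: "l < k * r"
  shows "sqrt (G \<phi> x (y - x) (y - x)) \<le> (1 + C / k\<^sup>2 * r) * l"
proof (cases "y = x")
  case True
  interpret local_metric "G \<phi>" "dG \<phi>" K k C by (rule lm)
  have "x \<in> K" using K r by auto
  then have "G \<phi> x 0 0 = 0" using bilinear_lzero[OF bilin] by blast
  moreover have "0 \<le> (1 + C / k\<^sup>2 * r) * l"
    using reach_nonneg[OF l] C_pos r by (intro mult_nonneg_nonneg add_nonneg_nonneg) auto
  ultimately show ?thesis using True by simp
next
  case False
  interpret local_metric "G \<phi>" "dG \<phi>" K k C by (rule lm)
  let ?u = "y - x"
  have xK: "x \<in> K" using K r by auto
  have "0 < k * norm ?u" using False k_pos by simp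
  then have nu: "0 < nrm x ?u" using nrm_ge[OF xK, of ?u] by linarith
  obtain c where c: "pw_curve A G c 0 1 l" "c 0 = cinv \<phi> x" "c 1 = cinv \<phi> y" using l unfolding reach_def by blast
  have inV: "c t \<in> cdom \<phi> \<and> cmap \<phi> (c t) \<in> ball x r" if t: "t \<in> {0..1}" for t
  proof (rule ccontr)
    assume n: "\<not> ?thesis"
    consider "t = 0" | "t = 1" | "0 < t" "t < 1" using t by force
    then have "\<exists>l'. reach (cinv \<phi> x) (c t) l' \<and> l' \<le> l"
    proof cases
      case 1
      have "c 0 \<in> cdom \<phi> \<and> cmap \<phi> (c 0) \<in> ball x r"
        using c(2) chart(6,7)[OF \<phi>, of x] xK K r by auto
      then show ?thesis using n 1 by simp
    next
      case 2 then show ?thesis using l c by auto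
    next
      case 3
      then obtain l1 l2 where "pw_curve A G c 0 t l1" "pw_curve A G c t 1 l2" "l = l1 + l2"
        using pw_curve_split[OF c(1)] by auto
      then show ?thesis using pw_curve_nonneg[of c t 1 l2] reachI[of c 0 t l1] c by fastforce
    qed
    then obtain l' where "reach (cinv \<phi> x) (c t) l'" "l' \<le> l" by blast
    then show False using exit_bound[OF \<phi> K lm r _ n] lr by fastforce
  qed
  define \<theta> where "\<theta> v = G \<phi> x v ?u / nrm x ?u" for v
  have "\<theta> (cmap \<phi> (c 1)) - \<theta> (cmap \<phi> (c 0)) \<le> (1 + C / k\<^sup>2 * r) * l"
  proof (rule calibration[OF c(1) \<phi>])
    show "linear \<theta>" unfolding \<theta>_def using bilin[OF xK]
      by (intro linearI) (auto simp: bilinear_ladd bilinear_lmul add_divide_distrib)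
    show "0 \<le> 1 + C / k\<^sup>2 * r" using C_pos r by (intro add_nonneg_nonneg) auto
    fix t :: real assume t: "t \<in> {0..1}"
    show "c t \<in> cdom \<phi>" using inV[OF t] by simp
    fix v
    let ?z = "cmap \<phi> (c t)"
    have z: "norm (?z - x) \<le> r" using inV[OF t] by (simp add: dist_norm norm_minus_commute)
    then have zK: "?z \<in> K" using K(1) inV[OF t] by (auto simp: subset_eq)
    have "\<theta> v \<le> nrm x v" using Cauchy_Schwarz[OF xK, of v ?u] nu by (simp add: \<theta>_def field_simps)
    also have "\<dots> \<le> nrm ?z v + C / k * norm (?z - x) * norm v"
      using nrm_lipschitz[OF xK zK, of v] by linarith
    also have "C / k * norm (?z - x) * norm v \<le> C / k * r * (nrm ?z v / k)"
      using z nrm_ge[OF zK, of v] k_pos C_pos r by (intro mult_mono) (auto simp: field_simps)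
    finally show "\<theta> v \<le> (1 + C / k\<^sup>2 * r) * sqrt (G \<phi> ?z v v)"
      by (simp add: nrm_def power2_eq_square algebra_simps)
  qed
  moreover have "\<theta> (cmap \<phi> (c 1)) - \<theta> (cmap \<phi> (c 0)) = nrm x ?u"
  proof -
    have "\<theta> (cmap \<phi> (c 1)) - \<theta> (cmap \<phi> (c 0)) = G \<phi> x ?u ?u / nrm x ?u"
      using c(2,3) chart(6)[OF \<phi>, of x] chart(6)[OF \<phi>, of y] xK y K(2) bilin[OF xK]
      by (simp add: \<theta>_def bilinear_lsub diff_divide_distrib subset_eq)
    also have "\<dots> = nrm x ?u" using nu by (simp add: nrm_sq[OF xK, symmetric] power2_eq_square)
    finally show ?thesis .
  qed
  ultimately show ?thesis by (simp add: nrm_def)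
qed

end

section \<open>The distance and its topology\<close>

locale riemannian_connected = riemannian +
  assumes conn: "connected (UNIV :: 'a set)"
begin

text \<open>Segments in a chart make all nearby points reachable, so with symmetry and transitivity
  the reachable set and its complement are both open.\<close>

lemma reach_exists: "\<exists>l. reach p q l"
proof -
  define R where "R = {q. \<exists>l. reach p q l}"
  have near: "\<exists>V. open V \<and> q \<in> V \<and> (\<forall>q'\<in>V. \<exists>l. reach q q' l)" for q
  proof -
    obtain \<phi> where \<phi>: "\<phi> \<in> A" "q \<in> cdom \<phi>" using chart_at by blast
    then obtain \<epsilon> where e: "0 < \<epsilon>" "ball (cmap \<phi> q) \<epsilon> \<subseteq> cmap \<phi> ` cdom \<phi>"
      using chart(2)[OF \<phi>(1)] open_contains_ball by blast
    let ?V = "cdom \<phi> \<inter> cmap \<phi> -` ball (cmap \<phi> q) \<epsilon>"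
    have "\<exists>l. reach q q' l" if "q' \<in> ?V" for q'
    proof -
      have "closed_segment (cmap \<phi> q) (cmap \<phi> q') \<subseteq> ball (cmap \<phi> q) \<epsilon>"
        using that e by (intro closed_segment_subset) auto
      then have "\<exists>l. reach (cinv \<phi> (cmap \<phi> q)) (cinv \<phi> (cmap \<phi> q')) l"
        using e by (intro segment_reach \<phi>) auto
      then show ?thesis using that \<phi> chart(5) by simp
    qed
    moreover have "open ?V" by (rule open_chart_preimage[OF \<phi>(1) open_ball])
    ultimately show ?thesis using \<phi> e by (intro exI[of _ ?V]) auto
  qed
  have "open R"
  proof (subst open_subopen, intro ballI)
    fix q assume "q \<in> R"
    then obtain l where l: "reach p q l" by (auto simp: R_def)
    obtain V where V: "open V" "q \<in> V" "\<forall>q'\<in>V. \<exists>l. reach q q' l" using near by blast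
    then have "V \<subseteq> R" using reach_trans[OF l] unfolding R_def by blast
    then show "\<exists>T. open T \<and> q \<in> T \<and> T \<subseteq> R" using V by blast
  qed
  moreover have "open (- R)"
  proof (subst open_subopen, intro ballI)
    fix q assume q: "q \<in> - R"
    obtain V where V: "open V" "q \<in> V" "\<forall>q'\<in>V. \<exists>l. reach q q' l" using near by blast
    have "q' \<in> - R" if q': "q' \<in> V" for q'
    proof
      assume "q' \<in> R"
      then obtain l l' where "reach p q' l" "reach q q' l'" using V q' by (auto simp: R_def)
      then have "q \<in> R" using reach_trans reach_sym unfolding R_def by blast
      then show False using q by simp
    qed
    then show "\<exists>T. open T \<and> q \<in> T \<and> T \<subseteq> - R" using V by blast
  qed
  moreover have "p \<in> R"
  proof -
    obtain V where "p \<in> V" "\<forall>q'\<in>V. \<exists>l. reach p q' l" using near by blast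
    then show ?thesis by (auto simp: R_def)
  qed
  ultimately have "R = UNIV"
    using conn unfolding connected_clopen by (metis closed_def open_openin closed_closedin subtopology_UNIV empty_iff)
  then show ?thesis by (auto simp: R_def)
qed

definition d :: "'a \<Rightarrow> 'a \<Rightarrow> real" where "d p q = riemannian_dist A G p q"

lemma d_eq: "d p q = Inf {l. reach p q l}"
  by (simp add: d_def riemannian_dist_eq)

lemma d_le: "reach p q l \<Longrightarrow> d p q \<le> l"
  unfolding d_eq by (rule cInf_lower) (auto intro!: bdd_belowI[of _ 0] reach_nonneg)

lemma d_ge: "(\<And>l. reach p q l \<Longrightarrow> x \<le> l) \<Longrightarrow> x \<le> d p q"
  unfolding d_eq using reach_exists[of p q] by (intro cInf_greatest) auto

lemma d_approx: "d p q < x \<Longrightarrow> \<exists>l<x. reach p q l"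
  by (meson d_ge not_le)

lemma d_nonneg: "0 \<le> d p q"
  by (rule d_ge) (rule reach_nonneg)

lemma d_sym: "d p q = d q p"
  by (intro antisym d_ge d_le) (auto intro: reach_sym)

lemma d_triangle: "d p r \<le> d p q + d q r"
proof (rule field_le_epsilon)
  fix \<epsilon> :: real assume "0 < \<epsilon>"
  then obtain l l' where "reach p q l" "l < d p q + \<epsilon> / 2" "reach q r l'" "l' < d q r + \<epsilon> / 2"
    using d_approx[of p q "d p q + \<epsilon> / 2"] d_approx[of q r "d q r + \<epsilon> / 2"] by auto
  then show "d p r \<le> d p q + d q r + \<epsilon>" using d_le[OF reach_trans, of p q l r l'] by simp
qed

text \<open>The interface between the manifold and the local analysis. All estimates are proved with
  curves that may wander within the larger ball of radius R; \<rho> is small enough to keep the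
  relevant ones there.\<close>

lemma chart_comparison:
  assumes \<phi>: "\<phi> \<in> A" and p: "p \<in> cdom \<phi>"
  obtains \<rho> k C where "0 < \<rho>" "cball (cmap \<phi> p) \<rho> \<subseteq> cmap \<phi> ` cdom \<phi>"
    "local_metric (G \<phi>) (dG \<phi>) (cball (cmap \<phi> p) \<rho>) k C"
    "\<And>x y. x \<in> cball (cmap \<phi> p) \<rho> \<Longrightarrow> y \<in> cball (cmap \<phi> p) \<rho> \<Longrightarrow>
      d (cinv \<phi> x) (cinv \<phi> y) \<le> sqrt (G \<phi> x (y - x) (y - x)) + C * (norm (y - x))\<^sup>2"
    "\<And>x y. x \<in> cball (cmap \<phi> p) \<rho> \<Longrightarrow> y \<in> cball (cmap \<phi> p) \<rho> \<Longrightarrow>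
      sqrt (G \<phi> x (y - x) (y - x)) \<le> d (cinv \<phi> x) (cinv \<phi> y) + C * (norm (y - x))\<^sup>2"
    "\<And>x y. x \<in> cball (cmap \<phi> p) \<rho> \<Longrightarrow> y \<in> cball (cmap \<phi> p) \<rho> \<Longrightarrow>
      k * norm (y - x) \<le> d (cinv \<phi> x) (cinv \<phi> y)"
    "\<And>r q. 0 < r \<Longrightarrow> r \<le> \<rho> \<Longrightarrow> \<not> (q \<in> cdom \<phi> \<and> cmap \<phi> q \<in> ball (cmap \<phi> p) r) \<Longrightarrow> k * r \<le> d p q"
proof -
  define x0 where "x0 = cmap \<phi> p"
  obtain R where R: "0 < R" "cball x0 R \<subseteq> cmap \<phi> ` cdom \<phi>"
    using chart(2)[OF \<phi>] p open_contains_cball unfolding x0_def by blast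
  let ?K = "cball x0 R"
  obtain k C where lm: "local_metric (G \<phi>) (dG \<phi>) ?K k C"
    using local_metric_exists[OF chart(2)[OF \<phi>], of "G \<phi>" ?K]
      metric_bilinear[OF \<phi>] metric_sym[OF \<phi>] metric_pos[OF \<phi>] metric_smooth[OF \<phi>] R by auto
  interpret local_metric "G \<phi>" "dG \<phi>" ?K k C by (rule lm)
  define \<Lambda> where "\<Lambda> = 1 + sqrt C / k"
  \<comment> \<open>Points x and y of the small ball satisfy norm (y - x) \<le> 2 * \<rho>, and
    \<rho> + \<Lambda> * 2 * \<rho> = R.\<close>
  define \<rho> where "\<rho> = R / (1 + 2 * \<Lambda>)"
  define C' where "C' = C + C / k + C / k\<^sup>2 * \<Lambda> * sqrt C"
  have L: "1 \<le> \<Lambda>" using C_pos k_pos by (simp add: \<Lambda>_def)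
  have rho: "0 < \<rho>" "\<rho> * (1 + 2 * \<Lambda>) = R" using L R by (auto simp: \<rho>_def)
  have "\<rho> * 1 \<le> \<rho> * (1 + 2 * \<Lambda>)" using rho L by (intro mult_left_mono) auto
  then have rhoR: "\<rho> \<le> R" using rho by simp
  have parts: "0 \<le> C / k" "0 \<le> C / k\<^sup>2 * \<Lambda> * sqrt C" using C_pos k_pos L by auto
  then have C': "C \<le> C'" "C / k \<le> C'" "C / k\<^sup>2 * \<Lambda> * sqrt C \<le> C'" using C_pos by (auto simp: C'_def)
  have sub: "cball x0 \<rho> \<subseteq> ?K" using rhoR by auto
  have small: "cball x (\<Lambda> * norm (y - x)) \<subseteq> ?K" "norm (y - x) \<le> \<Lambda> * norm (y - x)"
    if "x \<in> cball x0 \<rho>" "y \<in> cball x0 \<rho>" for x y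
  proof -
    have n: "norm (y - x) \<le> 2 * \<rho>" using that norm_triangle_ineq4[of "y - x0" "x - x0"]
      by (simp add: dist_norm norm_minus_commute)
    have "\<Lambda> * norm (y - x) \<le> \<Lambda> * (2 * \<rho>)" using n L by (intro mult_left_mono) auto
    then have "\<Lambda> * norm (y - x) + dist x x0 \<le> R"
      using that rho by (simp add: dist_commute algebra_simps)
    then show "cball x (\<Lambda> * norm (y - x)) \<subseteq> ?K" by (simp add: cball_subset_cball_iff)
    show "norm (y - x) \<le> \<Lambda> * norm (y - x)" using mult_right_mono[OF L, of "norm (y - x)"] by simp
  qed
  show ?thesis
  proof (rule that[of \<rho> k C', folded x0_def])
    show "0 < \<rho>" "cball x0 \<rho> \<subseteq> cmap \<phi> ` cdom \<phi>" using rho(1) order_trans[OF sub R(2)] by auto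
    show "local_metric (G \<phi>) (dG \<phi>) (cball x0 \<rho>) k C'" using mono[OF sub C'(1)] .
    fix x y assume x: "x \<in> cball x0 \<rho>" and y: "y \<in> cball x0 \<rho>"
    let ?u = "y - x"
    have xK: "x \<in> ?K" "y \<in> ?K" using x y sub by auto
    obtain l where "reach (cinv \<phi> x) (cinv \<phi> y) l" "l \<le> sqrt (G \<phi> x ?u ?u) + C / k * (norm ?u)\<^sup>2"
      using segment_upper[OF \<phi> _ R(2) lm xK] by auto
    then have "d (cinv \<phi> x) (cinv \<phi> y) \<le> sqrt (G \<phi> x ?u ?u) + C / k * (norm ?u)\<^sup>2"
      using d_le by (meson order_trans)
    also have "C / k * (norm ?u)\<^sup>2 \<le> C' * (norm ?u)\<^sup>2" using C' by (intro mult_right_mono) auto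
    finally show "d (cinv \<phi> x) (cinv \<phi> y) \<le> sqrt (G \<phi> x ?u ?u) + C' * (norm ?u)\<^sup>2" by simp
    show "k * norm ?u \<le> d (cinv \<phi> x) (cinv \<phi> y)"
    proof (cases "x = y")
      case False
      have "cball x (norm ?u) \<subseteq> ?K" using small[OF x y] by (meson subset_cball order_trans)
      moreover have "\<not> (cinv \<phi> y \<in> cdom \<phi> \<and> cmap \<phi> (cinv \<phi> y) \<in> ball x (norm ?u))"
        using chart(6)[OF \<phi>, of y] xK R by (auto simp: dist_norm norm_minus_commute)
      ultimately show ?thesis using False
        by (intro d_ge exit_bound[OF \<phi> _ R(2) lm, of x]) auto
    qed (simp add: d_nonneg)
    show "sqrt (G \<phi> x ?u ?u) \<le> d (cinv \<phi> x) (cinv \<phi> y) + C' * (norm ?u)\<^sup>2"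
    proof (cases "x = y")
      case True
      then show ?thesis using bilinear_lzero[OF bilin[OF xK(1)]] by (simp add: d_nonneg)
    next
      case False
      let ?r = "\<Lambda> * norm ?u"
      have r: "0 < ?r" using False L by simp
      have nC: "nrm x ?u \<le> sqrt C * norm ?u"
      proof -
        have "G \<phi> x ?u ?u \<le> C * norm ?u * norm ?u" using g_bound[OF xK(1), of ?u ?u] by simp
        then have "nrm x ?u \<le> sqrt (C * (norm ?u)\<^sup>2)"
          unfolding nrm_def by (intro real_sqrt_le_mono) (simp add: power2_eq_square)
        then show ?thesis by (simp add: real_sqrt_mult)
      qed
      have "nrm x ?u - C' * (norm ?u)\<^sup>2 \<le> l" if l: "reach (cinv \<phi> x) (cinv \<phi> y) l" for l
      proof (cases "nrm x ?u \<le> l")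
        case True
        then show ?thesis using C' C_pos by (simp add: add_increasing2 diff_le_eq)
      next
        case l_less: False
        have "sqrt C * norm ?u \<le> k * ?r"
          using k_pos by (simp add: \<Lambda>_def algebra_simps)
        then have "l < k * ?r" using nC l_less by simp
        then have "nrm x ?u \<le> (1 + C / k\<^sup>2 * ?r) * l"
          using lower_bound[OF \<phi> small(1)[OF x y] R(2) lm r xK(2) l] by (simp add: nrm_def)
        also have "\<dots> = l + C / k\<^sup>2 * ?r * l" by (simp add: algebra_simps)
        also have "C / k\<^sup>2 * ?r * l \<le> C / k\<^sup>2 * ?r * (sqrt C * norm ?u)"
          using l_less nC C_pos r by (intro mult_left_mono) auto
        also have "\<dots> = (C / k\<^sup>2 * \<Lambda> * sqrt C) * (norm ?u)\<^sup>2" by (simp add: power2_eq_square)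
        also have "\<dots> \<le> C' * (norm ?u)\<^sup>2" using C' by (intro mult_right_mono) auto
        finally show ?thesis by simp
      qed
      then have "nrm x ?u - C' * (norm ?u)\<^sup>2 \<le> d (cinv \<phi> x) (cinv \<phi> y)" by (rule d_ge)
      then show ?thesis by (simp add: nrm_def)
    qed
  next
    fix r q assume r: "0 < r" "r \<le> \<rho>" and q: "\<not> (q \<in> cdom \<phi> \<and> cmap \<phi> q \<in> ball x0 r)"
    have "cball x0 r \<subseteq> ?K" using r rhoR by auto
    then have "k * r \<le> l" if "reach p q l" for l
      using exit_bound[OF \<phi> _ R(2) lm r(1) _ q, of l] that chart(5)[OF \<phi> p] by (simp add: x0_def)
    then show "k * r \<le> d p q" by (rule d_ge)
  qed
qed

text \<open>The filter \<open>nhds p\<close> includes p itself, so this also yields d p p =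
  0.\<close>

lemma d_nhds: "(d p \<longlongrightarrow> 0) (nhds p)"
proof -
  obtain \<phi> where \<phi>: "\<phi> \<in> A" "p \<in> cdom \<phi>" using chart_at by blast
  obtain \<rho> k C where \<rho>: "0 < \<rho>" "cball (cmap \<phi> p) \<rho> \<subseteq> cmap \<phi> ` cdom \<phi>"
    "local_metric (G \<phi>) (dG \<phi>) (cball (cmap \<phi> p) \<rho>) k C"
    "\<And>x y. x \<in> cball (cmap \<phi> p) \<rho> \<Longrightarrow> y \<in> cball (cmap \<phi> p) \<rho> \<Longrightarrow>
      d (cinv \<phi> x) (cinv \<phi> y) \<le> sqrt (G \<phi> x (y - x) (y - x)) + C * (norm (y - x))\<^sup>2"
    using chart_comparison[OF \<phi>] by metis
  interpret local_metric "G \<phi>" "dG \<phi>" "cball (cmap \<phi> p) \<rho>" k C by (rule \<rho>(3))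
  let ?x = "cmap \<phi> p" and ?V = "cdom \<phi> \<inter> cmap \<phi> -` ball (cmap \<phi> p) \<rho>"
  have xS: "?x \<in> cball ?x \<rho>" using \<rho> by simp
  have V: "open ?V" "p \<in> ?V" using open_chart_preimage[OF \<phi>(1)] \<phi> \<rho> by auto
  have "(cmap \<phi> \<longlongrightarrow> ?x) (nhds p)"
    using chart(3,1)[OF \<phi>(1)] \<phi>(2) by (metis at_within_open continuous_on_def filterlim_at_within_closure_implies_filterlim
      isCont_def continuous_on_eq_continuous_at tendsto_at_iff_tendsto_nhds)
  then have "((\<lambda>q. sqrt C * norm (cmap \<phi> q - ?x) + C * (norm (cmap \<phi> q - ?x))\<^sup>2)
      \<longlongrightarrow> sqrt C * norm (?x - ?x) + C * (norm (?x - ?x))\<^sup>2) (nhds p)"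
    by (intro tendsto_intros)
  moreover have "\<forall>\<^sub>F q in nhds p. d p q \<le> sqrt C * norm (cmap \<phi> q - ?x) + C * (norm (cmap \<phi> q - ?x))\<^sup>2"
    using V
  proof (rule eventually_nhds[THEN iffD2, OF exI, OF conjI, OF _ conjI], intro ballI)
    fix q assume q: "q \<in> ?V"
    let ?u = "cmap \<phi> q - ?x"
    have "G \<phi> ?x ?u ?u \<le> C * norm ?u * norm ?u" using g_bound[OF xS, of ?u ?u] by simp
    then have "sqrt (G \<phi> ?x ?u ?u) \<le> sqrt (C * (norm ?u)\<^sup>2)"
      by (intro real_sqrt_le_mono) (simp add: power2_eq_square)
    also have "\<dots> = sqrt C * norm ?u" by (simp add: real_sqrt_mult)
    finally have "sqrt (G \<phi> ?x ?u ?u) \<le> sqrt C * norm ?u" .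
    moreover have "d p q \<le> sqrt (G \<phi> ?x ?u ?u) + C * (norm ?u)\<^sup>2"
      using \<rho>(4)[OF xS, of "cmap \<phi> q"] q chart(5)[OF \<phi>(1)] \<phi>(2) by auto
    ultimately show "d p q \<le> sqrt C * norm ?u + C * (norm ?u)\<^sup>2" by simp
  qed
  ultimately show ?thesis
    by (intro Lim_null_comparison[where f = "d p"]) (auto simp: d_nonneg)
qed

lemma d_self [simp]: "d p p = 0"
proof -
  have "d p p < \<epsilon>" if "0 < \<epsilon>" for \<epsilon>
    using order_tendstoD(2)[OF d_nhds that] by (rule eventually_nhds_x_imp_x)
  from this[of "d p p"] show ?thesis using d_nonneg[of p p] by force
qed

lemma d_diff_le: "\<bar>d p q - d p q'\<bar> \<le> d q q'"
  using d_triangle[of p q' q] d_triangle[of p q q'] d_sym[of q q'] by linarith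

lemma continuous_d: "continuous_on UNIV (d p)"
  unfolding continuous_on_def
proof
  fix q
  have "((\<lambda>q'. d p q' - d p q) \<longlongrightarrow> 0) (nhds q)"
    by (rule Lim_null_comparison[OF _ d_nhds[of q]])
      (use d_diff_le[of p q] in \<open>auto simp: abs_minus_commute intro!: always_eventually\<close>)
  then have "(d p \<longlongrightarrow> d p q) (nhds q)" by (rule LIM_zero_cancel)
  then show "(d p \<longlongrightarrow> d p q) (at q within UNIV)"
    by (rule filterlim_mono[OF _ order_refl]) (simp add: at_within_def)
qed

text \<open>Converse of \<open>d_nhds\<close>: leaving a coordinate ball of radius r costs distance
  k * r. Together they say that d induces the given topology.\<close>

lemma d_ball_subset:
  assumes "open U" "p \<in> U"
  obtains \<epsilon> where "0 < \<epsilon>" "\<And>q. d p q < \<epsilon> \<Longrightarrow> q \<in> U"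
proof -
  obtain \<phi> where \<phi>: "\<phi> \<in> A" "p \<in> cdom \<phi>" using chart_at by blast
  obtain \<rho> k C where \<rho>: "0 < \<rho>" "local_metric (G \<phi>) (dG \<phi>) (cball (cmap \<phi> p) \<rho>) k C"
    "\<And>r q. 0 < r \<Longrightarrow> r \<le> \<rho> \<Longrightarrow> \<not> (q \<in> cdom \<phi> \<and> cmap \<phi> q \<in> ball (cmap \<phi> p) r) \<Longrightarrow> k * r \<le> d p q"
    using chart_comparison[OF \<phi>] by metis
  have k: "0 < k" using \<rho>(2) by (rule local_metric.k_pos)
  have "open (cmap \<phi> ` (U \<inter> cdom \<phi>))"
    using assms chart(1)[OF \<phi>(1)] by (intro open_chart_image \<phi>) auto
  then obtain \<epsilon> where e: "0 < \<epsilon>" "ball (cmap \<phi> p) \<epsilon> \<subseteq> cmap \<phi> ` (U \<inter> cdom \<phi>)"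
    using assms \<phi> open_contains_ball by blast
  define r where "r = min \<epsilon> \<rho>"
  have r: "0 < r" "r \<le> \<rho>" "r \<le> \<epsilon>" using e \<rho> by (auto simp: r_def)
  have "q \<in> U" if "d p q < k * r" for q
  proof -
    have q: "q \<in> cdom \<phi>" "cmap \<phi> q \<in> ball (cmap \<phi> p) r" using \<rho>(3)[OF r(1,2), of q] that by force+
    then have "cmap \<phi> q \<in> ball (cmap \<phi> p) \<epsilon>" using r by auto
    then have "cmap \<phi> q \<in> cmap \<phi> ` (U \<inter> cdom \<phi>)" using e(2) by blast
    then obtain q' where "q' \<in> U" "q' \<in> cdom \<phi>" "cmap \<phi> q = cmap \<phi> q'" by auto
    then show ?thesis using chart(5)[OF \<phi>(1)] q by metis
  qed
  then show ?thesis using that[of "k * r"] k r by simp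
qed

lemma d_eq_0: "d p q = 0 \<longleftrightarrow> p = q"
proof
  assume d0: "d p q = 0"
  show "p = q"
  proof (rule ccontr)
    assume "p \<noteq> q"
    then obtain U where U: "open U" "p \<in> U" "q \<notin> U" using t1_space by blast
    show False by (rule d_ball_subset[OF U(1,2)]) (use d0 U(3) in force)
  qed
qed simp

lemma Metric_space_d: "Metric_space UNIV d"
  by unfold_locales (auto simp: d_nonneg d_eq_0 d_sym d_triangle)

text \<open>A point \<open>z\<close> of a small compact sphere around \<open>p\<close> that is closest to \<open>y\<close> lies between
  \<open>p\<close> and \<open>y\<close>.\<close>

lemma sphere_point:
  obtains \<delta>0 where "0 < \<delta>0"
    "\<And>\<delta> y. 0 < \<delta> \<Longrightarrow> \<delta> \<le> \<delta>0 \<Longrightarrow> \<delta> \<le> d p y \<Longrightarrow> \<exists>z. d p z = \<delta> \<and> d z y = d p y - \<delta>"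
proof -
  obtain \<phi> where \<phi>: "\<phi> \<in> A" "p \<in> cdom \<phi>" using chart_at by blast
  obtain \<rho> k C where \<rho>: "0 < \<rho>" "cball (cmap \<phi> p) \<rho> \<subseteq> cmap \<phi> ` cdom \<phi>"
    "local_metric (G \<phi>) (dG \<phi>) (cball (cmap \<phi> p) \<rho>) k C"
    "\<And>r q. 0 < r \<Longrightarrow> r \<le> \<rho> \<Longrightarrow> \<not> (q \<in> cdom \<phi> \<and> cmap \<phi> q \<in> ball (cmap \<phi> p) r) \<Longrightarrow> k * r \<le> d p q"
    using chart_comparison[OF \<phi>] by metis
  have k: "0 < k" using \<rho>(3) by (rule local_metric.k_pos)
  define K where "K = cinv \<phi> ` cball (cmap \<phi> p) \<rho>"
  have cK: "compact K" unfolding K_def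
    using \<rho>(2) by (intro compact_continuous_image continuous_on_subset[OF chart(4)[OF \<phi>(1)]]) auto
  have inK: "z \<in> K" if "d p z < k * \<rho>" for z
  proof -
    have "z \<in> cdom \<phi>" "cmap \<phi> z \<in> ball (cmap \<phi> p) \<rho>" using \<rho>(4)[OF \<rho>(1), of z] that by force+
    then show ?thesis unfolding K_def using chart(5)[OF \<phi>(1), of z]
      by (intro image_eqI[of _ _ "cmap \<phi> z"]) auto
  qed
  have "\<exists>z. d p z = \<delta> \<and> d z y = d p y - \<delta>" if \<delta>: "0 < \<delta>" "\<delta> \<le> k * \<rho> / 2" "\<delta> \<le> d p y" for \<delta> y
  proof -
    define Sph where "Sph = K \<inter> (d p -` {\<delta>})"
    have "closed (d p -` {\<delta>})" using continuous_d by (intro closed_vimage) auto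
    then have Sph: "compact Sph" unfolding Sph_def by (rule compact_Int_closed[OF cK])
    have inSph: "z \<in> Sph" if "d p z = \<delta>" for z
      using inK[of z] that \<delta> k \<rho>(1) by (simp add: Sph_def)
    \<comment> \<open>Every curve to y meets the sphere by the intermediate value theorem and splits
      there into parts of length at least \<delta> and at least the distance from the sphere to
      y.\<close>
    have cross: "\<exists>z l'. z \<in> Sph \<and> d z y \<le> l' \<and> \<delta> + l' \<le> l" if l: "reach p y l" for l
    proof -
      obtain c where c: "pw_curve A G c 0 1 l" "c 0 = p" "c 1 = y" using l unfolding reach_def by blast
      have "continuous_on {0..1} (\<lambda>t. d p (c t))"
        using continuous_on_compose2[OF continuous_d pw_curve_continuous[OF c(1)]] by simp
      then obtain t where t: "0 \<le> t" "t \<le> 1" "d p (c t) = \<delta>"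
        using IVT'[of "\<lambda>t. d p (c t)" 0 \<delta> 1] c \<delta> by auto
      show ?thesis
      \<comment> \<open>A crossing at the very end leaves no second piece, since pieces are
        nondegenerate; then y itself is the point, with remaining length 0.\<close>
      proof (cases "t = 1")
        case True
        then have "d p y = \<delta>" using t c by simp
        moreover have "d p y \<le> l" by (rule d_le[OF l])
        ultimately show ?thesis using inSph by (intro exI[of _ y] exI[of _ 0]) auto
      next
        case False
        have "t \<noteq> 0" using t c \<delta> by auto
        then obtain l1 l2 where s: "pw_curve A G c 0 t l1" "pw_curve A G c t 1 l2" "l = l1 + l2"
          using pw_curve_split[OF c(1), of t] t False by auto
        have "d p (c t) \<le> l1" "d (c t) y \<le> l2"
          using reachI[OF s(1)] reachI[OF s(2)] c d_le by auto
        then show ?thesis using t s inSph by (intro exI[of _ "c t"] exI[of _ l2]) auto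
      qed
    qed
    obtain l where "reach p y l" using reach_exists by blast
    then have "Sph \<noteq> {}" using cross by blast
    moreover have "continuous_on Sph (\<lambda>z. d z y)"
      using continuous_on_subset[OF continuous_d[of y]] by (simp add: d_sym[of _ y])
    ultimately obtain z where z: "z \<in> Sph" "\<And>z'. z' \<in> Sph \<Longrightarrow> d z y \<le> d z' y"
      using continuous_attains_inf[OF Sph, of "\<lambda>z. d z y"] by blast
    have "\<delta> + d z y \<le> d p y"
    proof (rule d_ge)
      fix l assume "reach p y l"
      then obtain z' l' where "z' \<in> Sph" "d z' y \<le> l'" "\<delta> + l' \<le> l" using cross by blast
      then show "\<delta> + d z y \<le> l" using z(2)[of z'] by linarith
    qed
    moreover have "d p z = \<delta>" using z(1) by (simp add: Sph_def)
    ultimately show ?thesis using d_triangle[of p y z] by (intro exI[of _ z]) auto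
  qed
  then show ?thesis using that[of "k * \<rho> / 2"] k \<rho>(1) by auto
qed

end

section \<open>Existence of geodesics\<close>

locale riemannian_complete = riemannian_connected +
  assumes complete: "Metric_space.mcomplete UNIV (riemannian_dist A G)"
begin

lemma d_complete:
  assumes "\<And>\<epsilon>. 0 < \<epsilon> \<Longrightarrow> \<exists>N. \<forall>m\<ge>N. \<forall>n\<ge>N. d (\<sigma> m) (\<sigma> n) < \<epsilon>"
  obtains z where "(\<lambda>n. d (\<sigma> n) z) \<longlonglongrightarrow> 0"
proof -
  interpret Metric_space UNIV d by (rule Metric_space_d)
  have dd: "d = riemannian_dist A G" by (intro ext) (simp add: d_def)
  have "MCauchy \<sigma>" using assms by (auto simp: MCauchy_def)
  then obtain z where "limitin mtopology \<sigma> z sequentially"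
    using complete unfolding dd[symmetric] mcomplete_def by blast
  then have "(\<lambda>n. d (\<sigma> n) z) \<longlonglongrightarrow> 0"
    unfolding limitin_metric by (auto simp: tendsto_iff dist_real_def d_nonneg)
  then show ?thesis by (rule that)
qed

text \<open>On a member of \<open>\<C>\<close> the map \<open>d p\<close> is an isometry into
  [0, r]; for a maximal member its image T turns out to be all of [0, r], and c is the inverse,
  rescaled. Completeness is needed for T to be closed.\<close>

lemma metric_geodesic:
  obtains c where "c 0 = p" "c 1 = q"
    "\<forall>s\<in>{0..1}. \<forall>t\<in>{0..1}. d (c s) (c t) = d p q * \<bar>t - s\<bar>"
proof -
  define r where "r = d p q"
  have r0: "0 \<le> r" by (simp add: r_def d_nonneg)
  define \<C> where "\<C> = {S. p \<in> S \<and> q \<in> S \<and> (\<forall>x\<in>S. d p x \<le> r) \<and> (\<forall>x\<in>S. \<forall>y\<in>S. d x y = \<bar>d p x - d p y\<bar>)}"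
  have "{p, q} \<in> \<C>" by (auto simp: \<C>_def r_def d_nonneg d_sym[of q p])
  then have ne: "\<C> \<noteq> {}" by blast
  have "\<exists>M\<in>\<C>. \<forall>X\<in>\<C>. M \<subseteq> X \<longrightarrow> X = M"
  proof (rule subset_Zorn_nonempty[OF ne])
    fix Ch assume Ch: "Ch \<noteq> {}" "subset.chain \<C> Ch"
    then have sub: "Ch \<subseteq> \<C>" and tot: "\<And>S T. S \<in> Ch \<Longrightarrow> T \<in> Ch \<Longrightarrow> S \<subseteq> T \<or> T \<subseteq> S"
      by (auto simp: subset.chain_def)
    have "d x y = \<bar>d p x - d p y\<bar>" if xy: "x \<in> S" "S \<in> Ch" "y \<in> T" "T \<in> Ch" for x y S T
    proof -
      obtain W where "W \<in> Ch" "x \<in> W" "y \<in> W" using tot[OF xy(2,4)] xy by blast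
      then show ?thesis using sub by (auto simp: \<C>_def)
    qed
    moreover have "p \<in> S \<and> q \<in> S \<and> (\<forall>x\<in>S. d p x \<le> r)" if "S \<in> Ch" for S
      using sub that by (auto simp: \<C>_def)
    moreover obtain S where "S \<in> Ch" using Ch(1) by blast
    ultimately show "\<Union> Ch \<in> \<C>" unfolding \<C>_def mem_Collect_eq
      by (intro conjI ballI) (blast+)
  qed
  then obtain M where M: "M \<in> \<C>" "\<And>X. X \<in> \<C> \<Longrightarrow> M \<subseteq> X \<Longrightarrow> X = M" by blast
  have pq: "p \<in> M" "q \<in> M" and Mr: "\<And>x. x \<in> M \<Longrightarrow> d p x \<le> r"
    and Md: "\<And>x y. x \<in> M \<Longrightarrow> y \<in> M \<Longrightarrow> d x y = \<bar>d p x - d p y\<bar>"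
    using M(1) unfolding \<C>_def by blast+
  \<comment> \<open>Maximality as a criterion: a point whose distances to all of M are additive
    already belongs to M.\<close>
  have add: "z \<in> M" if z: "d p z \<le> r" "\<And>x. x \<in> M \<Longrightarrow> d x z = \<bar>d p x - d p z\<bar>" for z
  proof -
    have "d x y = \<bar>d p x - d p y\<bar>" if "x \<in> insert z M" "y \<in> insert z M" for x y
      using that
    proof (elim insertE)
      assume "x = z" "y \<in> M"
      then show ?thesis using z(2)[of y] by (simp only: d_sym[of z y] abs_minus_commute)
    qed (use z(2)[of x] Md[of x y] in \<open>simp_all only:, simp\<close>)
    then have "insert z M \<in> \<C>" unfolding \<C>_def mem_Collect_eq
      using pq Mr z(1) by (intro conjI ballI) blast+
    then show ?thesis using M(2)[of "insert z M"] by blast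
  qed
  define T where "T = d p ` M"
  have T: "T \<subseteq> {0..r}" "0 \<in> T" "r \<in> T"
    using Mr d_nonneg pq image_eqI[of 0 "d p" p M] image_eqI[of r "d p" q M] by (auto simp: T_def r_def)
  have "closed T"
    unfolding closed_sequential_limits
  proof (intro allI impI, elim conjE)
    fix x t assume x: "\<forall>n::nat. x n \<in> T" and lim: "x \<longlonglongrightarrow> t"
    then obtain \<sigma> where \<sigma>: "\<And>n. \<sigma> n \<in> M" "\<And>n. x n = d p (\<sigma> n)" unfolding T_def image_iff by metis
    have "\<exists>N. \<forall>m\<ge>N. \<forall>n\<ge>N. d (\<sigma> m) (\<sigma> n) < \<epsilon>" if "0 < \<epsilon>" for \<epsilon>
      using LIMSEQ_imp_Cauchy[OF lim] that Md[OF \<sigma>(1) \<sigma>(1)] \<sigma>(2)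
      by (auto simp: Cauchy_def dist_real_def)
    then obtain z where z: "(\<lambda>n. d (\<sigma> n) z) \<longlonglongrightarrow> 0" using d_complete[of \<sigma>] by blast
    have dz: "(\<lambda>n. d u (\<sigma> n)) \<longlonglongrightarrow> d u z" for u
    proof -
      have "(\<lambda>n. d u (\<sigma> n) - d u z) \<longlonglongrightarrow> 0"
        by (rule Lim_null_comparison[OF _ z]) (use d_diff_le in auto)
      then show ?thesis by (simp add: LIM_zero_iff)
    qed
    have "x = (\<lambda>n. d p (\<sigma> n))" using \<sigma>(2) by auto
    then have pz: "d p z = t" using LIMSEQ_unique[OF dz[of p]] lim by simp
    have "z \<in> M"
    proof (rule add)
      show "d p z \<le> r" by (rule LIMSEQ_le_const2[OF dz]) (use Mr \<sigma> in auto)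
      fix u assume u: "u \<in> M"
      have "(\<lambda>n. \<bar>d p u - d p (\<sigma> n)\<bar>) \<longlonglongrightarrow> \<bar>d p u - d p z\<bar>" by (intro tendsto_intros dz)
      moreover have "(\<lambda>n. \<bar>d p u - d p (\<sigma> n)\<bar>) = (\<lambda>n. d u (\<sigma> n))" by (intro ext Md[symmetric] u \<sigma>(1))
      ultimately show "d u z = \<bar>d p u - d p z\<bar>" using LIMSEQ_unique[OF dz[of u]] by simp
    qed
    then show "t \<in> T" using pz by (auto simp: T_def)
  qed
  have "{0..r} \<subseteq> T"
  proof
    fix t assume t: "t \<in> {0..r}"
    show "t \<in> T"
    proof (rule ccontr)
      assume nt: "t \<notin> T"
      \<comment> \<open>The ends of the gap of T around t, both attained because T is
        closed.\<close>
      define a where "a = Sup (T \<inter> {..t})"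
      define b where "b = Inf (T \<inter> {t..})"
      have "closed (T \<inter> {..t})" "closed (T \<inter> {t..})" using \<open>closed T\<close> by auto
      moreover have bdd: "bdd_above (T \<inter> {..t})" "bdd_below (T \<inter> {t..})" by auto
      moreover have "0 \<in> T \<inter> {..t}" "r \<in> T \<inter> {t..}" using T t by auto
      ultimately have ab: "a \<in> T \<inter> {..t}" "b \<in> T \<inter> {t..}" unfolding a_def b_def
        by (metis closed_contains_Sup empty_iff, metis closed_contains_Inf empty_iff)
      have gap: "u \<le> a \<or> b \<le> u" if "u \<in> T" for u
        using cSup_upper[of u "T \<inter> {..t}"] cInf_lower[of u "T \<inter> {t..}"] bdd that
        by (cases "u \<le> t") (auto simp: a_def b_def)
      have less: "a < b" using ab nt by (metis IntE atLeast_iff atMost_iff order.strict_iff_order order.trans order_antisym_conv)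
      obtain x y where x: "x \<in> M" "d p x = a" and y: "y \<in> M" "d p y = b" using ab by (auto simp: T_def)
      obtain \<delta>0 where \<delta>0: "0 < \<delta>0"
        "\<And>\<delta> y. 0 < \<delta> \<Longrightarrow> \<delta> \<le> \<delta>0 \<Longrightarrow> \<delta> \<le> d x y \<Longrightarrow> \<exists>z. d x z = \<delta> \<and> d z y = d x y - \<delta>"
        using sphere_point[of x] by metis
      \<comment> \<open>At most half the gap, so that a + \<delta> falls strictly inside it.\<close>
      define \<delta> where "\<delta> = min \<delta>0 ((b - a) / 2)"
      have \<delta>: "0 < \<delta>" "\<delta> \<le> \<delta>0" "\<delta> < b - a" using \<delta>0 less by (auto simp: \<delta>_def min_def)
      have xy: "d x y = b - a" using Md[OF x(1) y(1)] x y less by simp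
      then obtain z where z: "d x z = \<delta>" "d z y = b - a - \<delta>" using \<delta>0(2)[of \<delta> y] \<delta> by auto
      have pz: "d p z = a + \<delta>"
        using d_triangle[of p z x] d_triangle[of p y z] x y z by simp
      have "z \<in> M"
      proof (rule add)
        show "d p z \<le> r" using pz \<delta> y Mr[OF y(1)] by simp
        \<comment> \<open>Every u in M lies on one side of the gap: to the left the triangle
          inequality through x is sharp, to the right the one through y.\<close>
        fix u assume u: "u \<in> M"
        have t: "d u z \<le> d u x + \<delta>" "d u z \<le> d u y + (b - a - \<delta>)"
          using d_triangle[of u z x] d_triangle[of u z y] z d_sym[of z y] by auto
        have low: "\<bar>d p u - d p z\<bar> \<le> d u z" by (rule d_diff_le)
        have "d u x = \<bar>d p u - a\<bar>" "d u y = \<bar>d p u - b\<bar>" using Md[OF u x(1)] Md[OF u y(1)] x y by auto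
        moreover have "d p u \<le> a \<or> b \<le> d p u" using gap u by (auto simp: T_def)
        ultimately show "d u z = \<bar>d p u - d p z\<bar>" using t low pz \<delta> by linarith
      qed
      then have "a + \<delta> \<in> T" using pz by (auto simp: T_def intro: image_eqI[of _ _ z])
      then show False using gap[of "a + \<delta>"] \<delta> by auto
    qed
  qed
  then have "\<exists>x\<in>M. d p x = r * t" if "t \<in> {0..1}" for t
  proof -
    have "r * t \<in> {0..r}" using that r0 by (auto simp: mult_left_le)
    then show ?thesis using \<open>{0..r} \<subseteq> T\<close> by (force simp: T_def)
  qed
  then obtain c where c: "\<And>t. t \<in> {0..1} \<Longrightarrow> c t \<in> M" "\<And>t. t \<in> {0..1} \<Longrightarrow> d p (c t) = r * t" by metis
  show ?thesis
  proof (rule that[of c], goal_cases)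
    case 1
    then show ?case using c(2)[of 0] d_eq_0[of p "c 0"] by simp
  next
    case 2
    then show ?case using c(2)[of 1] Md[OF c(1)[of 1] pq(2)] d_eq_0[of "c 1" q] by (simp add: r_def)
  next
    case 3
    have "d (c s) (c t) = r * \<bar>t - s\<bar>" if st: "s \<in> {0..1}" "t \<in> {0..1}" for s t
    proof -
      have "d (c s) (c t) = \<bar>r * s - r * t\<bar>" using Md[OF c(1)[OF st(1)] c(1)[OF st(2)]] c(2) st by simp
      also have "\<dots> = r * \<bar>t - s\<bar>"
        using r0 by (simp add: right_diff_distrib[symmetric] abs_mult abs_minus_commute)
      finally show ?thesis .
    qed
    then show ?case by (simp add: r_def)
  qed
qed

text \<open>A short piece of c around t0 satisfies \<open>minimizer_sub\<close>;
  \<open>t0 < 1\<close> leaves the room on the right that forward quotients need. The first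
  derivative is asserted near t0, not just at t0, so that v can be identified there with the
  derivative of the curve.\<close>

lemma local_geodesic:
  assumes L: "0 < L"
    and geo: "\<forall>s\<in>{0..1}. \<forall>t\<in>{0..1}. d (c s) (c t) = L * \<bar>t - s\<bar>"
    and t0: "0 \<le> t0" "t0 < 1" and \<phi>: "\<phi> \<in> A" "c t0 \<in> cdom \<phi>"
  shows "\<exists>\<eta> v z. 0 < \<eta> \<and>
    (\<forall>t\<in>{0..1}. \<bar>t - t0\<bar> < \<eta> \<longrightarrow> (cmap \<phi> \<circ> c has_vector_derivative v t) (at t within {0..1})) \<and>
    (v has_vector_derivative - z) (at t0 within {0..1}) \<and>
    (\<forall>w. G \<phi> (cmap \<phi> (c t0)) z w = dG \<phi> (cmap \<phi> (c t0)) (v t0) (v t0) w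
      - dG \<phi> (cmap \<phi> (c t0)) w (v t0) (v t0) / 2)"
proof -
  let ?x0 = "cmap \<phi> (c t0)"
  obtain \<rho> k C where \<rho>: "0 < \<rho>" "cball ?x0 \<rho> \<subseteq> cmap \<phi> ` cdom \<phi>"
    "local_metric (G \<phi>) (dG \<phi>) (cball ?x0 \<rho>) k C"
    "\<And>x y. x \<in> cball ?x0 \<rho> \<Longrightarrow> y \<in> cball ?x0 \<rho> \<Longrightarrow>
      d (cinv \<phi> x) (cinv \<phi> y) \<le> sqrt (G \<phi> x (y - x) (y - x)) + C * (norm (y - x))\<^sup>2"
    "\<And>x y. x \<in> cball ?x0 \<rho> \<Longrightarrow> y \<in> cball ?x0 \<rho> \<Longrightarrow>
      sqrt (G \<phi> x (y - x) (y - x)) \<le> d (cinv \<phi> x) (cinv \<phi> y) + C * (norm (y - x))\<^sup>2"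
    "\<And>x y. x \<in> cball ?x0 \<rho> \<Longrightarrow> y \<in> cball ?x0 \<rho> \<Longrightarrow>
      k * norm (y - x) \<le> d (cinv \<phi> x) (cinv \<phi> y)"
    using chart_comparison[OF \<phi>] by metis
  interpret lm: local_metric "G \<phi>" "dG \<phi>" "cball ?x0 \<rho>" k C by (rule \<rho>(3))
  \<comment> \<open>Half of the radius confines the curve; the other half is left for its
    translates.\<close>
  let ?U = "cdom \<phi> \<inter> cmap \<phi> -` ball ?x0 (\<rho> / 2)"
  have "open ?U" "c t0 \<in> ?U" using open_chart_preimage[OF \<phi>(1) open_ball] \<phi> \<rho>(1) by auto
  then obtain \<epsilon> where \<epsilon>: "0 < \<epsilon>" "\<And>q. d (c t0) q < \<epsilon> \<Longrightarrow> q \<in> ?U"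
    using d_ball_subset[of ?U "c t0"] by metis
  \<comment> \<open>The first bound keeps c in \<open>?U\<close>, since d grows at rate L; the
    second gives b \<le> a + 1.\<close>
  define h where "h = min (\<epsilon> / (2 * L)) (1 / 2)"
  have h: "0 < h" "h \<le> 1 / 2" "L * h < \<epsilon>"
  proof -
    show "0 < h" "h \<le> 1 / 2" using \<epsilon> L by (auto simp: h_def)
    have "L * h \<le> L * (\<epsilon> / (2 * L))" using L by (intro mult_left_mono) (auto simp: h_def)
    also have "\<dots> < \<epsilon>" using L \<epsilon> by simp
    finally show "L * h < \<epsilon>" .
  qed
  define a where "a = max 0 (t0 - h)"
  define b where "b = min 1 (t0 + h)"
  define e where "e = (t0 + b) / 2"
  have ab: "a \<le> t0" "t0 < b" "0 \<le> a" "b \<le> 1" "a < b" "b \<le> a + 1" "t0 < e" "e < b" "a < e" "e \<le> 1"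
    using t0 h by (auto simp: a_def b_def e_def min_def max_def)
  have inU: "c t \<in> cdom \<phi>" "norm (cmap \<phi> (c t) - ?x0) \<le> \<rho> / 2" if t: "t \<in> {a..b}" for t
  proof -
    have "\<bar>t - t0\<bar> \<le> h" using t by (auto simp: a_def b_def)
    then have "L * \<bar>t - t0\<bar> \<le> L * h" using L by (intro mult_left_mono) auto
    then have "d (c t0) (c t) < \<epsilon>" using geo[rule_format, of t0 t] t ab t0 h by auto
    from \<epsilon>(2)[OF this] show "c t \<in> cdom \<phi>" "norm (cmap \<phi> (c t) - ?x0) \<le> \<rho> / 2"
      by (auto simp: dist_norm norm_minus_commute)
  qed
  let ?c = "cmap \<phi> \<circ> c"
  let ?\<delta> = "\<lambda>x y. d (cinv \<phi> x) (cinv \<phi> y)"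
  have inS: "?c t \<in> cball ?x0 \<rho>" if "t \<in> {a..b}" for t
    using inU[OF that] \<rho>(1) by (simp add: dist_norm norm_minus_commute)
  have cinv_c: "cinv \<phi> (?c t) = c t" if "t \<in> {a..b}" for t
    using inU(1)[OF that] chart(5)[OF \<phi>(1)] by simp
  interpret m: minimizer_sub "G \<phi>" "dG \<phi>" "cball ?x0 \<rho>" k C "?\<delta>" "?c" a b L "\<rho> / 2" e
  proof (intro minimizer_sub.intro minimizer.intro minimizer_axioms.intro minimizer_sub_axioms.intro)
    show "local_metric (G \<phi>) (dG \<phi>) (cball ?x0 \<rho>) k C" by (rule \<rho>(3))
    show "a < b" "b \<le> a + 1" "0 < L" "0 < \<rho> / 2" "a < e" "e < b" using ab L \<rho>(1) by auto
    show "?c t + w \<in> cball ?x0 \<rho>" if "t \<in> {a..b}" "norm w \<le> \<rho> / 2" for t w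
    proof -
      have "norm ((?c t - ?x0) + w) \<le> \<rho> / 2 + \<rho> / 2"
        using inU(2)[OF that(1)] that(2) by (intro norm_triangle_le add_mono) auto
      then show ?thesis by (simp add: dist_norm norm_minus_commute algebra_simps)
    qed
    show "?\<delta> x z \<le> ?\<delta> x y + ?\<delta> y z" "?\<delta> x x = 0" for x y z by (auto simp: d_triangle)
    show "?\<delta> x y \<le> sqrt (G \<phi> x (y - x) (y - x)) + C * (norm (y - x))\<^sup>2"
      if "x \<in> cball ?x0 \<rho>" "y \<in> cball ?x0 \<rho>" for x y by (rule \<rho>(4)[OF that])
    fix s t assume st: "s \<in> {a..b}" "t \<in> {a..b}"
    show "sqrt (G \<phi> (?c s) (?c t - ?c s) (?c t - ?c s))
      \<le> ?\<delta> (?c s) (?c t) + C * (norm (?c t - ?c s))\<^sup>2"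
      by (intro \<rho>(5) inS st)
    show "k * norm (?c t - ?c s) \<le> ?\<delta> (?c s) (?c t)"
      by (intro \<rho>(6) inS st)
  next
    fix s t assume st: "a \<le> s" "s \<le> t" "t \<le> b"
    then have "d (c s) (c t) = L * (t - s)" using geo[rule_format, of s t] ab by auto
    then show "?\<delta> (?c s) (?c t) = L * (t - s)" using st cinv_c by simp
  qed
  \<comment> \<open>Within this distance of t0 the intervals [0, 1] and [a, e] have the same points.
    At t0 = 0 both start at 0, so only the right end restricts it.\<close>
  define \<eta>' where "\<eta>' = (if t0 = 0 then e - t0 else min (t0 - a) (e - t0))"
  have \<eta>': "0 < \<eta>'"
    using ab t0 h by (auto simp: \<eta>'_def a_def)
  have within: "t \<in> {a..e}" "at t within {0..1} = at t within {a..e}"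
    if t: "t \<in> {0..1}" "\<bar>t - t0\<bar> < \<eta>'" for t
  proof -
    have iff: "s \<in> {0..1} \<longleftrightarrow> s \<in> {a..e}" if "\<bar>s - t0\<bar> < \<eta>'" for s
      using that ab t0 h by (auto simp: \<eta>'_def a_def split: if_splits)
    show "t \<in> {a..e}" using iff t by blast
    show "at t within {0..1} = at t within {a..e}"
    proof (rule at_within_nhd)
      show "t \<in> {t0 - \<eta>'<..<t0 + \<eta>'}" using t by auto
      show "{0..1} \<inter> {t0 - \<eta>'<..<t0 + \<eta>'} - {t} = {a..e} \<inter> {t0 - \<eta>'<..<t0 + \<eta>'} - {t}"
        using iff by (auto simp: abs_less_iff)
    qed auto
  qed
  have t0e: "t0 \<in> {a..e}" using ab by simp
  have x0S: "?x0 \<in> cball ?x0 \<rho>" using \<rho>(1) by simp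
  have lin: "linear (\<lambda>w. dG \<phi> ?x0 (m.v t0) (m.v t0) w - dG \<phi> ?x0 w (m.v t0) (m.v t0) / 2)"
  proof (intro linear_compose_sub)
    show "linear (dG \<phi> ?x0 (m.v t0) (m.v t0))" using lm.dg_bilin[OF x0S] by (simp add: bilinear_def)
    have "linear (\<lambda>w. (1 / 2) *\<^sub>R dG \<phi> ?x0 w (m.v t0) (m.v t0))"
      by (intro linear_compose_scale_right lm.dg_linear x0S)
    then show "linear (\<lambda>w. dG \<phi> ?x0 w (m.v t0) (m.v t0) / 2)" by simp
  qed
  have "\<exists>z. \<forall>w. G \<phi> ?x0 z w = dG \<phi> ?x0 (m.v t0) (m.v t0) w - dG \<phi> ?x0 w (m.v t0) (m.v t0) / 2"
    by (rule lm.riesz[OF x0S lin]) blast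
  then obtain z where z: "\<And>w. G \<phi> ?x0 z w = dG \<phi> ?x0 (m.v t0) (m.v t0) w - dG \<phi> ?x0 w (m.v t0) (m.v t0) / 2"
    by blast
  show ?thesis
  proof (intro exI[of _ \<eta>'] exI[of _ m.v] exI[of _ z] conjI ballI impI allI)
    fix t :: real assume t: "t \<in> {0..1}" "\<bar>t - t0\<bar> < \<eta>'"
    show "(?c has_vector_derivative m.v t) (at t within {0..1})"
      using m.c_has_vector_derivative[OF within(1)[OF t]] within(2)[OF t] by simp
  next
    show "(m.v has_vector_derivative - z) (at t0 within {0..1})"
      using m.v_has_vector_derivative[OF t0e, of z] z within(2)[of t0] t0 \<eta>' by simp
  qed (fact \<eta>', fact z)
qed

text \<open>With both arguments equal to v the first two terms of the Christoffel formula coincide,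
  which leaves the factor 1/2 on the third only.\<close>

lemma christoffel_eqI:
  assumes \<phi>: "\<phi> \<in> A" "p \<in> cdom \<phi>"
    and z: "\<And>w. G \<phi> (cmap \<phi> p) z w = dG \<phi> (cmap \<phi> p) v v w - dG \<phi> (cmap \<phi> p) w v v / 2"
  shows "christoffel G \<phi> (cmap \<phi> p) v v = z"
proof -
  obtain \<rho> k C where \<rho>: "0 < \<rho>" "local_metric (G \<phi>) (dG \<phi>) (cball (cmap \<phi> p) \<rho>) k C"
    using chart_comparison[OF \<phi>] by metis
  interpret lm: local_metric "G \<phi>" "dG \<phi>" "cball (cmap \<phi> p) \<rho>" k C by (rule \<rho>(2))
  have S: "cmap \<phi> p \<in> cball (cmap \<phi> p) \<rho>" using \<rho>(1) by simp
  have uniq: "z' = z" if z': "\<And>w. G \<phi> (cmap \<phi> p) z' w = G \<phi> (cmap \<phi> p) z w" for z'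
  proof -
    have "linear (G \<phi> (cmap \<phi> p) z)" using lm.bilin[OF S] by (simp add: bilinear_def)
    from lm.riesz[OF S this] show ?thesis using z' by metis
  qed
  show ?thesis unfolding christoffel_def
  proof (rule the_equality)
    show "\<forall>w. G \<phi> (cmap \<phi> p) z w = (dG \<phi> (cmap \<phi> p) v v w + dG \<phi> (cmap \<phi> p) v v w - dG \<phi> (cmap \<phi> p) w v v) / 2"
      by (simp add: z)
    fix z' assume z': "\<forall>w. G \<phi> (cmap \<phi> p) z' w = (dG \<phi> (cmap \<phi> p) v v w + dG \<phi> (cmap \<phi> p) v v w - dG \<phi> (cmap \<phi> p) w v v) / 2"
    show "z' = z"
    proof (rule uniq)
      fix w show "G \<phi> (cmap \<phi> p) z' w = G \<phi> (cmap \<phi> p) z w"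
        using spec[OF z', of w] z[of w] by (simp add: field_simps)
    qed
  qed
qed

text \<open>Distinct endpoints make the speed d p q positive, as the local analysis
  requires.\<close>

lemma geodesic_exists:
  assumes "p \<noteq> q"
  obtains \<gamma> where "geodesic A G {0..1} \<gamma>" "\<gamma> 0 = p" "\<gamma> 1 = q"
proof -
  obtain c where c: "c 0 = p" "c 1 = q"
    and dc: "\<forall>s\<in>{0..1}. \<forall>t\<in>{0..1}. d (c s) (c t) = d p q * \<bar>t - s\<bar>"
    using metric_geodesic[of p q] by metis
  let ?L = "d p q"
  have L: "0 < ?L" using assms d_eq_0[of p q] d_nonneg[of p q] by linarith
  have cont: "continuous_on {0..1} c"
    unfolding continuous_on_def
  proof
    fix t :: real assume t: "t \<in> {0..1}"
    show "(c \<longlongrightarrow> c t) (at t within {0..1})"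
    proof (rule topological_tendstoI)
      fix U assume "open U" "c t \<in> U"
      then obtain \<epsilon> where \<epsilon>: "0 < \<epsilon>" "\<And>q'. d (c t) q' < \<epsilon> \<Longrightarrow> q' \<in> U"
        using d_ball_subset[of U "c t"] by metis
      show "\<forall>\<^sub>F s in at t within {0..1}. c s \<in> U"
        unfolding eventually_at
      proof (intro exI[of _ "\<epsilon> / ?L"] conjI ballI impI)
        fix s assume s: "s \<in> {0..1}" "s \<noteq> t \<and> dist s t < \<epsilon> / ?L"
        then have "d (c t) (c s) < \<epsilon>" using dc[rule_format, OF t s(1)] L by (simp add: dist_real_def field_simps)
        then show "c s \<in> U" by (rule \<epsilon>(2))
      qed (use \<epsilon> L in simp)
    qed
  qed
  have "geodesic A G {0..1} c"
    unfolding geodesic_def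
  proof (intro conjI ballI cont)
    show "is_interval {0..1::real}" by (simp add: is_interval_cc)
    fix \<phi> assume \<phi>: "\<phi> \<in> A"
    \<comment> \<open>\<open>geodesic\<close> asks for one velocity per chart, whereas the local
      velocities depend on t0; this function agrees with each of them near its t0.\<close>
    let ?v = "\<lambda>t. vector_derivative (cmap \<phi> \<circ> c) (at t within {0..1})"
    show "\<exists>v. \<forall>t\<in>{0..1}. c t \<in> cdom \<phi> \<longrightarrow>
        (cmap \<phi> \<circ> c has_vector_derivative v t) (at t within {0..1}) \<and>
        (v has_vector_derivative - christoffel G \<phi> (cmap \<phi> (c t)) (v t) (v t)) (at t within {0..1})"
    proof (intro exI[of _ ?v] ballI impI)
      fix t0 :: real assume t0: "t0 \<in> {0..1}" "c t0 \<in> cdom \<phi>"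
      let ?x0 = "cmap \<phi> (c t0)"
      have "\<exists>\<eta> v z. 0 < \<eta> \<and>
        (\<forall>t\<in>{0..1}. \<bar>t - t0\<bar> < \<eta> \<longrightarrow> (cmap \<phi> \<circ> c has_vector_derivative v t) (at t within {0..1})) \<and>
        (v has_vector_derivative - z) (at t0 within {0..1}) \<and>
        (\<forall>w. G \<phi> ?x0 z w = dG \<phi> ?x0 (v t0) (v t0) w - dG \<phi> ?x0 w (v t0) (v t0) / 2)"
      proof (cases "t0 < 1")
        case True
        with t0(1) show ?thesis by (intro local_geodesic[OF L dc] \<phi> t0(2)) auto
      next
        case False
        then have t1: "t0 = 1" using t0 by simp
        \<comment> \<open>Under t to 1 - t the velocity changes sign but its derivative does not,
          and the equation for z is quadratic in the velocity, so z carries over.\<close>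
        define c' where "c' t = c (1 - t)" for t
        have dc': "\<forall>s\<in>{0..1}. \<forall>t\<in>{0..1}. d (c' s) (c' t) = ?L * \<bar>t - s\<bar>"
        proof (intro ballI)
          fix s t :: real assume "s \<in> {0..1}" "t \<in> {0..1}"
          then show "d (c' s) (c' t) = ?L * \<bar>t - s\<bar>"
            using dc[rule_format, of "1 - s" "1 - t"] by (simp add: c'_def abs_minus_commute)
        qed
        have c'0: "c' 0 \<in> cdom \<phi>" using t0(2) t1 by (simp add: c'_def)
        obtain \<eta> v z where *: "0 < \<eta>"
            "\<And>t. t \<in> {0..1} \<Longrightarrow> \<bar>t - 0\<bar> < \<eta> \<Longrightarrow> (cmap \<phi> \<circ> c' has_vector_derivative v t) (at t within {0..1})"
            "(v has_vector_derivative - z) (at 0 within {0..1})"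
            "\<And>w. G \<phi> (cmap \<phi> (c' 0)) z w = dG \<phi> (cmap \<phi> (c' 0)) (v 0) (v 0) w - dG \<phi> (cmap \<phi> (c' 0)) w (v 0) (v 0) / 2"
          using local_geodesic[OF L dc' order_refl zero_less_one \<phi> c'0] by blast
        have refl: "(\<lambda>t. 1 - t) ` {0..1::real} = {0..1}" by simp
        have rd: "((\<lambda>t. 1 - t) has_vector_derivative - 1) (at t within {0..1::real})" for t
          by (auto intro!: derivative_eq_intros)
        have rev: "((\<lambda>t. f (1 - t)) has_vector_derivative - f') (at t within {0..1})"
          if "(f has_vector_derivative f') (at (1 - t) within {0..1})" for f :: "real \<Rightarrow> 'b" and f' t
          using vector_diff_chain_within[OF rd[of t], of f f'] that by (simp add: refl comp_def)
        define v' where "v' t = - v (1 - t)" for t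
        have "(cmap \<phi> \<circ> c has_vector_derivative v' t) (at t within {0..1})"
          if "t \<in> {0..1}" "\<bar>t - t0\<bar> < \<eta>" for t
        proof -
          have "(cmap \<phi> \<circ> c' has_vector_derivative v (1 - t)) (at (1 - t) within {0..1})"
            using that t1 by (intro *(2)) auto
          from rev[OF this] show ?thesis by (simp add: c'_def v'_def comp_def)
        qed
        moreover have "(v' has_vector_derivative - z) (at t0 within {0..1})"
          using has_vector_derivative_minus[OF rev[of v "- z" 1]] *(3) t1 by (simp add: v'_def[abs_def])
        moreover have "G \<phi> ?x0 z w = dG \<phi> ?x0 (v' t0) (v' t0) w - dG \<phi> ?x0 w (v' t0) (v' t0) / 2" for w
        proof -
          obtain \<rho> k C where \<rho>: "0 < \<rho>" "local_metric (G \<phi>) (dG \<phi>) (cball ?x0 \<rho>) k C"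
            using chart_comparison[OF \<phi> t0(2)] by metis
          interpret lm: local_metric "G \<phi>" "dG \<phi>" "cball ?x0 \<rho>" k C by (rule \<rho>(2))
          have S: "?x0 \<in> cball ?x0 \<rho>" using \<rho>(1) by simp
          have "dG \<phi> ?x0 (- u) (- u) w = dG \<phi> ?x0 u u w" "dG \<phi> ?x0 w (- u) (- u) = dG \<phi> ?x0 w u u" for u
            using linear_neg[OF lm.dg_linear[OF S, of "- u" w], of u]
              bilinear_lneg[OF lm.dg_bilin[OF S]] bilinear_rneg[OF lm.dg_bilin[OF S]] by simp_all
          then show ?thesis using *(4)[of w] t1 by (simp add: c'_def v'_def)
        qed
        ultimately show ?thesis using *(1) by blast
      qed
      then obtain \<eta> v z where \<eta>: "0 < \<eta>"
        and v: "\<And>t. t \<in> {0..1} \<Longrightarrow> \<bar>t - t0\<bar> < \<eta> \<Longrightarrow> (cmap \<phi> \<circ> c has_vector_derivative v t) (at t within {0..1})"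
        and vd: "(v has_vector_derivative - z) (at t0 within {0..1})"
        and z: "\<And>w. G \<phi> ?x0 z w = dG \<phi> ?x0 (v t0) (v t0) w - dG \<phi> ?x0 w (v t0) (v t0) / 2"
        by blast
      have eq: "?v t = v t" if "t \<in> {0..1}" "\<bar>t - t0\<bar> < \<eta>" for t
        using v[OF that] Icc_nontrivial[of 0 1 t] that(1) by (intro vector_derivative_within) auto
      have v0: "?v t0 = v t0" using eq[OF t0(1)] \<eta> by simp
      have "(?v has_vector_derivative - z) (at t0 within {0..1})"
        using has_vector_derivative_transform_within[OF vd \<eta> t0(1), of ?v] eq
        by (simp add: dist_real_def)
      moreover have "christoffel G \<phi> ?x0 (v t0) (v t0) = z" by (rule christoffel_eqI[OF \<phi> t0(2) z])
      ultimately show "(cmap \<phi> \<circ> c has_vector_derivative ?v t0) (at t0 within {0..1}) \<and>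
        (?v has_vector_derivative - christoffel G \<phi> ?x0 (?v t0) (?v t0)) (at t0 within {0..1})"
        using v[OF t0(1)] \<eta> v0 by simp
    qed
  qed
  then show ?thesis using c that by blast
qed

end

section \<open>The optimality criterion\<close>

lemma (in riemannian) velocity_tangent:
  assumes \<gamma>: "geodesic A G {0..1} \<gamma>"
  shows "velocity A {0..1} \<gamma> 0 \<in> tangent_space A (\<gamma> 0)"
  unfolding tangent_space_def mem_Collect_eq
proof (intro conjI ballI impI allI)
  fix \<phi> \<psi> assume \<phi>: "\<phi> \<in> A" "\<psi> \<in> A" "\<gamma> 0 \<in> cdom \<phi> \<inter> cdom \<psi>"
  have nt: "at 0 within {0..1::real} \<noteq> bot" using Icc_nontrivial[of 0 1 0] by simp
  obtain v where "\<forall>t\<in>{0..1}. \<gamma> t \<in> cdom \<phi> \<longrightarrow> (cmap \<phi> \<circ> \<gamma> has_vector_derivative v t) (at t within {0..1})"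
    using \<gamma> \<phi>(1) unfolding geodesic_def by blast
  then have v: "(cmap \<phi> \<circ> \<gamma> has_vector_derivative v 0) (at 0 within {0..1})" using \<phi> by simp
  have "continuous (at 0 within {0..1}) \<gamma>"
    using \<gamma> by (simp add: geodesic_def continuous_on_eq_continuous_within)
  then have "(cmap \<psi> \<circ> \<gamma> has_vector_derivative frechet_derivative (transition \<phi> \<psi>) (at (cmap \<phi> (\<gamma> 0))) (v 0))
      (at 0 within {0..1})"
    using \<phi> v by (intro change_chart) auto
  then show "velocity A {0..1} \<gamma> 0 \<psi> = frechet_derivative (transition \<phi> \<psi>) (at (cmap \<phi> (\<gamma> 0))) (velocity A {0..1} \<gamma> 0 \<phi>)"
    using \<phi> vector_derivative_within[OF nt v] vector_derivative_within[OF nt] by (simp add: velocity_def)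
qed (auto simp: velocity_def)

text \<open>The geodesic matters: with none in direction X, every real would vacuously be a
  directional derivative and \<open>THE\<close> would be unspecified.\<close>

lemma dir_derivative_eq:
  assumes "has_dir_derivative A G E h p0 X L" "geodesic_in_direction A G E p0 X I \<gamma>"
  shows "dir_derivative A G E h p0 X = L"
  unfolding dir_derivative_def
proof (rule the_equality)
  let ?q = "\<lambda>s. (h (\<gamma> s) - h p0) / s"
  fix L' assume "has_dir_derivative A G E h p0 X L'"
  then have "(?q \<longlongrightarrow> L') (at_right 0)" "(?q \<longlongrightarrow> L) (at_right 0)"
    using assms unfolding has_dir_derivative_def by blast+
  then show "L' = L" by (rule tendsto_unique[rotated]) simp
qed (fact assms(1))

text \<open>Convexity bounds each difference quotient along the geodesic by the increment over the
  whole unit interval, and the limit keeps the bound.\<close>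

lemma convex_dir_derivative_le:
  assumes h: "convex_at A G E h p0" "dir_differentiable_at A G E h p0"
    and \<gamma>: "geodesic A G {0..1} \<gamma>" "\<gamma> 0 = p0" "\<gamma> 1 = p" "p \<in> E"
    and X: "X \<in> tangent_directions A G E p0" "geodesic_in_direction A G E p0 X {0..1} \<gamma>"
  shows "dir_derivative A G E h p0 X \<le> h p - h p0"
proof -
  obtain L where L: "has_dir_derivative A G E h p0 X L"
    using h(2) X(1) by (auto simp: dir_differentiable_at_def)
  have "((\<lambda>s. (h (\<gamma> s) - h p0) / s) \<longlongrightarrow> L) (at_right 0)"
    using L X(2) by (simp add: has_dir_derivative_def)
  moreover have "\<forall>\<^sub>F s in at_right 0. (h (\<gamma> s) - h p0) / s \<le> h p - h p0"
    unfolding eventually_at_right_field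
  proof (intro exI[of _ 1] conjI allI impI)
    fix s :: real assume s: "0 < s" "s < 1"
    then have "h (\<gamma> s) \<le> (1 - s) * h p0 + s * h p" using h(1) \<gamma> by (auto simp: convex_at_def)
    then have "h (\<gamma> s) - h p0 \<le> (h p - h p0) * s" by (simp add: algebra_simps)
    then show "(h (\<gamma> s) - h p0) / s \<le> h p - h p0" using s by (simp add: divide_le_eq)
  qed simp
  ultimately have "L \<le> h p - h p0" by (rule tendsto_upperbound) simp
  then show ?thesis using dir_derivative_eq[OF L X(2)] by simp
qed

theorem theorem6p1:
  fixes A :: "('m::{t2_space, second_countable_topology}, 'e::euclidean_space) chart set"
    and G :: "('m, 'e) metric"
    and E X :: "'m set"
    and p0 :: 'm
    and f :: "'m \<Rightarrow> real"
    and g :: "nat \<Rightarrow> 'm \<Rightarrow> real"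
    and m :: nat
    and J :: "nat set"
    and \<mu> :: "nat \<Rightarrow> real"
  assumes "complete_riemannian_manifold A G"
    and "star_shaped_at A G E p0"
    and "X = feasible_set E m g"
    and "p0 \<in> X"
    and "J = {i \<in> {1..m}. g i p0 = 0}"
    and "convex_at A G E f p0"
    and "\<forall>i\<in>J. convex_at A G E (g i) p0"
    and "dir_differentiable_at A G E f p0"
    and "\<forall>i\<in>{1..m}. dir_differentiable_at A G E (g i) p0"
    and "\<forall>i\<in>{1..m}. \<mu> i \<ge> 0"
    and "\<forall>V\<in>tangent_directions A G E p0.
           dir_derivative A G E f p0 V + (\<Sum>i=1..m. \<mu> i * dir_derivative A G E (g i) p0 V) \<ge> 0"
    and "\<forall>i\<in>{1..m}. \<mu> i * g i p0 = 0"
  shows "optimal_solution f X p0 \<and>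
         (non_constant_on f X \<longrightarrow> strict_optimal_solution f X p0)"
proof -
  interpret riemannian_complete A G
    using assms(1) unfolding complete_riemannian_manifold_def by unfold_locales auto
  have min: "f p0 \<le> f p" if p: "p \<in> X" for p
  proof (cases "p = p0")
    case False
    have pE: "p \<in> E" "p0 \<in> E" using p assms(3,4) by (auto simp: feasible_set_def)
    obtain \<gamma> where \<gamma>: "geodesic A G {0..1} \<gamma>" "\<gamma> 0 = p0" "\<gamma> 1 = p"
      using geodesic_exists[of p0 p] False by metis
    define V where "V = velocity A {0..1} \<gamma> 0"
    \<comment> \<open>Star-shapedness covers the open interval and the endpoints lie in E anyway, so
      the whole geodesic witnesses that V is a tangent direction.\<close>
    have "\<gamma> s \<in> E" if s: "s \<in> {0..1}" for s
    proof -
      have "s = 0 \<or> s = 1 \<or> s \<in> {0<..<1}" using s by auto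
      then show ?thesis using assms(2) pE \<gamma> unfolding star_shaped_at_def by blast
    qed
    then have dir: "geodesic_in_direction A G E p0 V {0..1} \<gamma>"
      using \<gamma> unfolding geodesic_in_direction_def V_def by (auto intro!: exI[of _ "1::real"])
    have V: "V \<in> tangent_directions A G E p0"
      using velocity_tangent[OF \<gamma>(1)] dir \<gamma>(2) by (auto simp: tangent_directions_def V_def)
    have "(\<Sum>i=1..m. \<mu> i * dir_derivative A G E (g i) p0 V) \<le> 0"
    proof (rule sum_nonpos)
      fix i assume i: "i \<in> {1..m}"
      show "\<mu> i * dir_derivative A G E (g i) p0 V \<le> 0"
      proof (cases "g i p0 = 0")
        case True
        then have "convex_at A G E (g i) p0" using assms(5,7) i by simp
        then have "dir_derivative A G E (g i) p0 V \<le> g i p - g i p0"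
          using assms(9) i by (intro convex_dir_derivative_le[OF _ _ \<gamma> pE(1) V dir]) auto
        also have "\<dots> \<le> 0" using True p i assms(3) by (auto simp: feasible_set_def)
        finally show ?thesis using assms(10) i by (simp add: mult_nonneg_nonpos)
      next
        \<comment> \<open>For an inactive constraint, complementarity forces the multiplier to
          vanish.\<close>
        case False
        then have "\<mu> i = 0" using assms(12) i by (metis mult_eq_0_iff)
        then show ?thesis by simp
      qed
    qed
    moreover have "dir_derivative A G E f p0 V \<le> f p - f p0"
      using assms(6,8) by (intro convex_dir_derivative_le[OF _ _ \<gamma> pE(1) V dir])
    moreover have "dir_derivative A G E f p0 V + (\<Sum>i=1..m. \<mu> i * dir_derivative A G E (g i) p0 V) \<ge> 0"
      using assms(11) V by blast
    ultimately show ?thesis by linarith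
  qed simp
  then have "optimal_solution f X p0"
    using assms(4) by (force simp: optimal_solution_def)
  moreover have "strict_optimal_solution f X p0" if nc: "non_constant_on f X"
    unfolding strict_optimal_solution_def
  proof (intro conjI notI assms(4))
    assume "\<exists>p\<in>X. p \<noteq> p0 \<and> f p \<le> f p0"
    then obtain p where p: "p \<in> X" "p \<noteq> p0" "f p \<le> f p0" by blast
    \<comment> \<open>Optimality already gives the reverse inequality, and injectivity of f on X
      excludes equal values at distinct points.\<close>
    then have "f p = f p0" using min[OF p(1)] by simp
    then show False using nc p(1,2) assms(4) by (auto simp: non_constant_on_def)
  qed
  ultimately show ?thesis by blast
qed

end
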